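(* Let $r\ge 3$ be an integer and $\varepsilon\in(0,1/(r-2))$. There exist $c=c(r,\varepsilon)>0$ and $C=C(r,\varepsilon)>0$ such that for any pair of sequences $p=p_n$ and $q=q_n$ of probabilities, setting $\vartheta_q(n):=(n q_n^{(r+1)/2})^{2-r}$, we have \[ \lim_{n\to\infty}\mathbb{P}\big(\mathcal{R}^{(r)}(n,p)\text{ is }\varepsilon\text{-Turánnical for } G(n,q)\big)=\begin{cases}0,&\text{if } p_n\le c\,\vartheta_q(n)\text{ for all } n\in\mathbb{N},\\ 1,&\text{if } p_n\ge C\,\vartheta_q(n)\text{ for all } n\in\mathbb{N},\end{cases} \] where $\mathcal{R}^{(r)}(n,p)$ and $G(n,q)$ are chosen independently on the common vertex set $[n]$.
   Context: $\mathcal{R}^{(r)}(n,p)$ is the random $r$-uniform hypergraph on $[n]$ in which each $r$-subset is a hyperedge independently with probability $p$; $G(n,q)$ is the Erdős–Rényi random graph on $[n]$ with edge probability $q$. For an $n$-vertex graph $G$ and an $r$-uniform hypergraph $\mathcal{F}$ on the same vertex set, $\mathcal{F}$ is $\varepsilon$-Turánnical for $G$ if every subgraph of $G$ with more than $(1+\varepsilon)\frac{r-2}{r-1}e(G)$ edges contains a copy of $K_r$ whose vertex set is a hyperedge of $\mathcal{F}$.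
   Formalization: In the 0-case the hypothesis n²q_n → ∞ is added; without it the claim fails (e.g. q_n = n^{-3}, p_n = 0, where G(n,q) is a.a.s. edgeless and vacuously Turánnical). It is also necessary for the limit to be 0. The conditions on p_n need hold only for all large n. *)

theory Defs
  imports "HOL-Probability.Probability" "HOL-Library.Ramsey"
begin

text \<open>
  An \<open>r\<close>-uniform hypergraph on the vertex set \<open>{1..n}\<close> is represented by its set of
  hyperedges, a subset of \<open>nsets {1..n} r\<close>; a simple graph is the case \<open>r = 2\<close>.
  Isolated vertices play no role below, so subgraphs are subsets of the edge set.
\<close>

definition random_hypergraph :: "nat \<Rightarrow> nat \<Rightarrow> real \<Rightarrow> nat set set pmf" where
  "random_hypergraph r n p =
     map_pmf (\<lambda>X. {e \<in> nsets {1..n} r. X e})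
       (Pi_pmf (nsets {1..n} r) False (\<lambda>_. bernoulli_pmf p))"

abbreviation random_graph :: "nat \<Rightarrow> real \<Rightarrow> nat set set pmf" where
  "random_graph n q \<equiv> random_hypergraph 2 n q"

text \<open>
  Every \<open>F\<close> is vacuously \<open>\<epsilon>\<close>-Turannical for an edgeless \<open>G\<close>. Therefore the probability in question
  cannot tend to \<open>0\<close> unless \<open>G(n,q)\<close> has an edge with probability tending to \<open>1\<close>, i.e. unless
  \<open>n\<^sup>2 * q\<^sub>n\<close> tends to infinity.
\<close>

definition turannical :: "nat \<Rightarrow> real \<Rightarrow> 'a set set \<Rightarrow> 'a set set \<Rightarrow> bool" where
  "turannical r \<epsilon> F G \<longleftrightarrow>
     (\<forall>H. H \<subseteq> G \<and> real (card H) > (1 + \<epsilon>) * ((real r - 2) / (real r - 1)) * real (card G)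
        \<longrightarrow> (\<exists>X \<in> F. card X = r \<and> nsets X 2 \<subseteq> H))"

text \<open>
  The function \<open>(n * q\<^sub>n\<^bsup>(r+1)/2\<^esup>)\<^bsup>2-r\<^esup>\<close>. Since \<open>2 - r < 0\<close>, it is taken with values in
  \<^typ>\<open>ennreal\<close>, so that it is infinite (and not \<open>0\<close>, as for \<^const>\<open>powr\<close> on the reals) where \<open>q\<^sub>n = 0\<close>.
\<close>

definition theta :: "nat \<Rightarrow> (nat \<Rightarrow> real) \<Rightarrow> nat \<Rightarrow> ennreal" where
  "theta r q n = inverse (ennreal (real n * q n powr ((real r + 1) / 2)) ^ (r - 2))"

lemma theta_eq_powr:
  assumes "r \<ge> 2" "n > 0" "q n > 0"
  shows "theta r q n = ennreal ((real n * q n powr ((real r + 1) / 2)) powr (2 - real r))"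
proof -
  let ?x = "real n * q n powr ((real r + 1) / 2)"
  have x: "?x > 0" using assms by simp
  have "?x powr (2 - real r) = ?x powr (- real (r - 2))"
    using assms by (simp add: of_nat_diff)
  also have "\<dots> = inverse (?x ^ (r - 2))"
    using x by (simp only: powr_minus powr_realpow)
  finally have "?x powr (2 - real r) = inverse (?x ^ (r - 2))" .
  moreover have "theta r q n = ennreal (inverse (?x ^ (r - 2)))"
    unfolding theta_def using x by (simp only: ennreal_power inverse_ennreal zero_less_power less_imp_le)
  ultimately show ?thesis by simp
qed

lemma theta_eq_top: "r \<ge> 3 \<Longrightarrow> q n = 0 \<Longrightarrow> theta r q n = \<infinity>"
  by (simp add: theta_def)

end

theory Submission
  imports Defs "HOL-Real_Asymp.Real_Asymp"
begin

text \<open>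
  Let \<open>k = r choose 2\<close>, so that the inverse of the threshold function is \<open>n\<^bsup>r-2\<^esup> q\<^bsup>k-1\<^esup>\<close>.

  Below the threshold the number of cliques of \<open>G(n,q)\<close> spanned by hyperedges has expectation \<open>O(c n\<^sup>2 q)\<close>, and
  (by Markov for small \<open>q\<close>, by Chebyshev otherwise) is a small fraction of the number of edges with high
  probability. Deleting one edge from each such clique leaves more than \<open>(1+\<epsilon>)(r-2)/(r-1) e(G)\<close> edges.

  Above the threshold, a random Turan theorem with supersaturation says that, with high probability, every
  subgraph of \<open>G(n,q)\<close> with that many edges contains at least \<open>\<delta> n\<^sup>r q\<^sup>k\<close> cliques. The probability
  that none of them is a hyperedge is at most \<open>exp (-\<delta> p n\<^sup>r q\<^sup>k) \<le> exp (-\<delta> C n\<^sup>2 q)\<close>, which beats the number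
  of subgraphs. The random Turan theorem is proved at \<open>q\<^sub>0 = C\<^sub>0 n\<^bsup>-2/(r+1)\<^esup>\<close> with the container method
  (dense supersaturation comes from the Moon-Moser inequality) and transferred to larger \<open>q\<close>, together
  with the number of cliques, by viewing \<open>G(n,q\<^sub>0)\<close> as a random subgraph of \<open>G(n,q)\<close>.
\<close>

section \<open>Containers for weighted hypergraphs\<close>

text \<open>With \<open>k = r choose 2\<close>, the quantity \<open>n ^ (r-2) * q ^ (k-1)\<close>
  is, up to constants, the expected number of cliques of the random graph divided by the expected
  number of its edges; \<open>turan_scale\<close> is where it equals 1. As \<open>p \<le> 1\<close>,
  the hypothesis above the threshold already forces it above a constant, so only \<open>q\<close>
  above the Turan scale matter there. The obstacle is that containers bound clique-free subgraphs,
  whereas a union bound over all subgraphs of \<open>G\<close> needs order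
  \<open>n ^ r * q ^ k\<close> cliques in each of them. On the Turan scale cliques and edges have
  the same order, so a subgraph with few cliques becomes clique-free at the price of a small share
  of its edges; this is why sparsifying to that scale converts the qualitative statement into a
  count. The bad event for \<open>G\<close> only needs probability tending to 0, because the union
  bound over subgraphs is taken for a fixed \<open>G\<close>, over the randomness of
  \<open>F\<close>. Below the threshold, \<open>c\<close> may not depend on the error probability
  aimed at: a mean that is a fixed small fraction of the edges gives no vanishing bound by Markov,
  hence the variance.\<close>

text \<open>
  The fingerprint map \<open>g\<close> and the container map \<open>C\<close> are functions of the independent set \<open>I\<close>. The first
  condition makes \<open>C I = C (g I)\<close>, so there are only as many containers as fingerprints; the interval form
  \<open>g I \<subseteq> J \<subseteq> I\<close> is what survives composition of schemes.
\<close>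

definition is_scheme ::
  "'a set \<Rightarrow> ('a set \<Rightarrow> bool) \<Rightarrow> real \<Rightarrow> ('a set \<Rightarrow> bool) \<Rightarrow> ('a set \<Rightarrow> 'a set) \<Rightarrow> ('a set \<Rightarrow> 'a set) \<Rightarrow> bool" where
  "is_scheme V Q b P g C \<longleftrightarrow>
     (\<forall>I J. I \<subseteq> V \<longrightarrow> g I \<subseteq> J \<longrightarrow> J \<subseteq> I \<longrightarrow> g J = g I \<and> C J = C I) \<and>
     (\<forall>I. I \<subseteq> V \<longrightarrow> g I \<subseteq> I) \<and>
     (\<forall>I. I \<subseteq> V \<longrightarrow> Q I \<longrightarrow> real (card (g I)) \<le> b \<and> I \<subseteq> g I \<union> C I \<and> P (C I))"

definition containers :: "'a set \<Rightarrow> ('a set \<Rightarrow> bool) \<Rightarrow> real \<Rightarrow> ('a set \<Rightarrow> bool) \<Rightarrow> bool" where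
  "containers V Q b P \<longleftrightarrow> (\<exists>g C. is_scheme V Q b P g C)"

section \<open>Operations on container schemes\<close>

lemma is_schemeD:
  assumes "is_scheme V Q b P g C" "I \<subseteq> V"
  shows "g I \<subseteq> J \<Longrightarrow> J \<subseteq> I \<Longrightarrow> g J = g I \<and> C J = C I" "g I \<subseteq> I"
    "Q I \<Longrightarrow> real (card (g I)) \<le> b \<and> I \<subseteq> g I \<union> C I \<and> P (C I)"
proof -
  note s = assms(1)[unfolded is_scheme_def]
  show "g I \<subseteq> J \<Longrightarrow> J \<subseteq> I \<Longrightarrow> g J = g I \<and> C J = C I"
    using s[THEN conjunct1] assms(2) by metis
  show "g I \<subseteq> I"
    using s[THEN conjunct2, THEN conjunct1] assms(2) by metis
  show "Q I \<Longrightarrow> real (card (g I)) \<le> b \<and> I \<subseteq> g I \<union> C I \<and> P (C I)"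
    using s[THEN conjunct2, THEN conjunct2] assms(2) by metis
qed

lemma containers_trivial:
  assumes "\<And>I. I \<subseteq> V \<Longrightarrow> Q I \<Longrightarrow> I \<subseteq> D \<and> P D" "b \<ge> 0"
  shows "containers V Q b P"
  unfolding containers_def is_scheme_def
  by (rule exI[of _ "\<lambda>_. {}"], rule exI[of _ "\<lambda>_. D"]) (use assms in auto)

lemma containers_mono:
  assumes "containers V Q b P" "\<And>I. I \<subseteq> V \<Longrightarrow> Q' I \<Longrightarrow> Q I" "b \<le> b'" "\<And>C. P C \<Longrightarrow> P' C"
  shows "containers V Q' b' P'"
proof -
  obtain g C where s: "is_scheme V Q b P g C"
    using assms(1) by (auto simp: containers_def)
  have "is_scheme V Q' b' P' g C"
    unfolding is_scheme_def
  proof (intro conjI allI impI)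
    fix I J assume "I \<subseteq> V" "g I \<subseteq> J" "J \<subseteq> I"
    thus "g J = g I" "C J = C I" using is_schemeD(1)[OF s] by blast+
  next
    fix I assume I: "I \<subseteq> V"
    show "g I \<subseteq> I" using is_schemeD(2)[OF s I] .
    assume "Q' I"
    hence *: "real (card (g I)) \<le> b \<and> I \<subseteq> g I \<union> C I \<and> P (C I)"
      using is_schemeD(3)[OF s I] assms(2) I by blast
    thus "real (card (g I)) \<le> b'" using assms(3) by linarith
    show "I \<subseteq> g I \<union> C I" "P' (C I)" using * assms(4) by blast+
  qed
  thus ?thesis by (auto simp: containers_def)
qed

text \<open>One step of the container algorithm: if \<open>I\<close> meets the test set \<open>X\<close>, the first element of \<open>I \<inter> X\<close>
  in a fixed order joins the fingerprint.\<close>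

lemma containers_branch:
  assumes fin: "finite V" and X: "X \<subseteq> V"
    and c0: "containers V (\<lambda>I. Q I \<and> I \<inter> X = {}) b P"
    and c1: "\<And>v. v \<in> X \<Longrightarrow> containers V (\<lambda>I. Q I \<and> v \<in> I) (b - 1) P"
  shows "containers V Q b P"
proof -
  obtain h :: "'a \<Rightarrow> nat" where h: "inj_on h V"
    using fin finite_imp_inj_to_nat_seg by blast
  define pick where "pick I = arg_min_on h (I \<inter> X)" for I
  have pick_in: "pick I \<in> I \<inter> X" if "I \<subseteq> V" "I \<inter> X \<noteq> {}" for I
    unfolding pick_def using that fin by (intro arg_min_if_finite) (auto intro: finite_subset)
  have pick_le: "h (pick I) \<le> h u" if "I \<subseteq> V" "u \<in> I \<inter> X" for I u
  proof -
    have "finite (I \<inter> X)" "I \<inter> X \<noteq> {}" using that fin by (auto intro: finite_subset)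
    thus ?thesis unfolding pick_def using arg_min_if_finite(2)[of "I \<inter> X" h] that(2) by force
  qed
  \<comment> \<open>The minimum of \<open>I \<inter> X\<close> remains the minimum in every smaller
    set that still contains it. As \<open>pick I\<close> belongs to the fingerprint, this is the
    interval condition for the chosen branch.\<close>
  have pick_eq: "pick J = pick I" if "I \<subseteq> V" "pick I \<in> J" "J \<subseteq> I" "I \<inter> X \<noteq> {}" for I J
  proof -
    have 1: "pick I \<in> I \<inter> X" using pick_in that by blast
    hence 2: "pick J \<in> J \<inter> X" using that by (intro pick_in) auto
    have "h (pick J) \<le> h (pick I)" using 1 that by (intro pick_le) auto
    moreover have "h (pick I) \<le> h (pick J)" using 2 that by (intro pick_le) auto
    ultimately show ?thesis using h 1 2 that by (auto dest!: inj_onD)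
  qed
  obtain g0 C0 where s0: "is_scheme V (\<lambda>I. Q I \<and> I \<inter> X = {}) b P g0 C0"
    using c0 by (auto simp: containers_def)
  have "\<forall>v\<in>X. \<exists>gc. is_scheme V (\<lambda>I. Q I \<and> v \<in> I) (b - 1) P (fst gc) (snd gc)"
    using c1 by (auto simp: containers_def)
  from bchoice[OF this] obtain gc where
    s1: "\<And>v. v \<in> X \<Longrightarrow> is_scheme V (\<lambda>I. Q I \<and> v \<in> I) (b - 1) P (fst (gc v)) (snd (gc v))"
    by blast
  define g where "g I = (if I \<inter> X = {} then g0 I else insert (pick I) (fst (gc (pick I)) I))" for I
  define C where "C I = (if I \<inter> X = {} then C0 I else snd (gc (pick I)) I)" for I
  have "is_scheme V Q b P g C"
    unfolding is_scheme_def
  proof (intro conjI allI impI)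
    fix I J assume IJ: "I \<subseteq> V" "g I \<subseteq> J" "J \<subseteq> I"
    show "g J = g I" "C J = C I"
    proof (atomize(full), cases "I \<inter> X = {}")
      case True
      hence "J \<inter> X = {}" using IJ by auto
      thus "g J = g I \<and> C J = C I"
        using is_schemeD(1)[OF s0 IJ(1), of J] IJ True by (simp add: g_def C_def)
    next
      case False
      have p: "pick I \<in> J" using IJ False by (simp add: g_def)
      hence J: "J \<inter> X \<noteq> {}" using pick_in[OF IJ(1) False] by auto
      have e: "pick J = pick I" by (rule pick_eq[OF IJ(1) p IJ(3) False])
      have "is_scheme V (\<lambda>K. Q K \<and> pick I \<in> K) (b - 1) P (fst (gc (pick I))) (snd (gc (pick I)))"
        using s1[of "pick I"] pick_in[OF IJ(1) False] by simp
      moreover have "fst (gc (pick I)) I \<subseteq> J" using IJ(2) False by (simp add: g_def)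
      ultimately have "fst (gc (pick I)) J = fst (gc (pick I)) I \<and> snd (gc (pick I)) J = snd (gc (pick I)) I"
        using IJ by (intro is_schemeD(1))
      thus "g J = g I \<and> C J = C I" using J False e by (simp add: g_def C_def)
    qed
  next
    fix I assume I: "I \<subseteq> V"
    show "g I \<subseteq> I"
    proof (cases "I \<inter> X = {}")
      case True thus ?thesis using is_schemeD(2)[OF s0 I] by (simp add: g_def)
    next
      case False
      have p: "pick I \<in> I \<inter> X" by (rule pick_in[OF I False])
      hence "fst (gc (pick I)) I \<subseteq> I" using is_schemeD(2)[OF s1[of "pick I"] I] by blast
      thus ?thesis using False p by (simp add: g_def)
    qed
    assume Q: "Q I"
    show "real (card (g I)) \<le> b" "I \<subseteq> g I \<union> C I" "P (C I)"
    proof (atomize(full), cases "I \<inter> X = {}")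
      case True thus "real (card (g I)) \<le> b \<and> I \<subseteq> g I \<union> C I \<and> P (C I)"
        using is_schemeD(3)[OF s0 I] Q by (simp add: g_def C_def)
    next
      case False
      have p: "pick I \<in> I \<inter> X" by (rule pick_in[OF I False])
      let ?G = "fst (gc (pick I)) I"
      have *: "real (card ?G) \<le> b - 1 \<and> I \<subseteq> ?G \<union> snd (gc (pick I)) I \<and> P (snd (gc (pick I)) I)"
        using is_schemeD(3)[OF s1[of "pick I"] I] p Q by blast
      have "card (insert (pick I) ?G) \<le> Suc (card ?G)" by (rule card_insert_le_m1) auto
      hence "real (card (insert (pick I) ?G)) \<le> b" using * by linarith
      thus "real (card (g I)) \<le> b \<and> I \<subseteq> g I \<union> C I \<and> P (C I)"
        using * False by (auto simp: g_def C_def)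
    qed
  qed
  thus ?thesis by (auto simp: containers_def)
qed

text \<open>The container \<open>D\<close> of the first scheme is determined by the first
  fingerprint, so a second scheme on \<open>D\<close> can be run on \<open>I \<inter> D\<close>; the
  fingerprints are united. Downward closure of \<open>Q\<close> makes \<open>I \<inter> D\<close> an
  admissible input.\<close>

lemma containers_bind:
  assumes fin: "finite V"
    and c0: "containers V Q b P"
    and c1: "\<And>D. P D \<Longrightarrow> D \<subseteq> V \<and> containers D Q b' P'"
    and down: "\<And>I J. Q I \<Longrightarrow> J \<subseteq> I \<Longrightarrow> Q J"
  shows "containers V Q (b + b') P'"
proof -
  obtain g0 C0 where s0: "is_scheme V Q b P g0 C0"
    using c0 by (auto simp: containers_def)
  have "\<forall>D\<in>Collect P. \<exists>gc. is_scheme D Q b' P' (fst gc) (snd gc)"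
    using c1 by (auto simp: containers_def)
  from bchoice[OF this] obtain gc where
    s1: "\<And>D. P D \<Longrightarrow> is_scheme D Q b' P' (fst (gc D)) (snd (gc D))"
    by blast
  define g where "g I = g0 I \<union> (if P (C0 I) then fst (gc (C0 I)) (I \<inter> C0 I) else {})" for I
  define C where "C I = snd (gc (C0 I)) (I \<inter> C0 I)" for I
  \<comment> \<open>If \<open>Q I\<close> fails, \<open>P (C0 I)\<close> may fail too, and then
    nothing is known about \<open>gc (C0 I)\<close>. The default \<open>{}\<close> keeps the
    interval condition, which is required of all \<open>I\<close>.\<close>
  define C' where "C' I = (if P (C0 I) then C I else {})" for I
  have "is_scheme V Q (b + b') P' g C'"
    unfolding is_scheme_def
  proof (intro conjI allI impI)
    fix I J assume IJ: "I \<subseteq> V" "g I \<subseteq> J" "J \<subseteq> I"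
    have e0: "g0 J = g0 I \<and> C0 J = C0 I"
      using is_schemeD(1)[OF s0 IJ(1), of J] IJ by (simp add: g_def)
    show "g J = g I" "C' J = C' I"
    proof (atomize(full), cases "P (C0 I)")
      case True
      let ?D = "C0 I"
      have s: "is_scheme ?D Q b' P' (fst (gc ?D)) (snd (gc ?D))" using s1 True by blast
      hence "fst (gc ?D) (I \<inter> ?D) \<subseteq> I \<inter> ?D" by (rule is_schemeD(2)) auto
      moreover have "fst (gc ?D) (I \<inter> ?D) \<subseteq> J" using IJ(2) True by (simp add: g_def)
      ultimately have "fst (gc ?D) (I \<inter> ?D) \<subseteq> J \<inter> ?D" by blast
      moreover have "J \<inter> ?D \<subseteq> I \<inter> ?D" using IJ by auto
      ultimately have "fst (gc ?D) (J \<inter> ?D) = fst (gc ?D) (I \<inter> ?D) \<and> snd (gc ?D) (J \<inter> ?D) = snd (gc ?D) (I \<inter> ?D)"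
        using is_schemeD(1)[OF s, of "I \<inter> ?D" "J \<inter> ?D"] by blast
      thus "g J = g I \<and> C' J = C' I" using e0 by (simp add: g_def C_def C'_def)
    next
      case False thus "g J = g I \<and> C' J = C' I" using e0 by (simp add: g_def C'_def)
    qed
  next
    fix I assume I: "I \<subseteq> V"
    show "g I \<subseteq> I"
    proof (cases "P (C0 I)")
      case True
      have "fst (gc (C0 I)) (I \<inter> C0 I) \<subseteq> I \<inter> C0 I"
        using is_schemeD(2)[OF s1[OF True], of "I \<inter> C0 I"] by blast
      thus ?thesis using is_schemeD(2)[OF s0 I] by (auto simp: g_def)
    next
      case False thus ?thesis using is_schemeD(2)[OF s0 I] by (simp add: g_def)
    qed
    assume Q: "Q I"
    have 0: "real (card (g0 I)) \<le> b" "I \<subseteq> g0 I \<union> C0 I" "P (C0 I)"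
      using is_schemeD(3)[OF s0 I Q] by auto
    have QD: "Q (I \<inter> C0 I)" by (rule down[OF Q]) auto
    let ?G = "fst (gc (C0 I)) (I \<inter> C0 I)"
    have 1: "real (card ?G) \<le> b'" "I \<inter> C0 I \<subseteq> ?G \<union> C I" "P' (C I)"
      using is_schemeD(3)[OF s1[OF 0(3)], of "I \<inter> C0 I"] QD by (auto simp: C_def)
    have "card (g I) \<le> card (g0 I) + card ?G" using 0(3) by (simp add: g_def card_Un_le)
    thus "real (card (g I)) \<le> b + b'" using 0 1 by linarith
    show "I \<subseteq> g I \<union> C' I" "P' (C' I)" using 0 1 by (auto simp: g_def C'_def)
  qed
  thus ?thesis by (auto simp: containers_def)
qed

section \<open>Weighted degrees and a single container step\<close>

definition wdeg :: "'a set \<Rightarrow> nat \<Rightarrow> ('a set \<Rightarrow> real) \<Rightarrow> 'a set \<Rightarrow> real" where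
  "wdeg V k w T = sum w {f \<in> nsets V k. T \<subseteq> f}"

lemma wdeg_nonneg: "(\<And>f. w f \<ge> 0) \<Longrightarrow> wdeg V k w T \<ge> 0"
  unfolding wdeg_def by (intro sum_nonneg) auto

lemma wdeg_eq_if:
  assumes "finite V"
  shows "wdeg V k w T = (\<Sum>f\<in>nsets V k. if T \<subseteq> f then w f else 0)"
  unfolding wdeg_def using assms by (intro sum.inter_filter) (simp add: finite_imp_finite_nsets)

text \<open>Inserting \<open>v\<close> maps the \<open>k\<close>-sets avoiding \<open>v\<close>
  bijectively onto the \<open>(k+1)\<close>-sets containing it, so adding the link of
  \<open>v\<close> in \<open>A\<close> to \<open>B\<close> raises the degree of \<open>T\<close> by
  the degree of \<open>insert v T\<close>. A set \<open>T\<close> that contains \<open>v\<close>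
  lies in no link edge.\<close>

lemma wdeg_link:
  assumes "finite V" "v \<in> V" "T \<subseteq> V"
  shows "wdeg V k (\<lambda>f. B f + (if v \<in> f then 0 else A (insert v f))) T
       = wdeg V k B T + (if v \<in> T then 0 else wdeg V (Suc k) A (insert v T))"
proof -
  let ?S = "{f \<in> nsets V k. T \<subseteq> f}"
  have fin: "finite ?S" using assms by (simp add: finite_imp_finite_nsets)
  have "(\<Sum>f\<in>?S. if v \<in> f then 0 else A (insert v f)) = (\<Sum>f\<in>{f\<in>?S. v \<notin> f}. A (insert v f))"
    using fin by (subst sum.inter_filter) (auto intro!: sum.cong)
  also have "\<dots> = (if v \<in> T then 0 else wdeg V (Suc k) A (insert v T))"
  proof (cases "v \<in> T")
    case True thus ?thesis by (auto intro!: sum.neutral)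
  next
    case False
    have "(\<Sum>f\<in>{f\<in>?S. v \<notin> f}. A (insert v f)) = sum A {f \<in> nsets V (Suc k). insert v T \<subseteq> f}"
    proof (rule sum.reindex_bij_witness[where i = "\<lambda>e. e - {v}" and j = "insert v"])
      fix e assume "e \<in> {f \<in> nsets V (Suc k). insert v T \<subseteq> f}"
      thus "e - {v} \<in> {f\<in>?S. v \<notin> f}" using False by (auto simp: nsets_def)
    qed (use assms False in \<open>auto simp: nsets_def insert_absorb\<close>)
    thus ?thesis using False by (simp add: wdeg_def)
  qed
  finally show ?thesis by (simp add: wdeg_def sum.distrib)
qed

lemma wdeg_handshake:
  assumes "finite V"
  shows "(\<Sum>u\<in>V. wdeg V k A {u}) = real k * wdeg V k A {}"
proof -
  have fin: "finite (nsets V k)" using assms by (simp add: finite_imp_finite_nsets)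
  have "(\<Sum>u\<in>V. wdeg V k A {u}) = (\<Sum>u\<in>V. \<Sum>f\<in>nsets V k. if u \<in> f then A f else 0)"
    by (simp add: wdeg_eq_if[OF assms])
  also have "\<dots> = (\<Sum>f\<in>nsets V k. \<Sum>u\<in>V. if u \<in> f then A f else 0)" by (rule sum.swap)
  also have "\<dots> = (\<Sum>f\<in>nsets V k. real k * A f)"
  proof (intro sum.cong refl)
    fix f assume f: "f \<in> nsets V k"
    hence "{u\<in>V. u \<in> f} = f" by (auto simp: nsets_def)
    thus "(\<Sum>u\<in>V. if u \<in> f then A f else 0) = real k * A f"
      using f assms by (simp add: sum.inter_filter[symmetric] nsets_def)
  qed
  finally show ?thesis by (simp add: wdeg_def sum_distrib_left)
qed

text \<open>Every edge has \<open>2 ^ k\<close> subsets. The saturation level carries the factor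
  \<open>2 ^ (k + 1)\<close> to compensate for this and to gain another factor 2.\<close>

lemma wdeg_sum_Pow:
  assumes "finite V"
  shows "(\<Sum>T\<in>Pow V. wdeg V k B T) = 2 ^ k * wdeg V k B {}"
proof -
  have fin: "finite (nsets V k)" using assms by (simp add: finite_imp_finite_nsets)
  have "(\<Sum>T\<in>Pow V. wdeg V k B T) = (\<Sum>T\<in>Pow V. \<Sum>f\<in>nsets V k. if T \<subseteq> f then B f else 0)"
    by (simp only: wdeg_eq_if[OF \<open>finite V\<close>])
  also have "\<dots> = (\<Sum>f\<in>nsets V k. \<Sum>T\<in>Pow V. if T \<subseteq> f then B f else 0)" by (rule sum.swap)
  also have "\<dots> = (\<Sum>f\<in>nsets V k. 2 ^ k * B f)"
  proof (intro sum.cong refl)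
    fix f assume f: "f \<in> nsets V k"
    hence "{T\<in>Pow V. T \<subseteq> f} = Pow f" by (auto simp: nsets_def)
    thus "(\<Sum>T\<in>Pow V. if T \<subseteq> f then B f else 0) = 2 ^ k * B f"
      using f assms by (simp add: sum.inter_filter[symmetric] nsets_def card_Pow)
  qed
  finally show ?thesis by (simp add: wdeg_def sum_distrib_left)
qed

lemma wdeg_removal:
  assumes "finite V" "finite S" and w: "\<And>f. w f \<ge> 0"
  shows "wdeg V k w {} - wdeg V k (\<lambda>f. if \<exists>T\<in>S. T \<subseteq> f then 0 else w f) {} \<le> (\<Sum>T\<in>S. wdeg V k w T)"
proof -
  have fin: "finite (nsets V k)" using assms by (simp add: finite_imp_finite_nsets)
  have "wdeg V k w {} - wdeg V k (\<lambda>f. if \<exists>T\<in>S. T \<subseteq> f then 0 else w f) {}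
      = (\<Sum>f\<in>nsets V k. if \<exists>T\<in>S. T \<subseteq> f then w f else 0)"
    by (simp add: wdeg_def sum_subtractf[symmetric]) (intro sum.cong, auto)
  also have "\<dots> \<le> (\<Sum>f\<in>nsets V k. \<Sum>T\<in>S. if T \<subseteq> f then w f else 0)"
  proof (intro sum_mono)
    fix f
    show "(if \<exists>T\<in>S. T \<subseteq> f then w f else 0) \<le> (\<Sum>T\<in>S. if T \<subseteq> f then w f else 0)"
    proof (cases "\<exists>T\<in>S. T \<subseteq> f")
      case True
      then obtain T where T: "T \<in> S" "T \<subseteq> f" by blast
      have "(if T \<subseteq> f then w f else 0) \<le> (\<Sum>T\<in>S. if T \<subseteq> f then w f else 0)"
        using T assms by (intro member_le_sum) auto
      thus ?thesis using T True by simp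
    qed (auto intro!: sum_nonneg w)
  qed
  also have "\<dots> = (\<Sum>T\<in>S. \<Sum>f\<in>nsets V k. if T \<subseteq> f then w f else 0)" by (rule sum.swap)
  also have "\<dots> = (\<Sum>T\<in>S. wdeg V k w T)"
    by (simp only: wdeg_eq_if[OF \<open>finite V\<close>])
  finally show ?thesis .
qed

text \<open>The degree condition of the container method: \<open>wdeg V k w {}\<close> is the total
  weight, so total weight over \<open>card V\<close> is the average degree up to the factor
  \<open>k\<close>, and each further element of \<open>T\<close> must save a factor
  \<open>\<tau>\<close>.\<close>

definition spread :: "real \<Rightarrow> real \<Rightarrow> 'a set \<Rightarrow> nat \<Rightarrow> ('a set \<Rightarrow> real) \<Rightarrow> bool" where
  "spread K \<tau> V k w \<longleftrightarrow> (\<forall>f. w f \<ge> 0) \<and>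
     (\<forall>T. T \<subseteq> V \<longrightarrow> T \<noteq> {} \<longrightarrow> card T \<le> k \<longrightarrow>
        wdeg V k w T \<le> K * \<tau> ^ (card T - 1) * wdeg V k w {} / card V)"

text \<open>Independence in the support of \<open>w\<close>. No ground set occurs, so the same
  predicate can be used when the iteration passes from \<open>V\<close> to a container inside
  it.\<close>

definition wfree :: "nat \<Rightarrow> ('a set \<Rightarrow> real) \<Rightarrow> 'a set \<Rightarrow> bool" where
  "wfree k w I \<longleftrightarrow> (\<forall>f. card f = k \<longrightarrow> finite f \<longrightarrow> w f > 0 \<longrightarrow> \<not> f \<subseteq> I)"

text \<open>
  \<open>w\<close> is the current \<open>(k+1)\<close>-uniform hypergraph and \<open>B\<close> the \<open>k\<close>-uniform one collected so far from links of
  fingerprint vertices. \<open>S\<close> consists of the sets whose degree in \<open>B\<close> is saturated. While \<open>B\<close> is light,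
  discarding the edges above \<open>S\<close> costs at most half of \<open>w\<close>, hence many vertices keep a large degree.
\<close>

lemma low_degree_vertices:
  fixes V :: "'a set" and w B :: "'a set \<Rightarrow> real"
  assumes fin: "finite V" and ne: "V \<noteq> {}" and K: "K \<ge> 1" and \<tau>: "0 < \<tau>"
    and spr: "spread K \<tau> V (Suc k) w" and e: "e = wdeg V (Suc k) w {}" "e > 0"
    and B: "\<And>f. B f \<ge> 0" "wdeg V k B {} < \<tau> * e"
    and S: "S = {T. T \<subseteq> V \<and> T \<noteq> {} \<and> card T \<le> k \<and>
              2 ^ (k + 1) * K * \<tau> ^ card T * e / card V \<le> wdeg V k B T}"
    and A: "A = (\<lambda>f. if \<exists>T\<in>S. T \<subseteq> f then 0 else w f)"
    and X: "X = {u\<in>V. wdeg V (Suc k) A {u} \<ge> e / (4 * card V)}"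
  shows "real (card (V - X)) \<le> (1 - 1 / (4 * K)) * card V"
proof -
  define N where "N = real (card V)"
  have N: "N > 0" using fin ne by (simp add: N_def card_gt_0_iff)
  have w: "w f \<ge> 0" for f using spr by (auto simp: spread_def)
  have finS: "finite S" using fin unfolding S by (intro finite_subset[OF _ finite_Pow_iff[THEN iffD2, OF fin]]) auto
  \<comment> \<open>The saturation level of \<open>T\<close> is \<open>2 ^ (k + 1) * \<tau>\<close>
    times the bound that \<open>spread\<close> gives for its degree in \<open>w\<close>. The loss in
    \<open>w\<close> is therefore charged to degrees in \<open>B\<close>, whose total weight is
    below \<open>\<tau> * e\<close>.\<close>
  have "(\<Sum>T\<in>S. wdeg V (Suc k) w T) \<le> (\<Sum>T\<in>S. wdeg V k B T / (2 ^ (k + 1) * \<tau>))"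
  proof (intro sum_mono)
    fix T assume T: "T \<in> S"
    hence cT: "card T > 0" using fin by (auto simp: S card_gt_0_iff dest: finite_subset)
    have "wdeg V (Suc k) w T \<le> K * \<tau> ^ (card T - 1) * e / N"
      using spr T unfolding spread_def S N_def e by auto
    also have "\<dots> = (2 ^ (k + 1) * K * \<tau> ^ card T * e / N) / (2 ^ (k + 1) * \<tau>)"
      using \<tau> N cT by (cases "card T") (auto simp: field_simps)
    also have "\<dots> \<le> wdeg V k B T / (2 ^ (k + 1) * \<tau>)"
      using T \<tau> unfolding S N_def by (intro divide_right_mono) auto
    finally show "wdeg V (Suc k) w T \<le> wdeg V k B T / (2 ^ (k + 1) * \<tau>)" .
  qed
  also have "\<dots> = (\<Sum>T\<in>S. wdeg V k B T) / (2 ^ (k + 1) * \<tau>)" by (simp add: sum_divide_distrib)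
  also have "\<dots> \<le> (\<Sum>T\<in>Pow V. wdeg V k B T) / (2 ^ (k + 1) * \<tau>)"
    using \<tau> fin B(1) by (intro divide_right_mono sum_mono2) (auto simp: S wdeg_nonneg)
  also have "\<dots> = wdeg V k B {} / (2 * \<tau>)" using \<tau> by (simp add: wdeg_sum_Pow fin)
  also have "\<dots> \<le> e / 2" using B(2) \<tau> by (simp add: field_simps)
  finally have "e - wdeg V (Suc k) A {} \<le> e / 2"
    using wdeg_removal[OF fin finS, of w "Suc k", OF w] unfolding A e by linarith
  hence "e / 2 \<le> wdeg V (Suc k) A {}" by linarith
  also have "\<dots> \<le> real (Suc k) * wdeg V (Suc k) A {}"
    using wdeg_nonneg[of A V "Suc k" "{}"] w by (auto simp: A algebra_simps)
  also have "\<dots> = (\<Sum>u\<in>V. wdeg V (Suc k) A {u})" by (simp add: wdeg_handshake fin)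
  \<comment> \<open>Vertices outside \<open>X\<close> together account for at most
    \<open>e / 4\<close> of the remaining \<open>e / 2\<close>, and a vertex of \<open>X\<close> for
    at most \<open>K * e / N\<close> by \<open>spread\<close> on singletons. Hence \<open>X\<close>
    has at least \<open>N / (4 * K)\<close> vertices.\<close>
  also have "\<dots> \<le> (\<Sum>u\<in>V. e / (4 * N) + (if u \<in> X then K * e / N else 0))"
  proof (intro sum_mono)
    fix u assume u: "u \<in> V"
    show "wdeg V (Suc k) A {u} \<le> e / (4 * N) + (if u \<in> X then K * e / N else 0)"
    proof (cases "u \<in> X")
      case True
      have "wdeg V (Suc k) A {u} \<le> wdeg V (Suc k) w {u}"
        unfolding wdeg_def by (intro sum_mono) (auto simp: A w)
      also have "\<dots> \<le> K * \<tau> ^ (card {u} - 1) * e / N"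
        using spr u unfolding spread_def N_def e by (metis One_nat_def card.empty card_insert_disjoint empty_iff empty_not_insert empty_subsetI finite.emptyI insert_subset le_add1 plus_1_eq_Suc)
      finally show ?thesis using True e(2) N by (auto intro: order_trans)
    qed (use u in \<open>auto simp: X N_def\<close>)
  qed
  also have "\<dots> = e / 4 + real (card X) * (K * e / N)"
  proof -
    have "X \<subseteq> V" by (auto simp: X)
    hence "V \<inter> X = X" by auto
    thus ?thesis using fin N ne by (simp add: sum.distrib sum.If_cases N_def)
  qed
  finally have "e / 4 \<le> real (card X) * (K * e / N)" by linarith
  hence "N / (4 * K) \<le> real (card X)" using e(2) N K by (simp add: field_simps)
  moreover have "card (V - X) = card V - card X" "card X \<le> card V"
    using fin by (auto simp: X intro!: card_Diff_subset card_mono)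
  ultimately show ?thesis by (simp add: N_def algebra_simps)
qed

text \<open>By induction on the uniformity: either the fingerprint avoids all vertices of large degree, or enough
  links have been collected to continue with the hypergraph \<open>B\<close> of smaller uniformity.\<close>

lemma container_step:
  assumes "K \<ge> 1"
  shows "\<exists>c>0. \<forall>(V::'a set) w \<tau>. finite V \<longrightarrow> V \<noteq> {} \<longrightarrow> 0 < \<tau> \<longrightarrow> spread K \<tau> V k w \<longrightarrow>
     wdeg V k w {} > 0 \<longrightarrow>
     containers V (wfree k w) (real k * (4 * \<tau> * card V + 1))
       (\<lambda>C. C \<subseteq> V \<and> real (card C) \<le> (1 - c) * real (card V))"
  using assms
proof (induction k arbitrary: K)
  case 0
  show ?case
  proof (intro exI[of _ "1::real"] conjI allI impI)
    fix V :: "'a set" and w :: "'a set \<Rightarrow> real" and \<tau> :: real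
    assume "wdeg V 0 w {} > 0"
    hence "w {} > 0" by (simp add: wdeg_def)
    \<comment> \<open>The only edge is \<open>{}\<close>, which lies in every set, so there is no
      independent set to contain.\<close>
    hence no: "\<not> wfree 0 w I" for I unfolding wfree_def
      by (metis card.empty empty_subsetI finite.emptyI)
    show "containers V (wfree 0 w) (real 0 * (4 * \<tau> * card V + 1))
       (\<lambda>C. C \<subseteq> V \<and> real (card C) \<le> (1 - 1) * real (card V))"
      using no by (intro containers_trivial) auto
  qed auto
next
  case (Suc k)
  \<comment> \<open>A degree in \<open>B\<close> grows only while unsaturated, that is, at most
    \<open>2 ^ (k + 1) * K\<close> in units of \<open>\<tau> ^ card T * e / N\<close>, and one link
    adds at most \<open>K\<close> such units.\<close>
  define K' where "K' = 2 ^ (k + 1) * K + K"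
  have "K' \<ge> 1" using Suc.prems unfolding K'_def by (intro add_increasing) auto
  from Suc.IH[OF this] obtain c0 where c0: "c0 > 0" and IH:
    "\<forall>(V::'a set) w \<tau>. finite V \<longrightarrow> V \<noteq> {} \<longrightarrow> 0 < \<tau> \<longrightarrow> spread K' \<tau> V k w \<longrightarrow>
     wdeg V k w {} > 0 \<longrightarrow>
     containers V (wfree k w) (real k * (4 * \<tau> * card V + 1))
       (\<lambda>C. C \<subseteq> V \<and> real (card C) \<le> (1 - c0) * real (card V))" by (elim exE conjE)
  \<comment> \<open>A container is either \<open>V - X\<close>, which misses a fraction
    \<open>1 / (4 * K)\<close>, or one obtained from the \<open>k\<close>-uniform hypergraph
    \<open>B\<close>, which misses a fraction \<open>c0\<close>.\<close>
  define c where "c = min c0 (1 / (4 * K))"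
  have c: "c > 0" "c \<le> c0" "c \<le> 1 / (4 * K)" using c0 Suc.prems by (auto simp: c_def)
  show ?case
  proof (intro exI[of _ c] conjI allI impI)
    show "c > 0" by fact
    fix V :: "'a set" and w :: "'a set \<Rightarrow> real" and \<tau> :: real
    assume fin: "finite V" and ne: "V \<noteq> {}" and \<tau>: "0 < \<tau>"
      and spr: "spread K \<tau> V (Suc k) w" and pos: "wdeg V (Suc k) w {} > 0"
    define N where "N = real (card V)"
    define e where "e = wdeg V (Suc k) w {}"
    define P where "P C \<longleftrightarrow> C \<subseteq> V \<and> real (card C) \<le> (1 - c) * N" for C
    have N: "N > 0" using fin ne by (simp add: N_def card_gt_0_iff)
    have e: "e > 0" using pos by (simp add: e_def)
    have w: "w f \<ge> 0" for f using spr by (auto simp: spread_def)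
    \<comment> \<open>The bound is written with \<open>e\<close> rather than with the current weight
      of \<open>B\<close>. Once that weight reaches \<open>\<tau> * e\<close>, one factor
      \<open>\<tau>\<close> is absorbed by it and the invariant becomes
      \<open>spread K' \<tau> V k B\<close>.\<close>
    define inv where "inv B \<longleftrightarrow> (\<forall>f. B f \<ge> 0) \<and> (\<forall>T. T \<subseteq> V \<longrightarrow> T \<noteq> {} \<longrightarrow> card T \<le> k \<longrightarrow>
       wdeg V k B T \<le> K' * \<tau> ^ card T * e / N)" for B
    have big_case: "containers V (\<lambda>I. wfree (Suc k) w I \<and> wfree k B I) (real m + real k * (4 * \<tau> * N + 1)) P"
      if "inv B" and big: "wdeg V k B {} \<ge> \<tau> * e" for m B
    proof -
      have "wdeg V k B {} > 0" using big e \<tau> by (smt (verit) mult_pos_pos)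
      moreover have "spread K' \<tau> V k B"
        unfolding spread_def
      proof (intro conjI allI impI)
        fix T assume T: "T \<subseteq> V" "T \<noteq> {}" "card T \<le> k"
        hence cT: "card T > 0" using fin by (auto simp: card_gt_0_iff dest: finite_subset)
        have "wdeg V k B T \<le> K' * \<tau> ^ card T * e / N" using \<open>inv B\<close> T by (auto simp: inv_def)
        also have "\<dots> = K' * \<tau> ^ (card T - 1) * (\<tau> * e) / N" using cT by (cases "card T") auto
        also have "\<dots> \<le> K' * \<tau> ^ (card T - 1) * wdeg V k B {} / N"
          using big N \<tau> \<open>K' \<ge> 1\<close> by (intro divide_right_mono mult_left_mono) auto
        finally show "wdeg V k B T \<le> K' * \<tau> ^ (card T - 1) * wdeg V k B {} / card V"
          by (simp add: N_def)
      qed (use \<open>inv B\<close> in \<open>auto simp: inv_def\<close>)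
      ultimately have *: "containers V (wfree k B) (real k * (4 * \<tau> * N + 1))
          (\<lambda>C. C \<subseteq> V \<and> real (card C) \<le> (1 - c0) * N)"
        unfolding N_def using IH fin ne \<tau> by blast
      have "(1 - c0) * N \<le> (1 - c) * N" using c N by (intro mult_right_mono) auto
      thus ?thesis
        by (intro containers_mono[OF *]) (auto simp: P_def)
    qed
    \<comment> \<open>Here \<open>m\<close> bounds the number of fingerprint vertices still to be
      chosen at this level: each of them adds at least \<open>e / (4 * N)\<close> to the weight of
      \<open>B\<close>, which has to reach \<open>\<tau> * e\<close>.\<close>
    have main: "containers V (\<lambda>I. wfree (Suc k) w I \<and> wfree k B I) (real m + real k * (4 * \<tau> * N + 1)) P"
      if "inv B" "\<tau> * e - wdeg V k B {} \<le> real m * (e / (4 * N))" for m B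
      using that
    proof (induction m arbitrary: B)
      case 0
      thus ?case by (intro big_case) auto
    next
      case (Suc m)
      note B = Suc.prems(1)
      have B0: "B f \<ge> 0" for f using B by (auto simp: inv_def)
      show ?case
      proof (cases "wdeg V k B {} \<ge> \<tau> * e")
        case True thus ?thesis using B by (intro big_case)
      next
        case False
        define S where "S = {T. T \<subseteq> V \<and> T \<noteq> {} \<and> card T \<le> k \<and>
              2 ^ (k + 1) * K * \<tau> ^ card T * e / card V \<le> wdeg V k B T}"
        define A where "A = (\<lambda>f. if \<exists>T\<in>S. T \<subseteq> f then 0 else w f)"
        define X where "X = {u\<in>V. wdeg V (Suc k) A {u} \<ge> e / (4 * card V)}"
        have A0: "A f \<ge> 0" for f by (simp add: A_def w)
        have "real (card (V - X)) \<le> (1 - 1 / (4 * K)) * N"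
          unfolding N_def using False B0
          by (intro low_degree_vertices[OF fin ne \<open>K \<ge> 1\<close> \<tau> spr e_def e _ _ S_def A_def X_def]) auto
        also have "\<dots> \<le> (1 - c) * N" using c N by (intro mult_right_mono) auto
        finally have PX: "P (V - X)" by (simp add: P_def)
        show ?thesis
        proof (rule containers_branch[OF fin])
          show "X \<subseteq> V" by (auto simp: X_def)
          show "containers V (\<lambda>I. (wfree (Suc k) w I \<and> wfree k B I) \<and> I \<inter> X = {})
             (real (Suc m) + real k * (4 * \<tau> * N + 1)) P"
            using PX \<tau> N by (intro containers_trivial[where D = "V - X"]) auto
          fix v assume v: "v \<in> X"
          hence vV: "v \<in> V" by (auto simp: X_def)
          define B' where "B' = (\<lambda>f. B f + (if v \<in> f then 0 else A (insert v f)))"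
          have link: "wdeg V k B' T = wdeg V k B T + (if v \<in> T then 0 else wdeg V (Suc k) A (insert v T))"
            if "T \<subseteq> V" for T
            unfolding B'_def by (rule wdeg_link[OF fin vV that])
          have "inv B'"
            unfolding inv_def
          proof (intro conjI allI impI)
            fix f show "B' f \<ge> 0" by (simp add: B'_def A0 B0)
          next
            fix T assume T: "T \<subseteq> V" "T \<noteq> {}" "card T \<le> k"
            have finT: "finite T" using T fin finite_subset by blast
            have BT: "wdeg V k B T \<le> K' * \<tau> ^ card T * e / N" using B T by (auto simp: inv_def)
            show "wdeg V k B' T \<le> K' * \<tau> ^ card T * e / N"
            \<comment> \<open>In this case the degree of \<open>T\<close> does not move: either no
              link edge contains \<open>T\<close>, or all edges above the saturated \<open>T\<close>
              were removed from \<open>A\<close>.\<close>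
            proof (cases "v \<in> T \<or> T \<in> S")
              case True
              have "wdeg V (Suc k) A (insert v T) = 0" if "T \<in> S"
                unfolding wdeg_def A_def using that by (auto intro!: sum.neutral)
              thus ?thesis using True link[OF T(1)] BT by auto
            next
              case F: False
              have "wdeg V (Suc k) A (insert v T) \<le> wdeg V (Suc k) w (insert v T)"
                unfolding wdeg_def by (intro sum_mono) (auto simp: A_def w)
              also have "\<dots> \<le> K * \<tau> ^ (card (insert v T) - 1) * e / N"
              proof -
                have "insert v T \<subseteq> V" "insert v T \<noteq> {}" "card (insert v T) \<le> Suc k"
                  using T vV F finT by auto
                thus ?thesis using spr unfolding spread_def e_def N_def by blast
              qed
              also have "card (insert v T) - 1 = card T" using F finT by simp
              finally have "wdeg V (Suc k) A (insert v T) \<le> K * \<tau> ^ card T * e / N" .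
              moreover have "wdeg V k B T \<le> 2 ^ (k + 1) * K * \<tau> ^ card T * e / N"
                using F T by (auto simp: S_def N_def)
              ultimately have "wdeg V k B' T \<le> 2 ^ (k + 1) * K * \<tau> ^ card T * e / N + K * \<tau> ^ card T * e / N"
                using link[OF T(1)] F by simp
              thus ?thesis by (simp add: K'_def add_divide_distrib distrib_right)
            qed
          qed
          moreover have "\<tau> * e - wdeg V k B' {} \<le> real m * (e / (4 * N))"
          proof -
            have "wdeg V (Suc k) A {v} \<ge> e / (4 * N)" using v by (auto simp: X_def N_def)
            moreover have "real (Suc m) * (e / (4 * N)) = real m * (e / (4 * N)) + e / (4 * N)"
              by (simp only: of_nat_Suc distrib_right mult_1)
            ultimately show ?thesis using Suc.prems(2) link[of "{}"] by simp
          qed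
          ultimately have "containers V (\<lambda>I. wfree (Suc k) w I \<and> wfree k B' I)
              (real m + real k * (4 * \<tau> * N + 1)) P" by (rule Suc.IH)
          thus "containers V (\<lambda>I. (wfree (Suc k) w I \<and> wfree k B I) \<and> v \<in> I)
             (real (Suc m) + real k * (4 * \<tau> * N + 1) - 1) P"
          proof (rule containers_mono)
            fix I assume I: "(wfree (Suc k) w I \<and> wfree k B I) \<and> v \<in> I"
            \<comment> \<open>An edge of \<open>B'\<close> that is not one of \<open>B\<close> comes
              from the link of \<open>v\<close>. Inside \<open>I\<close> it would form with
              \<open>v \<in> I\<close> an edge of \<open>w\<close> inside \<open>I\<close>.\<close>
            have "\<not> f \<subseteq> I" if f: "card f = k" "finite f" "B' f > 0" for f
            proof (cases "B f > 0")
              case True thus ?thesis using I f by (auto simp: wfree_def)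
            next
              case F: False
              hence "v \<notin> f" "A (insert v f) > 0" using f B0[of f] by (auto simp: B'_def split: if_splits)
              hence "v \<notin> f" "w (insert v f) > 0" by (auto simp: A_def split: if_splits)
              hence "\<not> insert v f \<subseteq> I" using I f unfolding wfree_def
                by (metis card_insert_disjoint finite_insert)
              thus ?thesis using I by auto
            qed
            thus "wfree (Suc k) w I \<and> wfree k B' I" using I by (auto simp: wfree_def)
          qed auto
        qed
      qed
    qed
    \<comment> \<open>The number of increments \<open>e / (4 * N)\<close> that bring the weight of
      \<open>B\<close> from 0 to \<open>\<tau> * e\<close>; rounding up costs the \<open>+ 1\<close>
      in the bound.\<close>
    define m where "m = nat \<lceil>4 * \<tau> * N\<rceil>"
    have "0 \<le> 4 * \<tau> * N" using \<tau> N by simp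
    hence "real m = of_int \<lceil>4 * \<tau> * N\<rceil>" unfolding m_def by (intro of_nat_nat) linarith
    hence m: "4 * \<tau> * N \<le> real m" "real m \<le> 4 * \<tau> * N + 1" by linarith+
    have "\<tau> * e = 4 * \<tau> * N * (e / (4 * N))" using N by simp
    also have "\<dots> \<le> real m * (e / (4 * N))" using m e N by (intro mult_right_mono) auto
    finally have "containers V (\<lambda>I. wfree (Suc k) w I \<and> wfree k (\<lambda>_. 0) I) (real m + real k * (4 * \<tau> * N + 1)) P"
      using \<open>K' \<ge> 1\<close> \<tau> N e by (intro main) (auto simp: inv_def wdeg_def)
    thus "containers V (wfree (Suc k) w) (real (Suc k) * (4 * \<tau> * card V + 1))
       (\<lambda>C. C \<subseteq> V \<and> real (card C) \<le> (1 - c) * real (card V))"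
      by (rule containers_mono) (use m in \<open>auto simp: wfree_def P_def N_def algebra_simps\<close>)
  qed
qed

section \<open>Iteration of the container step\<close>

lemma wfree_subset: "wfree k w I \<Longrightarrow> J \<subseteq> I \<Longrightarrow> wfree k w J"
  unfolding wfree_def by blast

lemma wdeg_mono_carrier:
  assumes "finite V" "D \<subseteq> V" "\<And>f. w f \<ge> 0"
  shows "wdeg D k w T \<le> wdeg V k w T"
  unfolding wdeg_def
proof (intro sum_mono2)
  show "finite {f \<in> nsets V k. T \<subseteq> f}" using assms by (simp add: finite_imp_finite_nsets)
  show "{f \<in> nsets D k. T \<subseteq> f} \<subseteq> {f \<in> nsets V k. T \<subseteq> f}"
    using nsets_mono[OF assms(2)] by auto
qed (use assms in auto)

text \<open>Degrees can only drop on passing to \<open>D\<close>, while the average degree falls at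
  most by the factor \<open>\<delta>\<close>, since \<open>D\<close> keeps that share of the weight
  on no more vertices.\<close>

lemma spread_restrict:
  assumes fin: "finite V" and D: "D \<subseteq> V" "D \<noteq> {}" and K: "K \<ge> 0" and \<tau>: "\<tau> \<ge> 0" and \<delta>: "\<delta> > 0"
    and spr: "spread K \<tau> V k w" and big: "\<delta> * wdeg V k w {} \<le> wdeg D k w {}"
  shows "spread (K / \<delta>) \<tau> D k w"
proof -
  have w: "w f \<ge> 0" for f using spr by (auto simp: spread_def)
  have finD: "finite D" using D fin finite_subset by blast
  have cD: "0 < card D" "card D \<le> card V" using D fin finD by (auto simp: card_gt_0_iff card_mono)
  have "wdeg D k w T \<le> K / \<delta> * \<tau> ^ (card T - 1) * wdeg D k w {} / real (card D)"
    if T: "T \<subseteq> D" "T \<noteq> {}" "card T \<le> k" for T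
  proof -
    have "wdeg D k w T \<le> wdeg V k w T" by (rule wdeg_mono_carrier[OF fin D(1) w])
    also have "\<dots> \<le> K * \<tau> ^ (card T - 1) * wdeg V k w {} / real (card V)"
      using spr T D unfolding spread_def by blast
    also have "\<dots> \<le> K * \<tau> ^ (card T - 1) * (wdeg D k w {} / \<delta>) / real (card D)"
    proof (rule frac_le)
      show "K * \<tau> ^ (card T - 1) * wdeg V k w {} \<le> K * \<tau> ^ (card T - 1) * (wdeg D k w {} / \<delta>)"
        using big \<delta> K \<tau> by (intro mult_left_mono) (auto simp: field_simps)
      show "0 \<le> K * \<tau> ^ (card T - 1) * (wdeg D k w {} / \<delta>)"
        using K \<tau> \<delta> wdeg_nonneg[of w D k "{}", OF w] by simp
    qed (use cD in auto)
    finally show ?thesis by simp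
  qed
  thus ?thesis using w unfolding spread_def by blast
qed

text \<open>By \<open>spread\<close> on singletons no vertex carries more than \<open>K\<close>
  times the average share. Small sets thus have small weight, which is what ends the
  iteration.\<close>

lemma spread_total_le:
  assumes fin: "finite V" and D: "D \<subseteq> V" and k: "k > 0"
    and spr: "spread K \<tau> V k w"
  shows "wdeg D k w {} \<le> real (card D) * (K * wdeg V k w {} / real (card V))"
proof -
  have w: "w f \<ge> 0" for f using spr by (auto simp: spread_def)
  have finD: "finite D" using D fin finite_subset by blast
  have "wdeg D k w {} \<le> real k * wdeg D k w {}"
    using mult_right_mono[of 1 "real k" "wdeg D k w {}"] k wdeg_nonneg[of w D k "{}", OF w] by simp
  also have "\<dots> = (\<Sum>u\<in>D. wdeg D k w {u})" by (simp add: wdeg_handshake finD)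
  also have "\<dots> \<le> (\<Sum>u\<in>D. K * wdeg V k w {} / real (card V))"
  proof (intro sum_mono)
    fix u assume u: "u \<in> D"
    have "wdeg D k w {u} \<le> wdeg V k w {u}" by (rule wdeg_mono_carrier[OF fin D w])
    also have "{u} \<subseteq> V" "{u} \<noteq> {}" "card {u} \<le> k" using u D k by auto
    hence "wdeg V k w {u} \<le> K * \<tau> ^ (card {u} - 1) * wdeg V k w {} / real (card V)"
      using spr unfolding spread_def by blast
    finally show "wdeg D k w {u} \<le> K * wdeg V k w {} / real (card V)" by simp
  qed
  finally show ?thesis by simp
qed

text \<open>A container that still has the fraction \<open>d\<close> of the weight is
  \<open>spread\<close> with constant \<open>K / d\<close>, so the step applies to it with one and
  the same \<open>c\<close>, however often it is repeated. Sizes shrink geometrically, and a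
  container of fewer than \<open>d * N / K\<close> vertices has too little weight to need another
  step.\<close>

theorem container_lemma:
  assumes K: "K \<ge> 1" and \<delta>: "\<delta> > 0" and k: "k > 0"
  shows "\<exists>M>0. \<forall>(V::'a set) w \<tau>. finite V \<longrightarrow> V \<noteq> {} \<longrightarrow> 0 < \<tau> \<longrightarrow> \<tau> * real (card V) \<ge> 1 \<longrightarrow>
     spread K \<tau> V k w \<longrightarrow> wdeg V k w {} > 0 \<longrightarrow>
     containers V (wfree k w) (M * \<tau> * real (card V)) (\<lambda>C. C \<subseteq> V \<and> wdeg C k w {} < \<delta> * wdeg V k w {})"
proof -
  define d where "d = min \<delta> 1"
  have d: "d > 0" "d \<le> 1" "d \<le> \<delta>" using \<delta> by (auto simp: d_def)
  have "K / d \<ge> 1" using K d by (simp add: field_simps)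
  from container_step[OF this, of k] obtain c where c: "c > 0" and step:
    "\<forall>(V::'a set) w \<tau>. finite V \<longrightarrow> V \<noteq> {} \<longrightarrow> 0 < \<tau> \<longrightarrow> spread (K / d) \<tau> V k w \<longrightarrow>
     wdeg V k w {} > 0 \<longrightarrow>
     containers V (wfree k w) (real k * (4 * \<tau> * card V + 1))
       (\<lambda>C. C \<subseteq> V \<and> real (card C) \<le> (1 - c) * real (card V))" by (elim exE conjE)
  \<comment> \<open>The shrinking factor \<open>1 - c\<close> is raised to at least
    \<open>1/2\<close>, so that its powers are positive.\<close>
  define b where "b = 1 - min c (1/2)"
  have b: "0 < b" "b < 1" "1 - c \<le> b" using c by (auto simp: b_def)
  have "0 < d / K" using d K by simp
  \<comment> \<open>After \<open>m\<close> steps a container has fewer than \<open>d * N / K\<close>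
    vertices, hence weight below \<open>d * e\<close>.\<close>
  then obtain m where m: "b ^ m < d / K" using real_arch_pow_inv[of "d / K" b] b by blast
  \<comment> \<open>The \<open>5\<close> is \<open>4 + 1\<close>: the rounding term of each step is
    at most \<open>\<tau> * card V\<close>, as this is at least 1. The last \<open>+ 1\<close> keeps
    \<open>M\<close> positive.\<close>
  define M where "M = 5 * real m * real k + 1"
  show ?thesis
  proof (intro exI[of _ M] conjI allI impI)
    show "M > 0" by (simp add: M_def add_nonneg_pos)
    fix V :: "'a set" and w :: "'a set \<Rightarrow> real" and \<tau> :: real
    assume fin: "finite V" and ne: "V \<noteq> {}" and \<tau>: "0 < \<tau>" and \<tau>N: "\<tau> * real (card V) \<ge> 1"
      and spr: "spread K \<tau> V k w" and pos: "wdeg V k w {} > 0"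
    define N where "N = real (card V)"
    define e where "e = wdeg V k w {}"
    define P where "P C \<longleftrightarrow> C \<subseteq> V \<and> wdeg C k w {} < \<delta> * e" for C
    have N: "N > 0" using fin ne by (simp add: N_def card_gt_0_iff)
    have e: "e > 0" using pos by (simp add: e_def)
    have main: "containers D (wfree k w) (real j * (real k * (4 * \<tau> * N + 1))) P"
      if "D \<subseteq> V" "b ^ j * real (card D) < d * N / K" for j D
      using that
    proof (induction j arbitrary: D)
      case (0 D)
      have "wdeg D k w {} \<le> real (card D) * (K * e / N)"
        using spread_total_le[OF fin 0(1) k spr] by (simp add: e_def N_def)
      also have "\<dots> < d * N / K * (K * e / N)"
        using 0(2) K e N by (intro mult_strict_right_mono) auto
      also have "\<dots> = d * e" using K N by simp
      also have "\<dots> \<le> \<delta> * e" using d e by simp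
      finally show ?case using 0(1) by (intro containers_trivial[where D = D]) (auto simp: P_def)
    next
      case (Suc j D)
      show ?case
      proof (cases "wdeg D k w {} < d * e")
        case True
        also have "d * e \<le> \<delta> * e" using d e by simp
        finally show ?thesis using Suc.prems(1) \<tau> N by (intro containers_trivial[where D = D]) (auto simp: P_def)
      next
        case False
        have finD: "finite D" using Suc.prems(1) fin finite_subset by blast
        have "d * e > 0" using d e by simp
        hence posD: "wdeg D k w {} > 0" using False by linarith
        have "real (card D) * (K * e / N) > 0"
          using posD spread_total_le[OF fin Suc.prems(1) k spr] by (simp add: e_def N_def)
        hence neD: "D \<noteq> {}" by auto
        have "spread (K / d) \<tau> D k w"
          using fin Suc.prems(1) neD K \<tau> d spr False
          by (intro spread_restrict) (auto simp: e_def)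
        hence "containers D (wfree k w) (real k * (4 * \<tau> * card D + 1))
            (\<lambda>C. C \<subseteq> D \<and> real (card C) \<le> (1 - c) * real (card D))"
          using step finD neD \<tau> posD by blast
        moreover have "C \<subseteq> D \<and> containers C (wfree k w) (real j * (real k * (4 * \<tau> * N + 1))) P"
          if C: "C \<subseteq> D \<and> real (card C) \<le> (1 - c) * real (card D)" for C
        proof
          have "b ^ j * real (card C) \<le> b ^ j * (b * real (card D))"
            using C b by (intro mult_left_mono order_trans[OF conjunct2[OF C]] mult_right_mono) auto
          also have "\<dots> < d * N / K" using Suc.prems(2) by (simp add: mult_ac)
          finally show "containers C (wfree k w) (real j * (real k * (4 * \<tau> * N + 1))) P"
            using C Suc.prems(1) by (intro Suc.IH) auto
        qed (use C in simp)
        ultimately have "containers D (wfree k w)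
            (real k * (4 * \<tau> * card D + 1) + real j * (real k * (4 * \<tau> * N + 1))) P"
          by (rule containers_bind[OF finD _ _ wfree_subset])
        moreover have "real k * (4 * \<tau> * card D + 1) \<le> real k * (4 * \<tau> * N + 1)"
          using card_mono[OF fin Suc.prems(1)] \<tau> unfolding N_def
          by (intro mult_left_mono add_right_mono) auto
        ultimately show ?thesis
          by (elim containers_mono) (auto simp: algebra_simps)
      qed
    qed
    have "containers V (wfree k w) (real m * (real k * (4 * \<tau> * N + 1))) P"
    proof (rule main)
      have "b ^ m * real (card V) < d / K * real (card V)"
        using m N by (intro mult_strict_right_mono) (auto simp: N_def)
      thus "b ^ m * real (card V) < d * N / K" by (simp add: N_def)
    qed simp
    moreover have "real m * (real k * (4 * \<tau> * N + 1)) \<le> M * \<tau> * N"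
    proof -
      have "real m * (real k * (4 * \<tau> * N + 1)) \<le> real m * (real k * (5 * (\<tau> * N)))"
        using \<tau>N unfolding N_def by (intro mult_left_mono) auto
      also have "\<dots> \<le> M * \<tau> * N" using \<tau> N unfolding M_def by (simp add: algebra_simps)
      finally show ?thesis .
    qed
    ultimately show "containers V (wfree k w) (M * \<tau> * real (card V))
        (\<lambda>C. C \<subseteq> V \<and> wdeg C k w {} < \<delta> * wdeg V k w {})"
      by (elim containers_mono) (auto simp: P_def e_def N_def)
  qed
qed

section \<open>Supersaturation in dense graphs\<close>

text \<open>For \<open>s \<le> 1\<close> there are no pairs to check, so the counts are
  \<open>1\<close> and \<open>card V\<close>; these are the starting values for the Moon-Moser
  recursion.\<close>

definition cliques :: "nat \<Rightarrow> 'a set \<Rightarrow> 'a set set \<Rightarrow> 'a set set" where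
  "cliques s V H = {Q \<in> nsets V s. nsets Q 2 \<subseteq> H}"

definition exts :: "nat \<Rightarrow> 'a set \<Rightarrow> 'a set set \<Rightarrow> 'a set \<Rightarrow> 'a set" where
  "exts s V H R = {z \<in> V - R. insert z R \<in> cliques (Suc s) V H}"

lemma finite_cliques [simp]: "finite V \<Longrightarrow> finite (cliques s V H)"
  by (simp add: cliques_def finite_imp_finite_nsets)

lemma clique_subset:
  assumes "Q \<in> cliques s V H" "R \<subseteq> Q"
  shows "R \<in> cliques (card R) V H"
  using assms nsets_mono[of R Q 2] by (auto simp: cliques_def nsets_def intro: finite_subset)

text \<open>Double counting of a clique with a marked vertex, read as a smaller clique with an
  extending vertex. The weight \<open>f\<close> allows both the plain count and the sum of squared
  extension numbers.\<close>

lemma sum_exts: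
  fixes f :: "'a set \<Rightarrow> real"
  assumes "finite V"
  shows "(\<Sum>Q\<in>cliques (Suc s) V H. \<Sum>x\<in>Q. f (Q - {x})) = (\<Sum>R\<in>cliques s V H. real (card (exts s V H R)) * f R)"
proof -
  have finQ: "finite Q" if "Q \<in> cliques (Suc s) V H" for Q using that by (auto simp: cliques_def nsets_def)
  have finE: "finite (exts s V H R)" for R using assms by (simp add: exts_def)
  have "(\<Sum>Q\<in>cliques (Suc s) V H. \<Sum>x\<in>Q. f (Q - {x}))
      = (\<Sum>(Q, x)\<in>Sigma (cliques (Suc s) V H) (\<lambda>Q. Q). f (Q - {x}))"
    using assms finQ by (subst sum.Sigma) auto
  also have "\<dots> = (\<Sum>(R, z)\<in>Sigma (cliques s V H) (exts s V H). f R)"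
  proof (rule sum.reindex_bij_witness[where i = "\<lambda>(R, z). (insert z R, z)" and j = "\<lambda>(Q, x). (Q - {x}, x)"])
    fix a assume "a \<in> Sigma (cliques (Suc s) V H) (\<lambda>Q. Q)"
    then obtain Q x where a: "a = (Q, x)" "Q \<in> cliques (Suc s) V H" "x \<in> Q" by auto
    have "card (Q - {x}) = s" "x \<in> V" using a by (auto simp: cliques_def nsets_def)
    hence "Q - {x} \<in> cliques s V H" using clique_subset[OF a(2), of "Q - {x}"] by auto
    thus "(case a of (Q, x) \<Rightarrow> (Q - {x}, x)) \<in> Sigma (cliques s V H) (exts s V H)"
      using a \<open>x \<in> V\<close> by (auto simp: exts_def insert_absorb)
    show "(case case a of (Q, x) \<Rightarrow> (Q - {x}, x) of (R, z) \<Rightarrow> (insert z R, z)) = a"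
      using a by (auto simp: insert_absorb)
  next
    fix b assume "b \<in> Sigma (cliques s V H) (exts s V H)"
    thus "(case case b of (R, z) \<Rightarrow> (insert z R, z) of (Q, x) \<Rightarrow> (Q - {x}, x)) = b"
      and "(case b of (R, z) \<Rightarrow> (insert z R, z)) \<in> Sigma (cliques (Suc s) V H) (\<lambda>Q. Q)"
      by (auto simp: exts_def)
  qed auto
  also have "\<dots> = (\<Sum>R\<in>cliques s V H. \<Sum>z\<in>exts s V H R. f R)"
    using assms finE by (subst sum.Sigma) auto
  finally show ?thesis by simp
qed

text \<open>A vertex that extends two different facets of \<open>Q\<close> is adjacent to all of
  \<open>Q\<close>. So each vertex is counted at most once, unless it extends \<open>Q\<close>
  itself, and then it is counted \<open>s + 1\<close> times.\<close>

lemma sum_exts_facets_le: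
  assumes fin: "finite V" and Q: "Q \<in> cliques (Suc s) V H"
  shows "(\<Sum>x\<in>Q. real (card (exts s V H (Q - {x})))) \<le> real (card V) + real s * real (card (exts (Suc s) V H Q))"
proof -
  have finQ: "finite Q" and cQ: "card Q = Suc s" and QV: "Q \<subseteq> V" and QH: "nsets Q 2 \<subseteq> H"
    using Q by (auto simp: cliques_def nsets_def)
  have "(\<Sum>x\<in>Q. card (exts s V H (Q - {x}))) = (\<Sum>x\<in>Q. \<Sum>z\<in>V. if z \<in> exts s V H (Q - {x}) then 1 else 0)"
  proof (intro sum.cong refl)
    fix x
    have "{z \<in> V. z \<in> exts s V H (Q - {x})} = exts s V H (Q - {x})" by (auto simp: exts_def)
    thus "card (exts s V H (Q - {x})) = (\<Sum>z\<in>V. if z \<in> exts s V H (Q - {x}) then 1 else 0)"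
      using fin by (simp add: sum.inter_filter[symmetric])
  qed
  also have "\<dots> = (\<Sum>z\<in>V. \<Sum>x\<in>Q. if z \<in> exts s V H (Q - {x}) then 1 else 0)" by (rule sum.swap)
  also have "\<dots> \<le> (\<Sum>z\<in>V. 1 + (if z \<in> exts (Suc s) V H Q then s else 0))"
  proof (intro sum_mono)
    fix z assume z: "z \<in> V"
    let ?X = "{x \<in> Q. z \<in> exts s V H (Q - {x})}"
    have finX: "finite ?X" using finQ by simp
    have "card ?X \<le> 1 + (if z \<in> exts (Suc s) V H Q then s else 0)"
    proof (cases "z \<in> exts (Suc s) V H Q")
      case True
      have "card ?X \<le> card Q" by (intro card_mono finQ) auto
      thus ?thesis using True cQ by simp
    next
      case False
      have "\<forall>x\<in>?X. \<forall>y\<in>?X. x = y"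
      proof (intro ballI, rule ccontr)
        fix x y assume xy: "x \<in> ?X" "y \<in> ?X" "x \<noteq> y"
        hence zQ: "z \<notin> Q" by (auto simp: exts_def)
        have "nsets (insert z Q) 2 \<subseteq> H"
        proof
          fix e assume "e \<in> nsets (insert z Q) 2"
          then obtain a b where e: "e = {a, b}" "a \<in> insert z Q" "b \<in> insert z Q" "a \<noteq> b"
            by (auto elim: nsets2_E)
          have x: "nsets (insert z (Q - {x})) 2 \<subseteq> H" and y: "nsets (insert z (Q - {y})) 2 \<subseteq> H"
            using xy by (auto simp: exts_def cliques_def)
          have "{a, b} \<in> nsets Q 2 \<or> {a, b} \<in> nsets (insert z (Q - {x})) 2 \<or> {a, b} \<in> nsets (insert z (Q - {y})) 2"
            using e xy(3) by auto
          thus "e \<in> H" using e x y QH by blast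
        qed
        hence "insert z Q \<in> cliques (Suc (Suc s)) V H"
          using zQ z finQ cQ QV by (auto simp: cliques_def nsets_def)
        thus False using False z zQ by (simp add: exts_def)
      qed
      hence "card ?X \<le> 1" using finX by (simp add: card_le_Suc0_iff_eq)
      thus ?thesis by simp
    qed
    thus "(\<Sum>x\<in>Q. if z \<in> exts s V H (Q - {x}) then 1 else 0) \<le> 1 + (if z \<in> exts (Suc s) V H Q then s else 0)"
      using finQ by (simp add: sum.inter_filter[symmetric])
  qed
  also have "\<dots> = card V + s * card (exts (Suc s) V H Q)"
  proof -
    have "{z \<in> V. z \<in> exts (Suc s) V H Q} = exts (Suc s) V H Q" by (auto simp: exts_def)
    thus ?thesis using fin
      by (simp only: sum.distrib sum.inter_filter[symmetric]) simp
  qed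
  finally have "real (\<Sum>x\<in>Q. card (exts s V H (Q - {x}))) \<le> real (card V + s * card (exts (Suc s) V H Q))"
    by (simp only: of_nat_le_iff)
  thus ?thesis by simp
qed

text \<open>Cauchy-Schwarz for the extension numbers of \<open>s\<close>-cliques. Their sum is
  \<open>Suc s * k (Suc s)\<close>, and their sum of squares is a sum over facets of
  \<open>(s+1)\<close>-cliques, bounded by the preceding lemma.\<close>

lemma Moon_Moser:
  fixes H :: "'a set set"
  assumes fin: "finite V"
  defines "k \<equiv> \<lambda>s. real (card (cliques s V H))"
  shows "(real (Suc s) * k (Suc s))\<^sup>2 \<le> k s * (real (card V) * k (Suc s) + real s * (real (Suc (Suc s)) * k (Suc (Suc s))))"
proof -
  have count: "(\<Sum>R\<in>cliques s V H. real (card (exts s V H R))) = real (Suc s) * k (Suc s)" for s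
  proof -
    have "(\<Sum>R\<in>cliques s V H. real (card (exts s V H R))) = (\<Sum>Q\<in>cliques (Suc s) V H. \<Sum>x\<in>Q. 1)"
      using sum_exts[OF fin, of "\<lambda>_. 1" s H] by simp
    also have "\<dots> = (\<Sum>Q\<in>cliques (Suc s) V H. real (Suc s))"
      by (intro sum.cong refl) (auto simp: cliques_def nsets_def)
    finally show ?thesis by (simp add: k_def)
  qed
  have "(real (Suc s) * k (Suc s))\<^sup>2 \<le> (\<Sum>R\<in>cliques s V H. (real (card (exts s V H R)))\<^sup>2) * k s"
    unfolding count[of s, symmetric] unfolding k_def by (rule sum_squared_le_sum_of_squares)
  also have "(\<Sum>R\<in>cliques s V H. (real (card (exts s V H R)))\<^sup>2)
      = (\<Sum>Q\<in>cliques (Suc s) V H. \<Sum>x\<in>Q. real (card (exts s V H (Q - {x}))))"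
    using sum_exts[OF fin, of "\<lambda>R. real (card (exts s V H R))" s H] by (simp add: power2_eq_square)
  also have "\<dots> \<le> (\<Sum>Q\<in>cliques (Suc s) V H. real (card V) + real s * real (card (exts (Suc s) V H Q)))"
    by (intro sum_mono sum_exts_facets_le fin)
  also have "\<dots> = real (card V) * k (Suc s) + real s * (real (Suc (Suc s)) * k (Suc (Suc s)))"
    unfolding count[symmetric] by (simp add: sum.distrib sum_distrib_left k_def)
  finally show ?thesis by (simp add: k_def mult_ac mult_right_mono)
qed

lemma supersaturation_constant_pos:
  fixes t :: real
  assumes "real s < t + 1" "t > 0"
  shows "(\<Prod>i<s. (1 - real i / t) / real (Suc i)) > 0"
proof (intro prod_pos ballI divide_pos_pos)
  fix i assume "i \<in> {..<s}"
  hence "real i + 1 \<le> real s" by simp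
  thus "1 - real i / t > 0" using assms by (simp add: field_simps)
qed auto

text \<open>The real \<open>t\<close> is defined by the density \<open>1 - 1 / t\<close>, and the
  product is the generalised binomial \<open>t choose s\<close> divided by \<open>t ^ s\<close>: the
  clique density of a balanced complete \<open>t\<close>-partite graph. The bound
  \<open>s < t + 1\<close> makes all its factors positive.\<close>

theorem clique_supersaturation:
  fixes H :: "'a set set" and t :: real
  assumes fin: "finite V" "V \<noteq> {}" and H: "H \<subseteq> nsets V 2"
    and dense: "2 * real (card H) \<ge> (1 - 1 / t) * (real (card V))\<^sup>2"
    and t: "real s < t + 1" "t > 0"
  shows "real (card (cliques s V H)) \<ge> (\<Prod>i<s. (1 - real i / t) / real (Suc i)) * real (card V) ^ s"
proof -
  define n where "n = real (card V)"
  define k where "k s = real (card (cliques s V H))" for s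
  define a where "a s = (\<Prod>i<s. (1 - real i / t) / real (Suc i))" for s
  have n: "n > 0" using fin by (simp add: n_def card_gt_0_iff)
  have a: "a s > 0" if "real s < t + 1" for s
    unfolding a_def using that t(2) by (rule supersaturation_constant_pos)
  have k0: "k 0 = 1"
  proof -
    have "cliques 0 V H = {{}}" by (auto simp: cliques_def nsets_def)
    thus ?thesis by (simp add: k_def)
  qed
  have k1: "k 1 = n"
  proof -
    have "cliques 1 V H = (\<lambda>x. {x}) ` V"
      by (auto simp: cliques_def nsets_one nsets_singleton_iff)
    thus ?thesis by (simp add: k_def n_def card_image)
  qed
  have k2: "k 2 = real (card H)"
  proof -
    have "nsets Q 2 = {Q}" if "Q \<in> nsets V 2" for Q
      using that by (auto elim!: nsets2_E)
    hence "cliques 2 V H = H" using H by (auto simp: cliques_def)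
    thus ?thesis by (simp add: k_def)
  qed
  \<comment> \<open>Moon-Moser propagates a lower bound on the ratio of consecutive clique counts,
    so this ratio is carried along. At \<open>s = 1\<close> it is the density hypothesis. The guard
    \<open>s > 0\<close> permits cancelling \<open>real s\<close> in the step.\<close>
  have "real s < t + 1 \<longrightarrow> k s \<ge> a s * n ^ s \<and> (s > 0 \<longrightarrow> real (Suc s) * k (Suc s) \<ge> (1 - real s / t) * n * k s)" for s
  proof (induction s)
    case 0
    show ?case by (simp add: k0 a_def)
  next
    case (Suc s)
    show ?case
    proof (cases "s = 0")
      case True
      thus ?thesis using k1 k2 dense by (simp add: a_def n_def power2_eq_square numeral_2_eq_2)
    next
      case False
      show ?thesis
      proof
        assume s: "real (Suc s) < t + 1"
        have IH: "k s \<ge> a s * n ^ s" "real (Suc s) * k (Suc s) \<ge> (1 - real s / t) * n * k s"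
          using Suc False s by auto
        have ks: "k s > 0" using IH(1) a[of s] s n by (smt (verit) mult_pos_pos of_nat_Suc zero_less_power)
        have pos: "1 - real s / t > 0" using s t(2) by (simp add: field_simps)
        have "(1 - real s / t) * n * (a s * n ^ s) \<le> (1 - real s / t) * n * k s"
          using IH(1) pos n by (intro mult_left_mono) auto
        hence "(1 - real s / t) * n * (a s * n ^ s) \<le> real (Suc s) * k (Suc s)" using IH(2) by linarith
        hence 1: "a (Suc s) * n ^ Suc s \<le> k (Suc s)" by (simp add: a_def field_simps)
        have "k s * ((1 - real s / t) * n * (real (Suc s) * k (Suc s))) = ((1 - real s / t) * n * k s) * (real (Suc s) * k (Suc s))"
          by simp
        also have "\<dots> \<le> (real (Suc s) * k (Suc s)) * (real (Suc s) * k (Suc s))"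
          by (intro mult_right_mono IH) (auto simp: k_def)
        also have "\<dots> \<le> k s * (n * k (Suc s) + real s * (real (Suc (Suc s)) * k (Suc (Suc s))))"
          using Moon_Moser[OF fin(1), of s H] by (simp add: k_def n_def power2_eq_square)
        finally have "(1 - real s / t) * n * (real (Suc s) * k (Suc s)) \<le> n * k (Suc s) + real s * (real (Suc (Suc s)) * k (Suc (Suc s)))"
          using ks by (simp only: mult_le_cancel_left_pos)
        moreover have "(1 - real s / t) * n * (real (Suc s) * k (Suc s)) - n * k (Suc s) = real s * ((1 - real (Suc s) / t) * n * k (Suc s))"
          using t(2) by (simp add: field_simps)
        ultimately have "real s * ((1 - real (Suc s) / t) * n * k (Suc s)) \<le> real s * (real (Suc (Suc s)) * k (Suc (Suc s)))"
          by linarith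
        hence "(1 - real (Suc s) / t) * n * k (Suc s) \<le> real (Suc (Suc s)) * k (Suc (Suc s))"
          using False by (simp only: mult_le_cancel_left_pos of_nat_0_less_iff)
        thus "k (Suc s) \<ge> a (Suc s) * n ^ Suc s \<and>
          (Suc s > 0 \<longrightarrow> real (Suc (Suc s)) * k (Suc (Suc s)) \<ge> (1 - real (Suc s) / t) * n * k (Suc s))"
          using 1 by blast
      qed
    qed
  qed
  thus ?thesis using t by (simp add: k_def a_def n_def)
qed

section \<open>Random subsets\<close>

text \<open>An arbitrary ground set, so that hyperedges, edges and sparsifications share one
  calculus.\<close>

definition random_subset :: "'a set \<Rightarrow> real \<Rightarrow> 'a set pmf" where
  "random_subset A p = map_pmf (\<lambda>X. {e \<in> A. X e}) (Pi_pmf A False (\<lambda>_. bernoulli_pmf p))"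

lemma random_hypergraph_eq: "random_hypergraph r n p = random_subset (nsets {1..n} r) p"
  by (simp add: random_hypergraph_def random_subset_def)

lemma set_random_subset: "set_pmf (random_subset A p) \<subseteq> Pow A"
  by (auto simp: random_subset_def)

lemma finite_set_random_subset [simp]: "finite A \<Longrightarrow> finite (set_pmf (random_subset A p))"
  by (rule finite_subset[OF set_random_subset]) simp

lemma expectation_random_subset_prod:
  fixes f g :: "'a \<Rightarrow> real"
  assumes "finite A" "0 \<le> p" "p \<le> 1" "\<And>e. e \<in> A \<Longrightarrow> f e \<ge> 0" "\<And>e. e \<in> A \<Longrightarrow> g e \<ge> 0"
  shows "measure_pmf.expectation (random_subset A p) (\<lambda>R. \<Prod>e\<in>A. if e \<in> R then f e else g e)
       = (\<Prod>e\<in>A. p * f e + (1 - p) * g e)"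
proof -
  have "measure_pmf.expectation (random_subset A p) (\<lambda>R. \<Prod>e\<in>A. if e \<in> R then f e else g e)
      = measure_pmf.expectation (Pi_pmf A False (\<lambda>_. bernoulli_pmf p)) (\<lambda>X. \<Prod>e\<in>A. if X e then f e else g e)"
    unfolding random_subset_def integral_map_pmf by (intro arg_cong[where f = "integral\<^sup>L _"] ext prod.cong) auto
  also have "\<dots> = (\<Prod>e\<in>A. measure_pmf.expectation (bernoulli_pmf p) (\<lambda>b. if b then f e else g e))"
    using assms by (intro expectation_prod_Pi_pmf) (auto simp: integrable_measure_pmf_finite)
  also have "\<dots> = (\<Prod>e\<in>A. p * f e + (1 - p) * g e)"
    using assms by (intro prod.cong refl) (simp add: mult.commute)
  finally show ?thesis .
qed

lemma prob_eq_expectation: "measure_pmf.prob M X = measure_pmf.expectation M (\<lambda>x. if x \<in> X then 1 else 0)"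
proof -
  have "measure_pmf.prob M X = measure_pmf.expectation M (indicator X)" by simp
  also have "indicator X = (\<lambda>x. if x \<in> X then 1 else (0::real))" by (auto simp: indicator_def)
  finally show ?thesis .
qed

lemma expectation_mono_finite:
  fixes f g :: "'a \<Rightarrow> real"
  assumes "finite (set_pmf M)" "\<And>x. x \<in> set_pmf M \<Longrightarrow> f x \<le> g x"
  shows "measure_pmf.expectation M f \<le> measure_pmf.expectation M g"
  by (rule integral_mono_AE) (use assms in \<open>auto simp: AE_measure_pmf_iff integrable_measure_pmf_finite\<close>)

text \<open>One product computation with three uses: \<open>D = {}\<close> gives containment,
  \<open>y = 0\<close> gives avoidance (by \<open>0 ^ 0 = 1\<close> the power is then the indicator
  of disjointness), and \<open>y > 1\<close> gives the exponential moments for the container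
  bound.\<close>

lemma expectation_superset_power:
  fixes y :: real
  assumes "finite A" "0 \<le> p" "p \<le> 1" "S \<subseteq> A" "D \<subseteq> A" "S \<inter> D = {}" "y \<ge> 0"
  shows "measure_pmf.expectation (random_subset A p) (\<lambda>R. (if S \<subseteq> R then 1 else 0) * y ^ card (R \<inter> D))
       = p ^ card S * (1 + p * (y - 1)) ^ card D"
proof -
  define f where "f e = (if e \<in> D then y else 1)" for e
  define g where "g e = (if e \<in> S then 0 else 1::real)" for e
  have "(if S \<subseteq> R then 1 else 0) * y ^ card (R \<inter> D) = (\<Prod>e\<in>A. if e \<in> R then f e else g e)" for R
  proof -
    have "(\<Prod>e\<in>A. if e \<in> R then f e else g e) = (\<Prod>e\<in>A. (if e \<in> R \<inter> D then y else 1) * (if e \<in> S - R then 0 else 1))"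
      by (intro prod.cong refl) (auto simp: f_def g_def)
    also have "\<dots> = (\<Prod>e\<in>A. if e \<in> R \<inter> D then y else 1) * (\<Prod>e\<in>A. if e \<in> S - R then 0 else 1)"
      by (rule prod.distrib)
    also have "(\<Prod>e\<in>A. if e \<in> R \<inter> D then y else 1) = y ^ card (R \<inter> D)"
    proof -
      have "A \<inter> (R \<inter> D) = R \<inter> D" using assms by auto
      thus ?thesis using assms(1) by (simp only: prod.inter_restrict[symmetric] prod_constant)
    qed
    also have "(\<Prod>e\<in>A. if e \<in> S - R then 0 else (1::real)) = (if S \<subseteq> R then 1 else 0)"
    proof (cases "S \<subseteq> R")
      case True
      hence "(\<Prod>e\<in>A. if e \<in> S - R then 0 else (1::real)) = 1" by (intro prod.neutral) auto
      thus ?thesis using True by simp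
    next
      case False
      then obtain e where "e \<in> S" "e \<notin> R" by auto
      hence "(\<Prod>e\<in>A. if e \<in> S - R then 0 else (1::real)) = 0"
        using assms by (intro prod_zero bexI[of _ e]) auto
      thus ?thesis using False by simp
    qed
    finally show ?thesis by simp
  qed
  hence "measure_pmf.expectation (random_subset A p) (\<lambda>R. (if S \<subseteq> R then 1 else 0) * y ^ card (R \<inter> D))
      = (\<Prod>e\<in>A. p * f e + (1 - p) * g e)"
    using assms by (simp add: expectation_random_subset_prod f_def g_def)
  also have "\<dots> = (\<Prod>e\<in>A. (if e \<in> S then p else 1) * (if e \<in> D then 1 + p * (y - 1) else 1))"
    using assms(6) by (intro prod.cong refl) (auto simp: f_def g_def algebra_simps)
  also have "\<dots> = (\<Prod>e\<in>A. if e \<in> S then p else 1) * (\<Prod>e\<in>A. if e \<in> D then 1 + p * (y - 1) else 1)"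
    by (rule prod.distrib)
  also have "\<dots> = p ^ card S * (1 + p * (y - 1)) ^ card D"
    using assms by (simp add: prod.inter_restrict[symmetric] Int_absorb1)
  finally show ?thesis .
qed

lemma prob_superset_random_subset:
  assumes "finite A" "0 \<le> p" "p \<le> 1" "S \<subseteq> A"
  shows "measure_pmf.prob (random_subset A p) {R. S \<subseteq> R} = p ^ card S"
  using expectation_superset_power[OF assms, of "{}" 1] by (simp add: prob_eq_expectation)

lemma prob_disjoint_random_subset:
  assumes "finite A" "0 \<le> p" "p \<le> 1" "D \<subseteq> A"
  shows "measure_pmf.prob (random_subset A p) {R. R \<inter> D = {}} = (1 - p) ^ card D"
proof -
  have "card (R \<inter> D) = 0 \<longleftrightarrow> R \<inter> D = {}" for R
    using assms finite_subset[of D A] by auto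
  hence "(if R \<inter> D = {} then 1 else 0) = (0::real) ^ card (R \<inter> D)" for R
    by (auto simp: power_0_left)
  thus ?thesis
    using expectation_superset_power[OF assms(1-3) _ assms(4), of "{}" 0] by (simp add: prob_eq_expectation)
qed

lemma prob_pair_pmf:
  "measure_pmf.prob (pair_pmf M N) X = measure_pmf.expectation M (\<lambda>a. measure_pmf.prob N {b. (a, b) \<in> X})"
proof -
  have "ennreal (measure_pmf.prob (pair_pmf M N) X) = (\<integral>\<^sup>+x. indicator X x \<partial>pair_pmf M N)"
    by (simp add: measure_pmf.emeasure_eq_measure)
  also have "\<dots> = (\<integral>\<^sup>+a. \<integral>\<^sup>+b. indicator {b. (a, b) \<in> X} b \<partial>N \<partial>M)"
    unfolding nn_integral_pair_pmf' by (simp add: indicator_def)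
  also have "\<dots> = (\<integral>\<^sup>+a. ennreal (measure_pmf.prob N {b. (a, b) \<in> X}) \<partial>M)"
    by (simp add: measure_pmf.emeasure_eq_measure)
  also have "\<dots> = ennreal (measure_pmf.expectation M (\<lambda>a. measure_pmf.prob N {b. (a, b) \<in> X}))"
    by (intro nn_integral_eq_integral measure_pmf.integrable_const_bound[where B = 1]) auto
  finally show ?thesis
    by (subst (asm) ennreal_inj) (auto intro!: integral_nonneg_AE)
qed

lemma pmf_random_subset:
  assumes "finite A" "0 \<le> p" "p \<le> 1" "T \<subseteq> A"
  shows "pmf (random_subset A p) T = (\<Prod>e\<in>A. if e \<in> T then p else 1 - p)"
proof -
  have "pmf (random_subset A p) T = measure_pmf.prob (random_subset A p) {T}"
    by (simp add: measure_pmf_single)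
  also have "\<dots> = measure_pmf.expectation (random_subset A p) (\<lambda>R. if R \<in> {T} then 1 else 0)"
    by (rule prob_eq_expectation)
  also have "\<dots> = measure_pmf.expectation (random_subset A p)
      (\<lambda>R. \<Prod>e\<in>A. if e \<in> R then if e \<in> T then 1 else 0 else if e \<in> T then 0 else 1)"
  proof (intro integral_cong_AE AE_pmfI)
    fix R assume "R \<in> set_pmf (random_subset A p)"
    hence R: "R \<subseteq> A" using set_random_subset by blast
    show "(if R \<in> {T} then 1 else 0) = (\<Prod>e\<in>A. if e \<in> R then if e \<in> T then 1 else 0 else if e \<in> T then 0 else (1::real))"
    proof (cases "R = T")
      case True 
      have "(\<Prod>e\<in>A. if e \<in> T then if e \<in> T then 1 else 0 else if e \<in> T then 0 else 1) = (1::real)"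
        by (intro prod.neutral) auto
      thus ?thesis using True by (simp only: singleton_iff simp_thms if_True)
    next
      case False
      then obtain e where "e \<in> A" "e \<in> R \<longleftrightarrow> e \<notin> T" using R assms(4) by blast
      hence "(\<Prod>e\<in>A. if e \<in> R then if e \<in> T then 1 else 0 else if e \<in> T then 0 else (1::real)) = 0"
        using assms by (intro prod_zero bexI[of _ e]) auto
      thus ?thesis using False by simp
    qed
  qed auto
  also have "\<dots> = (\<Prod>e\<in>A. p * (if e \<in> T then 1 else 0) + (1 - p) * (if e \<in> T then 0 else 1))"
    using assms by (intro expectation_random_subset_prod) auto
  also have "\<dots> = (\<Prod>e\<in>A. if e \<in> T then p else 1 - p)" by (intro prod.cong) auto
  finally show ?thesis .
qed

text \<open>For fixed \<open>R\<close> the probability that \<open>R \<inter> R' = T\<close> is a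
  product over the elements of \<open>A\<close>; averaging each factor over \<open>R\<close> gives
  \<open>p * q\<close> on \<open>T\<close> and \<open>1 - p * q\<close> off it.\<close>

lemma random_subset_Int:
  assumes "finite A" "0 \<le> p" "p \<le> 1" "0 \<le> q" "q \<le> 1"
  shows "map_pmf (\<lambda>(R, R'). R \<inter> R') (pair_pmf (random_subset A p) (random_subset A q)) = random_subset A (p * q)"
    (is "?M = _")
proof (rule pmf_eqI)
  fix T :: "'a set"
  have pq: "0 \<le> p * q" "p * q \<le> 1" using assms by (auto simp: mult_le_one)
  show "pmf ?M T = pmf (random_subset A (p * q)) T"
  proof (cases "T \<subseteq> A")
    case False
    have "set_pmf ?M \<subseteq> Pow A"
      using set_random_subset[of A p] set_random_subset[of A q] by auto
    hence "T \<notin> set_pmf ?M" "T \<notin> set_pmf (random_subset A (p * q))"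
      using False set_random_subset[of A "p * q"] by blast+
    thus ?thesis by (simp only: set_pmf_iff not_not)
  next
    case True
    have "pmf ?M T = measure_pmf.prob (pair_pmf (random_subset A p) (random_subset A q)) {(R, R'). R \<inter> R' = T}"
      by (simp add: pmf_map vimage_def case_prod_unfold)
    also have "\<dots> = measure_pmf.expectation (random_subset A p)
        (\<lambda>R. measure_pmf.prob (random_subset A q) {R'. R \<inter> R' = T})"
      by (simp add: prob_pair_pmf)
    also have "\<dots> = measure_pmf.expectation (random_subset A p)
        (\<lambda>R. \<Prod>e\<in>A. if e \<in> R then (if e \<in> T then q else 1 - q) else (if e \<in> T then 0 else 1))"
    proof (intro integral_cong_AE AE_pmfI)
      fix R assume "R \<in> set_pmf (random_subset A p)"
      hence R: "R \<subseteq> A" using set_random_subset by blast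
      show "measure_pmf.prob (random_subset A q) {R'. R \<inter> R' = T} =
          (\<Prod>e\<in>A. if e \<in> R then (if e \<in> T then q else 1 - q) else (if e \<in> T then 0 else 1))"
      proof (cases "T \<subseteq> R")
        case False
        then obtain e where "e \<in> T" "e \<notin> R" by auto
        hence "(\<Prod>e\<in>A. if e \<in> R then (if e \<in> T then q else 1 - q) else (if e \<in> T then 0 else 1)) = 0"
          using assms True by (intro prod_zero bexI[of _ e]) auto
        moreover have "{R'. R \<inter> R' = T} = {}" using False by auto
        ultimately show ?thesis by simp
      next
        case TR: True
        have "measure_pmf.prob (random_subset A q) {R'. R \<inter> R' = T} = measure_pmf.expectation (random_subset A q)
            (\<lambda>R'. (if T \<subseteq> R' then 1 else 0) * 0 ^ card (R' \<inter> (R - T)))"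
        proof -
          have "(if R \<inter> R' = T then 1 else 0) = (if T \<subseteq> R' then 1 else 0) * (0::real) ^ card (R' \<inter> (R - T))" for R'
          proof -
            have "finite (R' \<inter> (R - T))" using assms R finite_subset by blast
            hence "card (R' \<inter> (R - T)) = 0 \<longleftrightarrow> R' \<inter> (R - T) = {}" by simp
            moreover have "R \<inter> R' = T \<longleftrightarrow> T \<subseteq> R' \<and> R' \<inter> (R - T) = {}" using TR by auto
            ultimately show ?thesis by (auto simp: power_0_left)
          qed
          thus ?thesis by (simp add: prob_eq_expectation)
        qed
        also have "\<dots> = q ^ card T * (1 - q) ^ card (R - T)"
          using assms True R by (subst expectation_superset_power) auto
        also have "\<dots> = (\<Prod>e\<in>A. if e \<in> T then q else 1) * (\<Prod>e\<in>A. if e \<in> R - T then 1 - q else 1)"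
        proof -
          have "A \<inter> T = T" "A \<inter> (R - T) = R - T" using True R by auto
          thus ?thesis using assms(1) by (simp only: prod.inter_restrict[symmetric] prod_constant)
        qed
        also have "\<dots> = (\<Prod>e\<in>A. (if e \<in> T then q else 1) * (if e \<in> R - T then 1 - q else 1))"
          by (rule prod.distrib[symmetric])
        also have "\<dots> = (\<Prod>e\<in>A. if e \<in> R then (if e \<in> T then q else 1 - q) else (if e \<in> T then 0 else 1))"
          using TR by (intro prod.cong) auto
        finally show ?thesis .
      qed
    qed auto
    also have "\<dots> = (\<Prod>e\<in>A. p * (if e \<in> T then q else 1 - q) + (1 - p) * (if e \<in> T then 0 else 1))"
      using assms by (intro expectation_random_subset_prod) auto
    also have "\<dots> = (\<Prod>e\<in>A. if e \<in> T then p * q else 1 - p * q)"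
      by (intro prod.cong) (auto simp: algebra_simps)
    finally show ?thesis using assms True pq by (simp add: pmf_random_subset)
  qed
qed

section \<open>First and second moments\<close>

lemma prob_markov:
  fixes X :: "'a \<Rightarrow> real"
  assumes "finite (set_pmf M)" "\<And>x. X x \<ge> 0" "t > 0"
  shows "measure_pmf.prob M {x. X x \<ge> t} \<le> measure_pmf.expectation M X / t"
  using integral_Markov_inequality_measure[of M X UNIV t] assms
  by (simp add: integrable_measure_pmf_finite)

lemma expectation_count:
  fixes M :: "'a set pmf" and F :: "'i \<Rightarrow> 'a set"
  assumes "finite (set_pmf M)" "finite I"
  shows "measure_pmf.expectation M (\<lambda>R. real (card {i\<in>I. F i \<subseteq> R})) = (\<Sum>i\<in>I. measure_pmf.prob M {R. F i \<subseteq> R})"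
proof -
  have "real (card {i\<in>I. F i \<subseteq> R}) = (\<Sum>i\<in>I. if F i \<subseteq> R then 1 else 0)" for R
    using assms(2) by (simp add: sum.inter_filter[symmetric])
  thus ?thesis
    using assms by (simp add: prob_eq_expectation integrable_measure_pmf_finite)
qed

text \<open>Chebyshev, where pairs with \<open>F i \<inter> F j = {}\<close> contribute no
  covariance and all others at most their joint probability. Only the product rule for disjoint sets
  is assumed of \<open>M\<close>, so that the union of a random hypergraph and a random graph is
  covered.\<close>

lemma second_moment:
  fixes M :: "'a set pmf" and F :: "'i \<Rightarrow> 'a set" and I :: "'i set"
  defines "P \<equiv> \<lambda>S. measure_pmf.prob M {R. S \<subseteq> R}"
  defines "X \<equiv> \<lambda>R. real (card {i\<in>I. F i \<subseteq> R})"
  assumes fin: "finite (set_pmf M)" "finite I"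
    and indep: "\<And>i j. i \<in> I \<Longrightarrow> j \<in> I \<Longrightarrow> F i \<inter> F j = {} \<Longrightarrow> P (F i \<union> F j) = P (F i) * P (F j)"
    and t: "t > 0"
  shows "measure_pmf.prob M {R. \<bar>X R - (\<Sum>i\<in>I. P (F i))\<bar> \<ge> t}
       \<le> (\<Sum>i\<in>I. \<Sum>j\<in>{j\<in>I. F i \<inter> F j \<noteq> {}}. P (F i \<union> F j)) / t\<^sup>2"
proof -
  define \<mu> where "\<mu> = (\<Sum>i\<in>I. P (F i))"
  have int: "integrable (measure_pmf M) f" for f :: "'a set \<Rightarrow> real"
    using fin(1) by (rule integrable_measure_pmf_finite)
  have X: "X R = (\<Sum>i\<in>I. if F i \<subseteq> R then 1 else 0)" for R
    using fin(2) by (simp add: X_def sum.inter_filter[symmetric])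
  have P: "P S = measure_pmf.expectation M (\<lambda>R. if S \<subseteq> R then 1 else 0)" for S
    by (simp add: P_def prob_eq_expectation)
  have P0: "P S \<ge> 0" for S by (simp add: P_def)
  have EX: "measure_pmf.expectation M X = (\<Sum>i\<in>I. P (F i))"
    unfolding X_def P_def by (rule expectation_count[OF fin])
  have "measure_pmf.expectation M (\<lambda>R. (X R)\<^sup>2)
      = measure_pmf.expectation M (\<lambda>R. \<Sum>i\<in>I. \<Sum>j\<in>I. if F i \<union> F j \<subseteq> R then 1 else 0)"
    by (intro arg_cong[where f = "integral\<^sup>L _"] ext)
       (auto simp: X power2_eq_square sum_product intro!: sum.cong)
  also have "\<dots> = (\<Sum>i\<in>I. \<Sum>j\<in>I. P (F i \<union> F j))"
    unfolding P by (subst Bochner_Integration.integral_sum, rule int, rule sum.cong[OF refl],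
      rule Bochner_Integration.integral_sum, rule int)
  also have "\<dots> \<le> (\<Sum>i\<in>I. \<Sum>j\<in>I. P (F i) * P (F j) + (if F i \<inter> F j \<noteq> {} then P (F i \<union> F j) else 0))"
    using indep P0 by (intro sum_mono) auto
  also have "\<dots> = \<mu>\<^sup>2 + (\<Sum>i\<in>I. \<Sum>j\<in>{j\<in>I. F i \<inter> F j \<noteq> {}}. P (F i \<union> F j))"
    using fin(2) by (simp add: sum.distrib \<mu>_def power2_eq_square sum_product sum.inter_filter)
  finally have *: "measure_pmf.expectation M (\<lambda>R. (X R)\<^sup>2) - \<mu>\<^sup>2
      \<le> (\<Sum>i\<in>I. \<Sum>j\<in>{j\<in>I. F i \<inter> F j \<noteq> {}}. P (F i \<union> F j))" by simp
  have "measure_pmf.prob M {R \<in> space M. \<bar>X R - measure_pmf.expectation M X\<bar> \<ge> t} \<le> measure_pmf.variance M X / t\<^sup>2"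
    by (rule measure_pmf.Chebyshev_inequality) (use t int in auto)
  also have "measure_pmf.variance M X = measure_pmf.expectation M (\<lambda>R. (X R)\<^sup>2) - \<mu>\<^sup>2"
    using EX by (subst measure_pmf.variance_eq) (auto simp: int \<mu>_def)
  finally show "measure_pmf.prob M {R. \<bar>X R - (\<Sum>i\<in>I. P (F i))\<bar> \<ge> t}
       \<le> (\<Sum>i\<in>I. \<Sum>j\<in>{j\<in>I. F i \<inter> F j \<noteq> {}}. P (F i \<union> F j)) / t\<^sup>2"
    using * t EX by (simp add: divide_right_mono order_trans)
qed

lemma random_subset_concentration:
  assumes "finite A" "0 \<le> p" "p \<le> 1" "D \<subseteq> A" "t > 0"
  shows "measure_pmf.prob (random_subset A p) {R. \<bar>real (card (R \<inter> D)) - p * real (card D)\<bar> \<ge> t}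
    \<le> p * real (card D) / t\<^sup>2"
proof -
  have finD: "finite D" using assms finite_subset by blast
  let ?P = "\<lambda>S. measure_pmf.prob (random_subset A p) {R. S \<subseteq> R}"
  have P1: "?P {e} = p" if "e \<in> D" for e
    using prob_superset_random_subset[OF assms(1-3), of "{e}"] that assms(4) by auto
  have "measure_pmf.prob (random_subset A p) {R. \<bar>real (card {e\<in>D. {e} \<subseteq> R}) - (\<Sum>e\<in>D. ?P {e})\<bar> \<ge> t}
    \<le> (\<Sum>e\<in>D. \<Sum>e'\<in>{e'\<in>D. {e} \<inter> {e'} \<noteq> {}}. ?P ({e} \<union> {e'})) / t\<^sup>2"
  proof (rule second_moment)
    fix i j assume ij: "i \<in> D" "j \<in> D" "{i} \<inter> {j} = {}"
    have "?P {i, j} = p\<^sup>2"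
      using prob_superset_random_subset[OF assms(1-3), of "{i, j}"] ij assms(4) by (auto simp: power2_eq_square)
    thus "?P ({i} \<union> {j}) = ?P {i} * ?P {j}" using P1 ij by (simp add: power2_eq_square insert_commute)
  qed (use assms finD in auto)
  also have "(\<Sum>e\<in>D. \<Sum>e'\<in>{e'\<in>D. {e} \<inter> {e'} \<noteq> {}}. ?P ({e} \<union> {e'})) = (\<Sum>e\<in>D. p)"
  proof (intro sum.cong refl)
    fix e assume e: "e \<in> D"
    hence "{e'\<in>D. {e} \<inter> {e'} \<noteq> {}} = {e}" by auto
    thus "(\<Sum>e'\<in>{e'\<in>D. {e} \<inter> {e'} \<noteq> {}}. ?P ({e} \<union> {e'})) = p" using P1[OF e] by simp
  qed
  also have "(\<Sum>e\<in>D. ?P {e}) = p * real (card D)" using P1 by simp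
  also have "(\<lambda>R. {e\<in>D. {e} \<subseteq> R}) = (\<lambda>R. R \<inter> D)" by auto
  finally show ?thesis by (simp add: mult.commute)
qed

section \<open>The hypergraph of cliques\<close>

text \<open>The hypergraph to which containers are applied: its vertices are the pairs in
  \<open>U\<close>, its edges the \<open>(r choose 2)\<close>-sets of pairs that form a complete
  graph on \<open>r\<close> vertices.\<close>

definition clique_weight :: "nat \<Rightarrow> 'a set \<Rightarrow> 'a set set \<Rightarrow> real" where
  "clique_weight r U f = (if \<exists>X \<in> nsets U r. f = nsets X 2 then 1 else 0)"

lemma Union_nsets_2:
  assumes "finite X" "card X \<ge> 2"
  shows "\<Union> (nsets X 2) = X"
proof
  show "X \<subseteq> \<Union> (nsets X 2)"
  proof
    fix x assume x: "x \<in> X"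
    hence "card (X - {x}) \<noteq> 0" using assms by simp
    then obtain y where "y \<in> X - {x}" by (metis card.empty ex_in_conv)
    hence "{x, y} \<in> nsets X 2" using x by auto
    thus "x \<in> \<Union> (nsets X 2)" by blast
  qed
qed (auto simp: nsets_def)

text \<open>For \<open>r \<ge> 2\<close> a vertex set is the union of its pairs, so summing over
  sets of pairs is counting vertex sets.\<close>

lemma wdeg_clique_weight:
  assumes U: "finite U" and C: "C \<subseteq> nsets U 2" and r: "r \<ge> 2"
  shows "wdeg C (r choose 2) (clique_weight r U) T
       = real (card {X \<in> nsets U r. T \<subseteq> nsets X 2 \<and> nsets X 2 \<subseteq> C})"
proof -
  let ?S = "{X \<in> nsets U r. T \<subseteq> nsets X 2 \<and> nsets X 2 \<subseteq> C}"
  have finC: "finite C" using C U finite_subset finite_imp_finite_nsets by metis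
  have inj: "inj_on (\<lambda>X. nsets X 2) ?S"
    using r by (intro inj_on_inverseI[where g = Union]) (auto simp: nsets_def[of U] intro!: Union_nsets_2)
  have eq: "{f \<in> {f \<in> nsets C (r choose 2). T \<subseteq> f}. \<exists>X \<in> nsets U r. f = nsets X 2} = (\<lambda>X. nsets X 2) ` ?S"
    by (auto simp: nsets_def[of U] nsets_def[of C] card_nsets finite_imp_finite_nsets)
  have "wdeg C (r choose 2) (clique_weight r U) T
      = real (card {f \<in> {f \<in> nsets C (r choose 2). T \<subseteq> f}. \<exists>X \<in> nsets U r. f = nsets X 2})"
    unfolding wdeg_def clique_weight_def using finC
    by (subst sum.inter_filter[symmetric]) (auto simp: finite_imp_finite_nsets)
  also have "\<dots> = real (card ?S)" unfolding eq using inj by (simp add: card_image)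
  finally show ?thesis .
qed

lemma wdeg_clique_weight_empty:
  assumes "finite U" "C \<subseteq> nsets U 2" "r \<ge> 2"
  shows "wdeg C (r choose 2) (clique_weight r U) {} = real (card (cliques r U C))"
  using wdeg_clique_weight[OF assms, of "{}"] by (simp add: cliques_def)

lemma wdeg_clique_weight_complete:
  assumes "finite U" "r \<ge> 2"
  shows "wdeg (nsets U 2) (r choose 2) (clique_weight r U) {} = real (card U choose r)"
proof -
  have "cliques r U (nsets U 2) = nsets U r"
    unfolding cliques_def using nsets_mono[of _ U 2] by (auto simp: nsets_def)
  thus ?thesis using assms by (simp add: wdeg_clique_weight_empty)
qed

section \<open>Numerical estimates and the spread of the clique hypergraph\<close>

lemma choose_le_pow: "n choose k \<le> n ^ k"
  by (cases "k \<le> n") (auto simp: binomial_le_pow binomial_eq_0)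

lemma card_supersets_le:
  assumes U: "finite U" and Y: "Y \<subseteq> U" "card Y \<le> r"
  shows "card {X \<in> nsets U r. Y \<subseteq> X} \<le> card U ^ (r - card Y)"
proof -
  let ?S = "{X \<in> nsets U r. Y \<subseteq> X}"
  have finY: "finite Y" using U Y finite_subset by blast
  have inj: "inj_on (\<lambda>X. X - Y) ?S" by (auto simp: inj_on_def)
  have "card ?S = card ((\<lambda>X. X - Y) ` ?S)" using inj by (simp add: card_image)
  also have "\<dots> \<le> card (nsets U (r - card Y))"
    using U finY by (intro card_mono) (auto simp: finite_imp_finite_nsets nsets_def card_Diff_subset)
  also have "\<dots> = (card U choose (r - card Y))" using U by (simp add: card_nsets)
  also have "\<dots> \<le> card U ^ (r - card Y)" by (rule choose_le_pow)
  finally show ?thesis .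
qed

text \<open>The solution \<open>q\<close> of \<open>n ^ (r-2) * q ^ (k-1) = 1\<close> for
  \<open>k = r choose 2\<close>, where \<open>n ^ r * q ^ k = n ^ 2 * q\<close>. The exponent is the
  reciprocal of \<open>(r+1)/2\<close>, the 2-density of the complete graph on \<open>r\<close>
  vertices. It also serves as the \<open>\<tau>\<close> of the container lemma.\<close>

definition turan_scale :: "nat \<Rightarrow> nat \<Rightarrow> real" where
  "turan_scale r n = real n powr (- 2 / (real r + 1))"

lemma real_choose_two: "real (v choose 2) = real v * (real v - 1) / 2"
proof (induction v)
  case (Suc v)
  have "real (Suc v choose 2) = real v + real (v choose 2)"
    by (simp add: numeral_2_eq_2)
  thus ?case using Suc by (simp add: field_simps)
qed simp

lemma choose_two_ge_3:
  assumes "r \<ge> 3"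
  shows "r choose 2 \<ge> 3"
proof -
  have "3 choose 2 \<le> r choose 2" using assms by (intro binomial_right_mono)
  thus ?thesis by (simp add: numeral_eq_Suc)
qed

text \<open>The clique count as the edge count times the inverse of the threshold function; every
  comparison of cliques with edges goes through this factorisation.\<close>

lemma clique_count_eq:
  fixes n q :: real
  assumes "r \<ge> 3"
  shows "n ^ r * q ^ (r choose 2) = n\<^sup>2 * q * (n ^ (r - 2) * q ^ ((r choose 2) - 1))"
proof -
  have "r - 2 + 2 = r" using assms by simp
  hence "n ^ r = n ^ (r - 2) * n\<^sup>2" using power_add[of n "r - 2" 2] by (simp only:)
  moreover have "q ^ (r choose 2) = q ^ ((r choose 2) - 1) * q"
    using choose_two_ge_3[OF assms] by (cases "r choose 2") auto
  ultimately show ?thesis by (simp add: mult_ac)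
qed

text \<open>Among graphs with \<open>v\<close> vertices the complete one is the worst case, and
  \<open>(v choose 2) - 1 = (v - 2) * (v + 1) / 2\<close>. Thus the claim is that its 2-density
  \<open>(v + 1) / 2\<close> does not exceed \<open>(r + 1) / 2\<close>.\<close>

lemma turan_scale_power_ge:
  assumes n: "n \<ge> 1" and v: "2 \<le> v" "v \<le> r" and j: "j \<le> v choose 2" "j \<ge> 1"
  shows "real n ^ (r - v) \<le> turan_scale r n ^ (j - 1) * real n ^ (r - 2)"
proof -
  have n0: "real n > 0" using n by simp
  have "2 * (real j - 1) \<le> (real v - 2) * (real v + 1)"
    using j(1) real_choose_two[of v] by (simp add: field_simps flip: of_nat_le_iff[where ?'a = real])
  also have "\<dots> \<le> (real v - 2) * (real r + 1)" using v by (intro mult_left_mono) auto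
  finally have *: "2 * (real j - 1) / (real r + 1) \<le> real v - 2" by (simp add: field_simps)
  have "real n ^ (r - v) = real n powr (real r - real v)"
    using n0 v by (simp add: powr_realpow[symmetric] of_nat_diff)
  also have "\<dots> \<le> real n powr ((- 2 / (real r + 1)) * (real j - 1) + (real r - 2))"
    using * n by (intro powr_mono) (auto simp: field_simps)
  also have "\<dots> = turan_scale r n ^ (j - 1) * real n ^ (r - 2)"
    unfolding turan_scale_def powr_add using n0 v j
    by (simp add: powr_realpow[symmetric] of_nat_diff powr_powr)
  finally show ?thesis .
qed

lemma turan_scale_bounds: "n \<ge> 1 \<Longrightarrow> 0 < turan_scale r n" "n \<ge> 1 \<Longrightarrow> turan_scale r n \<le> 1"
proof -
  assume n: "n \<ge> 1"
  show "0 < turan_scale r n" using n by (simp add: turan_scale_def)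
  have "turan_scale r n \<le> real n powr 0"
    unfolding turan_scale_def using n by (intro powr_mono) auto
  thus "turan_scale r n \<le> 1" using n by simp
qed

text \<open>An \<open>r\<close>-clique containing all pairs of \<open>T\<close> contains the set
  \<open>Y\<close> of their endpoints, so its degree depends on \<open>card Y\<close> alone, up to
  constants: at most \<open>n ^ (r - v)\<close> choices, and none if \<open>v > r\<close>.\<close>

lemma spread_clique_weight:
  assumes U: "finite U" and r: "r \<ge> 2" and n: "card U \<ge> r"
  shows "spread (real r ^ r) (turan_scale r (card U)) (nsets U 2) (r choose 2) (clique_weight r U)"
  unfolding spread_def
proof (intro conjI allI impI)
  define n where "n = card U"
  define \<tau> where "\<tau> = turan_scale r n"
  have n1: "n \<ge> 1" "n \<ge> 2" "n \<ge> r" using n r by (auto simp: n_def)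
  have \<tau>: "\<tau> > 0" "\<tau> \<le> 1" using turan_scale_bounds[OF n1(1)] by (auto simp: \<tau>_def)
  have N: "card (nsets U 2) = (n choose 2)" using U by (simp add: card_nsets n_def)
  have N0: "n choose 2 > 0" using n1 by (simp add: zero_less_binomial)
  have e: "wdeg (nsets U 2) (r choose 2) (clique_weight r U) {} = real (n choose r)"
    using U r by (simp add: wdeg_clique_weight_complete n_def)
  fix T :: "'a set set" assume T: "T \<subseteq> nsets U 2" "T \<noteq> {}"
  define Y where "Y = \<Union> T"
  define v where "v = card Y"
  have YU: "Y \<subseteq> U" using T by (auto simp: Y_def nsets_def)
  have finY: "finite Y" using U YU finite_subset by blast
  have TY: "T \<subseteq> nsets Y 2" using T by (auto simp: Y_def nsets_def)
  have finT: "finite T" using TY finY finite_subset finite_imp_finite_nsets by metis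
  have j: "card T \<le> v choose 2"
    using card_mono[OF _ TY] finY by (simp add: finite_imp_finite_nsets card_nsets v_def)
  have j1: "card T \<ge> 1" using finT T by (simp add: Suc_le_eq card_gt_0_iff)
  have v2: "v \<ge> 2"
  proof (rule ccontr)
    assume "\<not> v \<ge> 2"
    hence "v choose 2 = 0" by (intro binomial_eq_0) simp
    thus False using j j1 by linarith
  qed
  have set_eq: "{X \<in> nsets U r. T \<subseteq> nsets X 2 \<and> nsets X 2 \<subseteq> nsets U 2} \<subseteq> {X \<in> nsets U r. Y \<subseteq> X}"
    by (auto simp: Y_def nsets_def)
  have finS: "finite {X \<in> nsets U r. Y \<subseteq> X}" using U by (simp add: finite_imp_finite_nsets)
  have deg: "wdeg (nsets U 2) (r choose 2) (clique_weight r U) T \<le> real (card {X \<in> nsets U r. Y \<subseteq> X})"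
    using wdeg_clique_weight[OF U order_refl r, of T] card_mono[OF finS set_eq] by simp
  \<comment> \<open>The constant \<open>r ^ r\<close> comes from
    \<open>(n / r) ^ r \<le> n choose r\<close>.\<close>
  have rhs: "real r ^ r * \<tau> ^ (card T - 1) * real (n choose r) / real (n choose 2) \<ge> \<tau> ^ (card T - 1) * real n ^ (r - 2)"
  proof -
    have "(real n / real r) ^ r \<le> real (n choose r)"
      using binomial_ge_n_over_k_pow_k[of r n] n1 by simp
    hence 1: "real n ^ r \<le> real r ^ r * real (n choose r)" using r by (simp add: power_divide field_simps)
    have 2: "real (n choose 2) \<le> real n ^ 2"
      using choose_le_pow[of n 2] by (simp flip: of_nat_power)
    have "\<tau> ^ (card T - 1) * real n ^ (r - 2) = \<tau> ^ (card T - 1) * (real n ^ r / real n ^ 2)"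
      using n1 r by (simp add: power_diff)
    also have "\<dots> \<le> \<tau> ^ (card T - 1) * (real r ^ r * real (n choose r) / real (n choose 2))"
      using 1 2 N0 \<tau> by (intro mult_left_mono frac_le) auto
    finally show ?thesis by (simp add: mult_ac)
  qed
  show "wdeg (nsets U 2) (r choose 2) (clique_weight r U) T \<le> real r ^ r * turan_scale r (card U) ^ (card T - 1) *
         wdeg (nsets U 2) (r choose 2) (clique_weight r U) {} / real (card (nsets U 2))"
  proof (cases "v \<le> r")
    case True
    have "real (card {X \<in> nsets U r. Y \<subseteq> X}) \<le> real (n ^ (r - v))"
      using card_supersets_le[OF U YU] True by (simp only: of_nat_le_iff n_def v_def)
    also have "\<dots> \<le> \<tau> ^ (card T - 1) * real n ^ (r - 2)"
      using turan_scale_power_ge[OF n1(1) v2 True j j1] by (simp add: \<tau>_def)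
    finally show ?thesis using deg rhs e N by (simp add: \<tau>_def n_def)
  next
    case False
    have none: "{X \<in> nsets U r. Y \<subseteq> X} = {}"
      using False card_mono[of _ Y] by (force simp: nsets_def v_def)
    have "wdeg (nsets U 2) (r choose 2) (clique_weight r U) T \<le> 0" using deg unfolding none by simp
    also have "0 \<le> \<tau> ^ (card T - 1) * real n ^ (r - 2)" using \<tau> by simp
    finally show ?thesis using rhs e N by (simp add: \<tau>_def n_def)
  qed
qed (auto simp: clique_weight_def)

lemma wfree_clique_weight:
  assumes "cliques r U H = {}"
  shows "wfree (r choose 2) (clique_weight r U) H"
  using assms unfolding wfree_def clique_weight_def cliques_def by (auto split: if_splits)

section \<open>Union bound over fingerprints\<close>

lemma sum_power_card_Pow:
  fixes z :: real
  assumes "finite V"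
  shows "(\<Sum>S\<in>Pow V. z ^ card S) = (1 + z) ^ card V"
  using prod_add[OF assms, of "\<lambda>_. z" "\<lambda>_. 1"] by (simp add: add.commute)

text \<open>A weighted union bound over the fingerprints \<open>S\<close>: a bad \<open>R\<close> contains some \<open>S\<close> with at most \<open>b\<close>
  elements and at least \<open>m\<close> further elements of the container, so \<open>x\<^bsup>card S - b\<^esup> y\<^bsup>card (R \<inter> D S) - m\<^esup> \<ge> 1\<close>.\<close>

lemma container_union_bound:
  fixes V :: "'a set"
  assumes V: "finite V" and q: "0 \<le> q" "q \<le> 1"
    and con: "containers V Q b P"
    and P: "\<And>C. P C \<Longrightarrow> C \<subseteq> V \<and> real (card C) \<le> d"
    and x: "0 < x" "x \<le> 1" and y: "1 \<le> y"
  shows "measure_pmf.prob (random_subset V q) {R. \<exists>H. H \<subseteq> R \<and> Q H \<and> real (card H) \<ge> m + b}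
    \<le> exp (b * ln (1 / x) - m * ln y + x * q * real (card V) + q * (y - 1) * d)"
proof -
  obtain g C where s: "is_scheme V Q b P g C" using con by (auto simp: containers_def)
  define SS where "SS = {S \<in> Pow V. P (C S)}"
  \<comment> \<open>Removing \<open>S\<close> makes the events \<open>S \<subseteq> R\<close> and
    those about \<open>R \<inter> D S\<close> concern disjoint sets of coordinates.\<close>
  define D where "D S = C S - S" for S
  define a where "a = x powr (- b) * y powr (- m)"
  have a: "a > 0" using x y by (simp add: a_def)
  have finSS: "finite SS" using V by (simp add: SS_def)
  have SSV: "S \<subseteq> V" "D S \<subseteq> V" "S \<inter> D S = {}" "card (D S) \<le> d" if "S \<in> SS" for S
  proof -
    show "S \<subseteq> V" "D S \<subseteq> V" "S \<inter> D S = {}" using that P by (auto simp: SS_def D_def)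
    have "C S \<subseteq> V" using that P by (simp add: SS_def)
    hence "finite (C S)" using V finite_subset by blast
    hence "card (D S) \<le> card (C S)" by (intro card_mono) (auto simp: D_def)
    thus "card (D S) \<le> d" using that P[of "C S"] by (auto simp: SS_def)
  qed
  have wit: "1 \<le> (\<Sum>S\<in>SS. a * x ^ card S * ((if S \<subseteq> R then 1 else 0) * y ^ card (R \<inter> D S)))"
    if R: "R \<subseteq> V" and H: "H \<subseteq> R" "Q H" "real (card H) \<ge> m + b" for R H
  proof -
    have HV: "H \<subseteq> V" using R H by auto
    define S where "S = g H"
    have SH: "S \<subseteq> H" using is_schemeD(2)[OF s HV] by (simp add: S_def)
    \<comment> \<open>The interval condition with \<open>J = g H\<close>: the container is a
      function of the fingerprint, so the sum below runs over fingerprints only.\<close>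
    have CS: "C S = C H" using is_schemeD(1)[OF s HV, of S] SH by (simp add: S_def)
    have *: "real (card S) \<le> b" "H \<subseteq> S \<union> C S" "P (C S)"
      using is_schemeD(3)[OF s HV H(2)] unfolding CS by (auto simp: S_def)
    have "S \<in> SS" using SH HV * by (auto simp: SS_def)
    have finR: "finite R" "finite H" using R HV V finite_subset by auto
    have "card H \<le> card S + card (R \<inter> D S)"
    proof -
      have "H \<subseteq> S \<union> (R \<inter> D S)" using * H by (auto simp: D_def)
      hence "card H \<le> card (S \<union> (R \<inter> D S))" using finR SH finite_subset by (intro card_mono) auto
      also have "\<dots> \<le> card S + card (R \<inter> D S)" by (rule card_Un_le)
      finally show ?thesis .
    qed
    hence m: "m \<le> real (card (R \<inter> D S))" using H(3) * by linarith
    have "1 = a * (x powr b * y powr m)"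
      using x y by (simp add: a_def powr_minus field_simps)
    also have "\<dots> \<le> a * (x powr card S * y powr card (R \<inter> D S))"
      using a * m x y by (intro mult_left_mono mult_mono powr_mono powr_mono') auto
    also have "\<dots> = a * x ^ card S * ((if S \<subseteq> R then 1 else 0) * y ^ card (R \<inter> D S))"
      using x y SH H by (simp add: powr_realpow)
    also have "\<dots> \<le> (\<Sum>S\<in>SS. a * x ^ card S * ((if S \<subseteq> R then 1 else 0) * y ^ card (R \<inter> D S)))"
      using finSS \<open>S \<in> SS\<close> a x y by (intro member_le_sum) auto
    finally show ?thesis .
  qed
  have fin: "finite (set_pmf (random_subset V q))" using V by simp
  have "measure_pmf.prob (random_subset V q) {R. \<exists>H. H \<subseteq> R \<and> Q H \<and> real (card H) \<ge> m + b}
    \<le> measure_pmf.expectation (random_subset V q)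
        (\<lambda>R. \<Sum>S\<in>SS. a * x ^ card S * ((if S \<subseteq> R then 1 else 0) * y ^ card (R \<inter> D S)))"
    unfolding prob_eq_expectation
  proof (rule expectation_mono_finite[OF fin])
    fix R assume "R \<in> set_pmf (random_subset V q)"
    hence R: "R \<subseteq> V" using set_random_subset by blast
    have "0 \<le> (\<Sum>S\<in>SS. a * x ^ card S * ((if S \<subseteq> R then 1 else 0) * y ^ card (R \<inter> D S)))"
      using a x y by (intro sum_nonneg) auto
    thus "(if R \<in> {R. \<exists>H. H \<subseteq> R \<and> Q H \<and> real (card H) \<ge> m + b} then 1 else 0)
       \<le> (\<Sum>S\<in>SS. a * x ^ card S * ((if S \<subseteq> R then 1 else 0) * y ^ card (R \<inter> D S)))"
      using wit[OF R] by auto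
  qed
  also have "\<dots> = (\<Sum>S\<in>SS. measure_pmf.expectation (random_subset V q)
        (\<lambda>R. a * x ^ card S * ((if S \<subseteq> R then 1 else 0) * y ^ card (R \<inter> D S))))"
    by (rule Bochner_Integration.integral_sum) (rule integrable_measure_pmf_finite[OF fin])
  also have "\<dots> = (\<Sum>S\<in>SS. a * x ^ card S * (q ^ card S * (1 + q * (y - 1)) ^ card (D S)))"
    using V q y SSV by (intro sum.cong refl) (simp add: expectation_superset_power)
  also have "\<dots> \<le> (\<Sum>S\<in>SS. a * exp (q * (y - 1) * d) * (x * q) ^ card S)"
  proof (intro sum_mono)
    fix S assume S: "S \<in> SS"
    have "(1 + q * (y - 1)) ^ card (D S) \<le> exp (q * (y - 1)) ^ card (D S)"
      using q y by (intro power_mono exp_ge_add_one_self) auto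
    also have "\<dots> = exp (q * (y - 1) * card (D S))" by (simp add: exp_of_nat_mult mult.commute)
    also have "\<dots> \<le> exp (q * (y - 1) * d)" using SSV(4)[OF S] q y by (auto intro!: mult_left_mono)
    finally have "a * x ^ card S * (q ^ card S * (1 + q * (y - 1)) ^ card (D S))
        \<le> a * x ^ card S * (q ^ card S * exp (q * (y - 1) * d))"
      using a x q by (intro mult_left_mono) auto
    thus "a * x ^ card S * (q ^ card S * (1 + q * (y - 1)) ^ card (D S)) \<le> a * exp (q * (y - 1) * d) * (x * q) ^ card S"
      by (simp add: power_mult_distrib mult_ac)
  qed
  \<comment> \<open>The bound \<open>b\<close> on fingerprint sizes is already accounted for by the
    factor \<open>x powr (- b)\<close> in \<open>a\<close>, so all subsets may be summed over and no
    binomial coefficients have to be estimated.\<close>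
  also have "\<dots> \<le> (\<Sum>S\<in>Pow V. a * exp (q * (y - 1) * d) * (x * q) ^ card S)"
    using V a x q by (intro sum_mono2) (auto simp: SS_def)
  also have "\<dots> = a * exp (q * (y - 1) * d) * (1 + x * q) ^ card V"
    by (simp add: sum_distrib_left[symmetric] sum_power_card_Pow[OF V])
  also have "\<dots> \<le> a * exp (q * (y - 1) * d) * exp (x * q) ^ card V"
    using a x q by (intro mult_left_mono power_mono exp_ge_add_one_self) auto
  also have "\<dots> = exp (b * ln (1 / x) - m * ln y + x * q * real (card V) + q * (y - 1) * d)"
    using x y by (simp add: a_def powr_def exp_add exp_diff exp_minus ln_div exp_of_nat_mult[symmetric] field_simps)
  finally show ?thesis .
qed

section \<open>The random Turan theorem\<close>

text \<open>The Turan density is \<open>1 - 1 / (r - 1)\<close>, so exceeding it means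
  \<open>t > r - 1\<close> in the clique count. Density is measured here against
  \<open>n choose 2\<close> and there against \<open>n\<^sup>2 / 2\<close>; the gap between
  \<open>\<rho>\<close> and \<open>\<rho>'\<close> absorbs the difference once
  \<open>n \<ge> n1\<close>.\<close>

lemma dense_supersaturation:
  fixes \<rho> :: real
  assumes r: "r \<ge> 2" and \<rho>: "\<rho> > (real r - 2) / (real r - 1)"
  shows "\<exists>a>0. \<exists>n1. \<forall>(U::'a set) C. finite U \<longrightarrow> card U \<ge> n1 \<longrightarrow> C \<subseteq> nsets U 2 \<longrightarrow>
     real (card C) \<ge> \<rho> * real (card U choose 2) \<longrightarrow> real (card (cliques r U C)) \<ge> a * real (card U) ^ r"
proof -
  define \<pi> where "\<pi> = (real r - 2) / (real r - 1)"
  have \<pi>: "\<pi> \<ge> 0" "\<pi> < 1" using r by (auto simp: \<pi>_def)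
  \<comment> \<open>The cap at 1 guarantees \<open>\<rho>' < 1\<close>, so that \<open>t\<close> is
    a positive real.\<close>
  define \<rho>' where "\<rho>' = (\<pi> + min \<rho> 1) / 2"
  have \<rho>': "\<pi> < \<rho>'" "\<rho>' < \<rho>" "\<rho>' < 1" using \<pi> \<rho> by (auto simp: \<rho>'_def \<pi>_def[symmetric])
  define t where "t = 1 / (1 - \<rho>')"
  have t: "t > 0" "1 - 1 / t = \<rho>'" using \<rho>' by (auto simp: t_def)
  have "1 - \<rho>' < 1 - \<pi>" using \<rho>' by simp
  also have "1 - \<pi> = 1 / (real r - 1)" using r by (simp add: \<pi>_def field_simps)
  finally have rt: "real r < t + 1" using \<rho>' r by (simp add: t_def field_simps)
  define a where "a = (\<Prod>i<r. (1 - real i / t) / real (Suc i))"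
  have a: "a > 0" unfolding a_def using rt t(1) by (rule supersaturation_constant_pos)
  define n1 where "n1 = nat \<lceil>\<rho> / (\<rho> - \<rho>')\<rceil> + 1"
  show ?thesis
  proof (intro exI[of _ a] conjI a exI[of _ n1] allI impI)
    fix U :: "'a set" and C
    assume U: "finite U" "card U \<ge> n1" and C: "C \<subseteq> nsets U 2" "real (card C) \<ge> \<rho> * real (card U choose 2)"
    define n where "n = real (card U)"
    have "\<rho> / (\<rho> - \<rho>') \<le> real n1" unfolding n1_def by linarith
    also have "\<dots> \<le> n" using U by (simp add: n_def)
    finally have "\<rho> \<le> n * (\<rho> - \<rho>')" using \<rho>' by (simp add: field_simps)
    moreover have n: "n > 0" using U by (simp add: n_def n1_def)
    ultimately have "\<rho> * n \<le> n * (\<rho> - \<rho>') * n" by (intro mult_right_mono) auto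
    hence "\<rho>' * n\<^sup>2 \<le> 2 * (\<rho> * real (card U choose 2))"
      by (simp add: real_choose_two n_def power2_eq_square algebra_simps)
    also have "\<dots> \<le> 2 * real (card C)" using C by simp
    finally have "2 * real (card C) \<ge> (1 - 1 / t) * (real (card U))\<^sup>2" by (simp add: t(2) n_def)
    moreover have "U \<noteq> {}" using n by (auto simp: n_def)
    ultimately show "real (card (cliques r U C)) \<ge> a * real (card U) ^ r"
      unfolding a_def using clique_supersaturation[OF U(1) _ C(1) _ rt t(1)] by blast
  qed
qed

text \<open>Removes one chosen pair for each member of \<open>Q\<close>. It serves twice: in the
  sparsified graph, and for the counterexample to the Turannical property below the
  threshold.\<close>

lemma clique_removal:
  fixes H :: "'a set set"
  assumes H: "finite H" and Q: "finite Q" "\<And>X. X \<in> Q \<Longrightarrow> nsets X 2 \<noteq> {}"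
  shows "\<exists>H'\<subseteq>H. card H \<le> card H' + card Q \<and> (\<forall>X\<in>Q. \<not> nsets X 2 \<subseteq> H')"
proof -
  have "\<forall>X\<in>Q. \<exists>e. e \<in> nsets X 2" using Q(2) by blast
  from bchoice[OF this] obtain \<phi> where \<phi>: "\<And>X. X \<in> Q \<Longrightarrow> \<phi> X \<in> nsets X 2" by blast
  have "card H \<le> card (H - \<phi> ` Q) + card (\<phi> ` Q)"
    using H Q(1) diff_card_le_card_Diff[of "\<phi> ` Q" H] by simp
  moreover have "card (\<phi> ` Q) \<le> card Q" using Q(1) by (rule card_image_le)
  ultimately show ?thesis using \<phi> by (intro exI[of _ "H - \<phi> ` Q"]) auto
qed

lemma turan_scale_power:
  assumes "n \<ge> 1" "r \<ge> 3"
  shows "real n ^ (r - 2) * turan_scale r n ^ ((r choose 2) - 1) = 1"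
proof -
  have k: "r choose 2 \<ge> 1" using assms by (simp add: Suc_le_eq zero_less_binomial)
  have kk: "real ((r choose 2) - 1) * (2 / (real r + 1)) = real r - 2"
    using k real_choose_two[of r] assms by (simp add: of_nat_diff field_simps)
  have "turan_scale r n ^ ((r choose 2) - 1) = real n powr (- (real r - 2))"
    unfolding turan_scale_def kk[symmetric] using assms
    by (simp add: powr_powr powr_realpow[symmetric] mult.commute)
  also have "\<dots> = inverse (real n ^ (r - 2))"
    unfolding powr_minus using assms by (simp add: powr_realpow[symmetric] of_nat_diff)
  finally show ?thesis using assms by simp
qed

lemma turan_scale_mult_choose_ge:
  assumes "n \<ge> 1" "r \<ge> 1"
  shows "turan_scale r n * real (n choose 2) \<ge> (real n - 1) / 2"
proof -
  have "2 / (real r + 1) \<le> 1" using assms by simp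
  hence "real n powr (-1) \<le> turan_scale r n"
    unfolding turan_scale_def using assms by (intro powr_mono) auto
  hence "1 / real n * real (n choose 2) \<le> turan_scale r n * real (n choose 2)"
    using assms by (intro mult_right_mono) (auto simp: powr_minus_divide)
  thus ?thesis using assms by (simp add: real_choose_two)
qed

lemma turan_scale_mult_choose_at_top:
  assumes "r \<ge> 1"
  shows "filterlim (\<lambda>n. turan_scale r n * real (n choose 2)) at_top sequentially"
proof (rule filterlim_at_top_mono)
  show "filterlim (\<lambda>n. (real n - 1) / 2) at_top sequentially" by real_asymp
  show "\<forall>\<^sub>F n in sequentially. (real n - 1) / 2 \<le> turan_scale r n * real (n choose 2)"
    using eventually_ge_at_top[of 1] by eventually_elim (use assms turan_scale_mult_choose_ge in auto)
qed

lemma turan_scale_tendsto_0: "(\<lambda>n. turan_scale r n) \<longlonglongrightarrow> 0"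
  unfolding turan_scale_def
  by (rule tendsto_neg_powr[OF _ filterlim_real_sequentially]) simp

text \<open>A clique-free \<open>H\<close> consists of a small fingerprint and a part of a container
  with at most \<open>\<rho>1 * N\<close> pairs. The random graph is expected to meet the container
  in at most \<open>\<rho>1 * q * N\<close> pairs, whereas \<open>H\<close> would need
  \<open>\<rho>2 * q * N\<close> there; a Chernoff bound beats the number of fingerprints if
  \<open>C0\<close> is large.\<close>

theorem random_turan_threshold:
  fixes \<rho> :: real
  assumes r: "r \<ge> 3" and \<rho>: "\<rho> > (real r - 2) / (real r - 1)"
  shows "\<exists>C0\<ge>1. (\<lambda>n. measure_pmf.prob (random_subset (nsets {1..n} 2) (C0 * turan_scale r n))
     {R. \<exists>H. H \<subseteq> R \<and> cliques r {1..n} H = {} \<and>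
         real (card H) \<ge> \<rho> * (C0 * turan_scale r n * real (n choose 2))}) \<longlonglongrightarrow> 0"
proof -
  define \<pi> where "\<pi> = (real r - 2) / (real r - 1)"
  have \<pi>: "\<pi> > 0" using r by (auto simp: \<pi>_def)
  \<comment> \<open>The gap from \<open>\<rho>1\<close> to \<open>\<rho>2\<close> drives the
    Chernoff bound; the gap from \<open>\<rho>2\<close> to \<open>\<rho>\<close> pays for the edges
    of the fingerprint.\<close>
  define \<rho>1 where "\<rho>1 = \<pi> + (\<rho> - \<pi>) / 3"
  define \<rho>2 where "\<rho>2 = \<pi> + 2 * (\<rho> - \<pi>) / 3"
  have \<rho>s: "\<pi> < \<rho>1" "\<rho>1 < \<rho>2" "\<rho>2 < \<rho>" "0 < \<rho>1" 
    using \<rho>[folded \<pi>_def] \<pi> by (auto simp: \<rho>1_def \<rho>2_def field_simps)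
  define k where "k = r choose 2"
  have k: "k > 0" using r by (simp add: k_def zero_less_binomial)
  have "\<rho>1 > (real r - 2) / (real r - 1)" using \<rho>s by (simp add: \<pi>_def)
  from dense_supersaturation[OF _ this] r obtain a n1 where a: "a > 0" and sat:
    "\<forall>(U::nat set) C. finite U \<longrightarrow> card U \<ge> n1 \<longrightarrow> C \<subseteq> nsets U 2 \<longrightarrow>
     real (card C) \<ge> \<rho>1 * real (card U choose 2) \<longrightarrow> real (card (cliques r U C)) \<ge> a * real (card U) ^ r"
    by (metis (lifting) One_nat_def Suc_1 Suc_leD numeral_3_eq_3)
  have "real r ^ r \<ge> 1" using r by simp
  from container_lemma[OF this a k] obtain M where M: "M > 0" and con:
    "\<forall>(V::nat set set) w \<tau>. finite V \<longrightarrow> V \<noteq> {} \<longrightarrow> 0 < \<tau> \<longrightarrow> \<tau> * real (card V) \<ge> 1 \<longrightarrow>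
     spread (real r ^ r) \<tau> V k w \<longrightarrow> wdeg V k w {} > 0 \<longrightarrow>
     containers V (wfree k w) (M * \<tau> * real (card V)) (\<lambda>C. C \<subseteq> V \<and> wdeg C k w {} < a * wdeg V k w {})"
    by (elim exE conjE)
  \<comment> \<open>With \<open>ln (1 + s) \<ge> s - s\<^sup>2\<close>, valid for
    \<open>s \<le> 1\<close>, the rate \<open>\<kappa>\<close> is at least
    \<open>s * (\<rho>2 - \<rho>1 - \<rho>2 * s)\<close>, and this choice of \<open>s\<close> makes
    it positive.\<close>
  define s where "s = min 1 ((\<rho>2 - \<rho>1) / (2 * \<rho>2))"
  have s: "0 < s" "s \<le> 1" "s \<le> (\<rho>2 - \<rho>1) / (2 * \<rho>2)" using \<rho>s by (auto simp: s_def)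
  define y where "y = 1 + s"
  \<comment> \<open>The Chernoff exponent per unit of \<open>q * N\<close>, before the cost of
    fingerprints.\<close>
  define \<kappa> where "\<kappa> = \<rho>2 * ln y - \<rho>1 * (y - 1)"
  have "\<kappa> > 0"
  proof -
    have "2 * (\<rho>2 * s) \<le> \<rho>2 - \<rho>1" using s(3) \<rho>s by (simp add: field_simps)
    hence "\<rho>2 * s < \<rho>2 - \<rho>1" using \<rho>s by linarith
    hence "s * (\<rho>2 * s) < s * (\<rho>2 - \<rho>1)" using s by (intro mult_strict_left_mono) auto
    hence "0 < \<rho>2 * (s - s\<^sup>2) - \<rho>1 * s" by (simp add: algebra_simps power2_eq_square)
    also have "\<dots> \<le> \<kappa>" unfolding \<kappa>_def y_def
      using s \<rho>s ln_one_plus_pos_lower_bound[of s] by (simp add: mult_left_mono)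
    finally show ?thesis .
  qed
  \<comment> \<open>The two costs of the fingerprints, \<open>x * q * N\<close> and
    \<open>b * ln (1 / x)\<close>, are to be at most a quarter of \<open>\<kappa> * q * N\<close>
    each; \<open>x\<close> settles the former and the last entry of \<open>C0\<close> the
    latter.\<close>
  define x where "x = min 1 (\<kappa> / 4)"
  have x: "0 < x" "x \<le> 1" "x \<le> \<kappa> / 4" using \<open>\<kappa> > 0\<close> by (auto simp: x_def)
  have lx: "ln (1 / x) \<ge> 0" using x by simp
  define C0 where "C0 = Max {1, M / (\<rho> - \<rho>2), 4 * M * ln (1 / x) / \<kappa>}"
  have C0: "C0 \<ge> 1" "C0 \<ge> M / (\<rho> - \<rho>2)" "C0 \<ge> 4 * M * ln (1 / x) / \<kappa>" by (auto simp: C0_def)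
  have MC: "M \<le> (\<rho> - \<rho>2) * C0" "M * ln (1 / x) \<le> \<kappa> / 4 * C0"
    using C0 \<rho>s \<open>\<kappa> > 0\<close> by (auto simp: field_simps)
  define q where "q n = C0 * turan_scale r n" for n
  define N where "N n = real (n choose 2)" for n
  define pr where "pr n = measure_pmf.prob (random_subset (nsets {1..n} 2) (q n))
     {R. \<exists>H. H \<subseteq> R \<and> cliques r {1..n} H = {} \<and> real (card H) \<ge> \<rho> * (q n * N n)}" for n
  have qN: "filterlim (\<lambda>n. turan_scale r n * N n) at_top sequentially"
    unfolding N_def using r by (intro turan_scale_mult_choose_at_top) auto
  have "(\<lambda>n. q n) \<longlonglongrightarrow> 0" unfolding q_def using tendsto_mult_right_zero[OF turan_scale_tendsto_0] by blast
  hence "\<forall>\<^sub>F n in sequentially. q n < 1" by (rule order_tendstoD) simp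
  moreover have "\<forall>\<^sub>F n in sequentially. turan_scale r n * N n \<ge> 1"
    using qN by (simp add: filterlim_at_top)
  ultimately have "\<forall>\<^sub>F n in sequentially. pr n \<le> exp (- (\<kappa> / 2 * (q n * N n)))"
    using eventually_ge_at_top[of n1] eventually_ge_at_top[of r]
  proof eventually_elim
    case (elim n)
    define U where "U = {1..n}"
    define V where "V = nsets U 2"
    define \<tau> where "\<tau> = turan_scale r n"
    define w :: "nat set set \<Rightarrow> real" where "w = clique_weight r U"
    have U: "finite U" "card U = n" by (auto simp: U_def)
    have V: "finite V" "real (card V) = N n" using U by (auto simp: V_def N_def finite_imp_finite_nsets)
    have n1: "n \<ge> 1" using elim r by linarith
    have \<tau>: "0 < \<tau>" using turan_scale_bounds[OF n1] by (simp add: \<tau>_def)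
    have qn: "0 < q n" "q n \<le> 1" using \<tau> C0 elim by (auto simp: q_def \<tau>_def)
    have N0: "N n > 0" using elim(2) \<tau> by (smt (verit) N_def \<tau>_def mult_nonneg_nonpos of_nat_0_le_iff)
    have tot: "wdeg V k w {} = real (n choose r)"
      unfolding V_def w_def k_def using U r by (simp add: wdeg_clique_weight_complete)
    have "containers V (wfree k w) (M * \<tau> * real (card V)) (\<lambda>C. C \<subseteq> V \<and> wdeg C k w {} < a * wdeg V k w {})"
    proof (rule con[rule_format])
      show "spread (real r ^ r) \<tau> V k w"
        using spread_clique_weight[OF U(1), of r] r elim U by (simp add: \<tau>_def V_def k_def w_def)
      show "V \<noteq> {}" using V N0 by auto
      show "wdeg V k w {} > 0" unfolding tot using elim by (simp add: zero_less_binomial)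
      show "\<tau> * real (card V) \<ge> 1" using elim V by (simp add: \<tau>_def)
    qed (use V \<tau> in auto)
    hence con': "containers V (wfree k w) (M * \<tau> * N n) (\<lambda>C. C \<subseteq> V \<and> real (card C) \<le> \<rho>1 * N n)"
    proof (rule containers_mono)
      fix C assume C: "C \<subseteq> V \<and> wdeg C k w {} < a * wdeg V k w {}"
      \<comment> \<open>The weight fraction allowed to containers is the supersaturation constant
        \<open>a\<close> itself: a larger container would span \<open>a * n ^ r\<close> cliques, but
        it spans fewer than \<open>a * (n choose r)\<close>.\<close>
      have "\<not> real (card C) \<ge> \<rho>1 * real (card U choose 2)"
      proof
        assume "real (card C) \<ge> \<rho>1 * real (card U choose 2)"
        hence "a * real n ^ r \<le> real (card (cliques r U C))"
          using sat[rule_format, of U C] C elim U by (auto simp: V_def)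
        also have "\<dots> = wdeg C k w {}"
          using C U r unfolding V_def w_def k_def by (subst wdeg_clique_weight_empty) auto
        also have "\<dots> < a * real (n choose r)" using C tot by simp
        also have "\<dots> \<le> a * real n ^ r"
          using a choose_le_pow[of n r] by (simp flip: of_nat_power)
        finally show False by simp
      qed
      thus "C \<subseteq> V \<and> real (card C) \<le> \<rho>1 * N n" using C U by (simp add: N_def)
    qed (use V in auto)
    have mb: "\<rho>2 * (q n * N n) + M * \<tau> * N n \<le> \<rho> * (q n * N n)"
    proof -
      have "M * (\<tau> * N n) \<le> (\<rho> - \<rho>2) * C0 * (\<tau> * N n)"
        using MC \<tau> N0 by (intro mult_right_mono) auto
      thus ?thesis by (simp add: q_def \<tau>_def algebra_simps)
    qed
    have "pr n \<le> measure_pmf.prob (random_subset V (q n))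
       {R. \<exists>H. H \<subseteq> R \<and> wfree k w H \<and> real (card H) \<ge> \<rho>2 * (q n * N n) + M * \<tau> * N n}"
      unfolding pr_def V_def[unfolded U_def]
    proof (intro measure_pmf.finite_measure_mono subsetI)
      fix R assume "R \<in> {R. \<exists>H. H \<subseteq> R \<and> cliques r {1..n} H = {} \<and> real (card H) \<ge> \<rho> * (q n * N n)}"
      then obtain H where H: "H \<subseteq> R" "cliques r U H = {}" "real (card H) \<ge> \<rho> * (q n * N n)"
        unfolding U_def by blast
      have "wfree k w H" unfolding k_def w_def using H(2) by (rule wfree_clique_weight)
      moreover have "real (card H) \<ge> \<rho>2 * (q n * N n) + M * \<tau> * N n" using H(3) mb by linarith
      ultimately show "R \<in> {R. \<exists>H. H \<subseteq> R \<and> wfree k w H \<and> real (card H) \<ge> \<rho>2 * (q n * N n) + M * \<tau> * N n}"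
        using H(1) by blast
    qed simp
    also have "\<dots> \<le> exp (M * \<tau> * N n * ln (1 / x) - \<rho>2 * (q n * N n) * ln y + x * q n * real (card V)
         + q n * (y - 1) * (\<rho>1 * N n))"
      using qn x s by (intro container_union_bound[OF V(1) _ _ con']) (auto simp: y_def)
    also have "\<dots> \<le> exp (- (\<kappa> / 2 * (q n * N n)))"
    proof -
      have "M * ln (1 / x) * (\<tau> * N n) \<le> \<kappa> / 4 * C0 * (\<tau> * N n)"
        using MC \<tau> N0 by (intro mult_right_mono) auto
      hence 1: "M * \<tau> * N n * ln (1 / x) \<le> \<kappa> / 4 * (q n * N n)" by (simp add: q_def \<tau>_def mult_ac)
      have 2: "x * q n * real (card V) \<le> \<kappa> / 4 * (q n * N n)"
        using mult_right_mono[OF x(3), of "q n * N n"] qn N0 V by (simp add: mult_ac)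
      have 3: "\<rho>2 * (q n * N n) * ln y - q n * (y - 1) * (\<rho>1 * N n) = \<kappa> * (q n * N n)"
        by (simp add: \<kappa>_def algebra_simps)
      show ?thesis unfolding exp_le_cancel_iff using 1 2 3 by linarith
    qed
    finally show ?case .
  qed
  moreover have "((\<lambda>n. exp (- (\<kappa> / 2 * (q n * N n)))) \<longlonglongrightarrow> 0)"
  proof -
    have "filterlim (\<lambda>n. (\<kappa> / 2 * C0) * (turan_scale r n * N n)) at_top sequentially"
      using \<open>\<kappa> > 0\<close> C0 by (intro filterlim_tendsto_pos_mult_at_top[OF tendsto_const _ qN]) auto
    hence "filterlim (\<lambda>n. - (\<kappa> / 2 * (q n * N n))) at_bot sequentially"
      by (simp add: filterlim_uminus_at_bot q_def mult_ac)
    thus ?thesis by (rule filterlim_compose[OF exp_at_bot])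
  qed
  ultimately have "pr \<longlonglongrightarrow> 0"
    by (intro tendsto_sandwich[OF _ _ tendsto_const, of 0 pr]) (auto simp: pr_def)
  thus ?thesis using C0(1) unfolding pr_def q_def N_def by blast
qed


text \<open>If \<open>G(n,q)\<close> is bad, then its sparsification \<open>G(n,q\<^sub>0)\<close> is bad with conditional probability at
  least \<open>1/2\<close>; so the estimate at \<open>q\<^sub>0\<close> suffices and no union bound over subgraphs is needed.\<close>

theorem sparse_supersaturation:
  fixes \<rho> :: real
  assumes r: "r \<ge> 3" and \<rho>: "\<rho> > (real r - 2) / (real r - 1)"
  shows "\<exists>C0\<ge>1. \<exists>\<delta>>0. \<forall>\<zeta>>0. \<forall>\<^sub>F n in sequentially. \<forall>q. C0 * turan_scale r n \<le> q \<longrightarrow> q \<le> 1 \<longrightarrow>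
     measure_pmf.prob (random_subset (nsets {1..n} 2) q)
     {G. \<exists>H. H \<subseteq> G \<and> real (card H) \<ge> \<rho> * (q * real (n choose 2)) \<and>
         real (card (cliques r {1..n} H)) < \<delta> * real n ^ r * q ^ (r choose 2)} \<le> \<zeta>"
proof -
  define \<pi> where "\<pi> = (real r - 2) / (real r - 1)"
  have \<pi>: "\<pi> > 0" using r by (auto simp: \<pi>_def)
  \<comment> \<open>The threshold theorem is used at a smaller density, which leaves edges to be
    lost in sparsifying and in deleting cliques.\<close>
  define \<rho>2 where "\<rho>2 = (\<pi> + \<rho>) / 2"
  have \<rho>s: "\<pi> < \<rho>2" "\<rho>2 < \<rho>" "0 < \<rho>2" using \<rho> \<pi> by (auto simp: \<rho>2_def \<pi>_def[symmetric])
  define k where "k = r choose 2"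
  have k: "k \<ge> 3" unfolding k_def using r by (rule choose_two_ge_3)
  have "\<rho>2 > (real r - 2) / (real r - 1)" using \<rho>s by (simp add: \<pi>_def)
  from random_turan_threshold[OF r this] obtain C0 where C0: "C0 \<ge> 1" and lim:
    "(\<lambda>n. measure_pmf.prob (random_subset (nsets {1..n} 2) (C0 * turan_scale r n))
     {R. \<exists>H. H \<subseteq> R \<and> cliques r {1..n} H = {} \<and>
         real (card H) \<ge> \<rho>2 * (C0 * turan_scale r n * real (n choose 2))}) \<longlonglongrightarrow> 0" by blast
  \<comment> \<open>Sparsifying \<open>H\<close> with relative error \<open>\<eta>\<close> leaves at
    least \<open>(\<rho> + \<rho>2) / 2\<close> in units of \<open>Q * N\<close>; deleting fewer
    than \<open>t = (\<rho> - \<rho>2) / 2 * (Q * N)\<close> edges then leaves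
    \<open>\<rho>2\<close>.\<close>
  define \<eta> where "\<eta> = (\<rho> - \<rho>2) / (2 * \<rho>)"
  have \<eta>: "0 < \<eta>" "\<eta> < 1" "(1 - \<eta>) * \<rho> = (\<rho> + \<rho>2) / 2" using \<rho>s by (auto simp: \<eta>_def field_simps)
  \<comment> \<open>Chosen so that Markov bounds the probability of \<open>t\<close> or more
    surviving cliques by exactly \<open>1/4\<close>: the \<open>32\<close> is
    \<open>4 * 2 * 4\<close>, from \<open>n\<^sup>2 \<le> 4 * N\<close>, the halving in
    \<open>t\<close>, and the target.\<close>
  define \<delta> where "\<delta> = (\<rho> - \<rho>2) / (32 * C0 ^ (k - 1))"
  have \<delta>: "\<delta> > 0" using \<rho>s C0 by (simp add: \<delta>_def)
  define q0 where "q0 n = C0 * turan_scale r n" for n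
  define N where "N n = real (n choose 2)" for n
  have qN: "filterlim (\<lambda>n. turan_scale r n * N n) at_top sequentially"
    unfolding N_def using r by (intro turan_scale_mult_choose_at_top) auto
  show ?thesis
  proof (rule exI[of _ C0], rule conjI[OF C0], rule exI[of _ \<delta>], rule conjI[OF \<delta>], intro allI impI)
    fix \<zeta> :: real assume \<zeta>: "\<zeta> > 0"
    have "\<forall>\<^sub>F n in sequentially. measure_pmf.prob (random_subset (nsets {1..n} 2) (C0 * turan_scale r n))
     {R. \<exists>H. H \<subseteq> R \<and> cliques r {1..n} H = {} \<and>
         real (card H) \<ge> \<rho>2 * (C0 * turan_scale r n * real (n choose 2))} < \<zeta> / 2"
      using lim \<zeta> by (intro order_tendstoD) auto
    moreover have "\<forall>\<^sub>F n in sequentially. turan_scale r n * N n \<ge> 4 / (\<eta>\<^sup>2 * \<rho>)"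
      using qN by (simp add: filterlim_at_top)
    ultimately show "\<forall>\<^sub>F n in sequentially. \<forall>q. C0 * turan_scale r n \<le> q \<longrightarrow> q \<le> 1 \<longrightarrow>
     measure_pmf.prob (random_subset (nsets {1..n} 2) q)
     {G. \<exists>H. H \<subseteq> G \<and> real (card H) \<ge> \<rho> * (q * real (n choose 2)) \<and>
         real (card (cliques r {1..n} H)) < \<delta> * real n ^ r * q ^ (r choose 2)} \<le> \<zeta>"
      using eventually_ge_at_top[of r]
    proof eventually_elim
      case (elim n)
      show ?case
      proof (intro allI impI)
        fix q assume hq: "C0 * turan_scale r n \<le> q" "q \<le> 1"
        define U where "U = {1..n}"
        define V where "V = nsets U 2"
        define \<tau> where "\<tau> = turan_scale r n"
        define Q where "Q = q0 n"
        define \<alpha> where "\<alpha> = Q / q"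
        define E where "E = {R. \<exists>H. H \<subseteq> R \<and> cliques r U H = {} \<and> real (card H) \<ge> \<rho>2 * (Q * N n)}"
        define B where "B = {G. \<exists>H. H \<subseteq> G \<and> real (card H) \<ge> \<rho> * (q * N n) \<and>
           real (card (cliques r U H)) < \<delta> * real n ^ r * q ^ k}"
        have U: "finite U" "card U = n" by (auto simp: U_def)
        have V: "finite V" using U by (auto simp: V_def finite_imp_finite_nsets)
        have n: "n \<ge> 1" "n \<ge> 2" using elim r by linarith+
        have \<tau>: "0 < \<tau>" using turan_scale_bounds[OF n(1)] by (simp add: \<tau>_def)
        have Q: "0 < Q" "Q \<le> q" "Q \<ge> \<tau>" using \<tau> C0 hq by (auto simp: q0_def \<tau>_def Q_def)
        have q: "0 < q" "q \<le> 1" using Q hq by linarith+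
        have \<alpha>: "0 < \<alpha>" "\<alpha> \<le> 1" "q * \<alpha> = Q" using Q q by (auto simp: \<alpha>_def)
        have N0: "N n > 0" using n by (simp add: N_def zero_less_binomial)
        have N4: "real n ^ 2 \<le> 4 * N n"
          using n by (simp add: N_def real_choose_two power2_eq_square field_simps)
        \<comment> \<open>For fixed \<open>G\<close> a single witness \<open>H\<close> is fixed
          before \<open>R\<close> is drawn, so first and second moments for this one
          \<open>H\<close> suffice.\<close>
        have key: "measure_pmf.prob (random_subset V \<alpha>) {R. G \<inter> R \<in> E} \<ge> 1 / 2"
          if G: "G \<subseteq> V" "G \<in> B" for G
        proof -
          obtain H where H: "H \<subseteq> G" "real (card H) \<ge> \<rho> * (q * N n)"
            "real (card (cliques r U H)) < \<delta> * real n ^ r * q ^ k" using G by (auto simp: B_def)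
          have HV: "H \<subseteq> V" using H G by auto
          have finH: "finite H" using HV V finite_subset by blast
          have \<alpha>H: "\<alpha> * real (card H) \<ge> \<rho> * (Q * N n)"
          proof -
            have "\<rho> * (Q * N n) = \<alpha> * (\<rho> * (q * N n))" using \<alpha>(3) by (simp add: mult_ac)
            also have "\<dots> \<le> \<alpha> * real (card H)" using \<alpha> H by (intro mult_left_mono) auto
            finally show ?thesis .
          qed
          have \<rho>QN: "\<rho> * (Q * N n) > 0" using \<rho>s Q N0 by simp
          define X1 where "X1 = {R. \<bar>real (card (R \<inter> H)) - \<alpha> * real (card H)\<bar> \<ge> \<eta> * (\<alpha> * real (card H))}"
          define t where "t = (\<rho> - \<rho>2) / 2 * (Q * N n)"
          define X2 where "X2 = {R. real (card (cliques r U (R \<inter> H))) \<ge> t}"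
          have t: "t > 0" using \<rho>s Q N0 by (simp add: t_def)
          have p1: "measure_pmf.prob (random_subset V \<alpha>) X1 \<le> 1 / 4"
          proof -
            have "measure_pmf.prob (random_subset V \<alpha>) X1 \<le> \<alpha> * real (card H) / (\<eta> * (\<alpha> * real (card H)))\<^sup>2"
              unfolding X1_def using V \<alpha> HV \<eta> \<alpha>H \<rho>QN
              by (intro random_subset_concentration) (auto intro!: mult_pos_pos)
            also have "\<dots> = 1 / (\<eta>\<^sup>2 * (\<alpha> * real (card H)))"
              using \<alpha>H \<rho>QN by (simp add: power2_eq_square)
            also have "\<dots> \<le> 1 / (\<eta>\<^sup>2 * (\<rho> * (\<tau> * N n)))"
            proof -
              have "\<rho> * (\<tau> * N n) \<le> \<rho> * (Q * N n)" using \<rho>s Q N0 by (intro mult_left_mono mult_right_mono) auto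
              hence "\<eta>\<^sup>2 * (\<rho> * (\<tau> * N n)) \<le> \<eta>\<^sup>2 * (\<alpha> * real (card H))" using \<alpha>H by (intro mult_left_mono) auto
              moreover have "\<eta>\<^sup>2 * (\<rho> * (\<tau> * N n)) > 0" using \<eta> \<rho>s \<tau> N0 by simp
              ultimately show ?thesis by (intro frac_le) auto
            qed
            also have "\<dots> \<le> 1 / 4"
            proof -
              have "4 \<le> \<eta>\<^sup>2 * \<rho> * (\<tau> * N n)" using elim(2) \<eta> \<rho>s by (simp add: \<tau>_def field_simps)
              thus ?thesis using divide_left_mono[of 4 "\<eta>\<^sup>2 * \<rho> * (\<tau> * N n)" 1] by (simp add: mult.assoc)
            qed
            finally show ?thesis .
          qed
          have p2: "measure_pmf.prob (random_subset V \<alpha>) X2 \<le> 1 / 4"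
          proof -
            let ?K = "cliques r U H"
            have finK: "finite ?K" using U by simp
            have "measure_pmf.prob (random_subset V \<alpha>) X2
                \<le> measure_pmf.expectation (random_subset V \<alpha>) (\<lambda>R. real (card (cliques r U (R \<inter> H)))) / t"
              unfolding X2_def using V t by (intro prob_markov) auto
            also have "(\<lambda>R. real (card (cliques r U (R \<inter> H)))) = (\<lambda>R. real (card {X\<in>?K. nsets X 2 \<subseteq> R}))"
              by (intro ext arg_cong[where f = "\<lambda>S. real (card S)"]) (auto simp: cliques_def)
            also have "measure_pmf.expectation (random_subset V \<alpha>) \<dots>
                = (\<Sum>X\<in>?K. measure_pmf.prob (random_subset V \<alpha>) {R. nsets X 2 \<subseteq> R})"
              using V finK by (intro expectation_count) auto
            also have "\<dots> = (\<Sum>X\<in>?K. \<alpha> ^ k)"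
            proof (intro sum.cong refl)
              fix X assume X: "X \<in> ?K"
              hence "nsets X 2 \<subseteq> V" "card (nsets X 2) = k"
                using HV by (auto simp: cliques_def nsets_def[of U] k_def)
              thus "measure_pmf.prob (random_subset V \<alpha>) {R. nsets X 2 \<subseteq> R} = \<alpha> ^ k"
                using prob_superset_random_subset[OF V, of \<alpha> "nsets X 2"] \<alpha> by simp
            qed
            also have "\<dots> = real (card ?K) * \<alpha> ^ k" by simp
            also have "\<dots> / t \<le> (\<delta> * real n ^ r * q ^ k) * \<alpha> ^ k / t"
              using H(3) \<alpha> t by (intro divide_right_mono mult_right_mono) auto
            also have "\<delta> * real n ^ r * q ^ k * \<alpha> ^ k = \<delta> * (real n ^ r * Q ^ k)"
              using \<alpha>(3) by (simp add: power_mult_distrib[symmetric] mult.assoc)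
            \<comment> \<open>On the Turan scale cliques are only a constant factor more numerous
              than edges, which makes the deletion affordable for small
              \<open>\<delta>\<close>.\<close>
            also have "real n ^ r * Q ^ k = C0 ^ (k - 1) * Q * real n ^ 2"
            proof -
              have "real n ^ (r - 2) * \<tau> ^ (k - 1) = 1"
                unfolding \<tau>_def k_def using n r by (intro turan_scale_power) auto
              hence "real n ^ (r - 2) * Q ^ (k - 1) = C0 ^ (k - 1)"
                by (simp add: Q_def q0_def \<tau>_def[symmetric] power_mult_distrib)
              thus ?thesis unfolding k_def clique_count_eq[OF r] by (simp add: mult_ac)
            qed
            also have "\<delta> * (C0 ^ (k - 1) * Q * real n ^ 2) / t \<le> \<delta> * (C0 ^ (k - 1) * Q * (4 * N n)) / t"
              using \<delta> C0 Q N4 t by (intro divide_right_mono mult_left_mono) auto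
            also have "\<dots> = 1 / 4"
              using \<rho>s C0 Q N0 by (simp add: \<delta>_def t_def)
            finally show ?thesis .
          qed
          have "UNIV - (X1 \<union> X2) \<subseteq> {R. G \<inter> R \<in> E}"
          proof
            fix R assume R: "R \<in> UNIV - (X1 \<union> X2)"
            let ?K = "cliques r U (R \<inter> H)"
            have "\<alpha> * real (card H) - real (card (R \<inter> H)) < \<eta> * (\<alpha> * real (card H))" using R by (auto simp: X1_def)
            hence "real (card (R \<inter> H)) \<ge> (1 - \<eta>) * (\<alpha> * real (card H))" by (simp add: algebra_simps)
            moreover have "(1 - \<eta>) * (\<alpha> * real (card H)) \<ge> (1 - \<eta>) * (\<rho> * (Q * N n))"
              using \<alpha>H \<eta> by (intro mult_left_mono) auto
            moreover have "(1 - \<eta>) * (\<rho> * (Q * N n)) = (\<rho> + \<rho>2) / 2 * (Q * N n)"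
              using \<eta>(3) by (simp only: mult.assoc[symmetric])
            moreover have "real (card ?K) < t" using R by (auto simp: X2_def)
            ultimately have big: "real (card (R \<inter> H)) - real (card ?K) \<ge> \<rho>2 * (Q * N n)"
              by (simp add: t_def field_simps)
            have "nsets X 2 \<noteq> {}" if "X \<in> ?K" for X
              using that r by (auto simp: cliques_def nsets_def[of U] nsets_eq_empty_iff)
            then obtain H' where H': "H' \<subseteq> R \<inter> H" "card (R \<inter> H) \<le> card H' + card ?K" "\<forall>X\<in>?K. \<not> nsets X 2 \<subseteq> H'"
              using clique_removal[of "R \<inter> H" ?K] finH U by auto
            have "cliques r U H' = {}" using H' by (auto simp: cliques_def)
            moreover have "real (card H') \<ge> \<rho>2 * (Q * N n)" using H'(2) big by linarith
            moreover have "H' \<subseteq> G \<inter> R" using H'(1) H(1) by blast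
            ultimately have "G \<inter> R \<in> E" unfolding E_def by blast
            thus "R \<in> {R. G \<inter> R \<in> E}" by blast
          qed
          hence "measure_pmf.prob (random_subset V \<alpha>) (UNIV - (X1 \<union> X2)) \<le> measure_pmf.prob (random_subset V \<alpha>) {R. G \<inter> R \<in> E}"
            by (intro measure_pmf.finite_measure_mono) auto
          moreover have "measure_pmf.prob (random_subset V \<alpha>) (UNIV - (X1 \<union> X2)) = 1 - measure_pmf.prob (random_subset V \<alpha>) (X1 \<union> X2)"
            using measure_pmf.prob_compl[of "X1 \<union> X2" "random_subset V \<alpha>"] by simp
          moreover have "measure_pmf.prob (random_subset V \<alpha>) (X1 \<union> X2) \<le> 1 / 4 + 1 / 4"
            using p1 p2 measure_Un_le[of X1 "random_subset V \<alpha>" X2] by simp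
          ultimately show ?thesis by simp
        qed
        have "measure_pmf.prob (random_subset V q) B / 2 = measure_pmf.expectation (random_subset V q) (\<lambda>G. (if G \<in> B then 1 else 0) / 2)"
          unfolding prob_eq_expectation by simp
        also have "\<dots> \<le> measure_pmf.expectation (random_subset V q) (\<lambda>G. measure_pmf.prob (random_subset V \<alpha>) {R. G \<inter> R \<in> E})"
          using V key set_random_subset[of V q] by (intro expectation_mono_finite) auto
        also have "\<dots> = measure_pmf.prob (pair_pmf (random_subset V q) (random_subset V \<alpha>)) {(G, R). G \<inter> R \<in> E}"
          by (simp add: prob_pair_pmf)
        also have "\<dots> = measure_pmf.prob (map_pmf (\<lambda>(G, R). G \<inter> R) (pair_pmf (random_subset V q) (random_subset V \<alpha>))) E"
          by (simp add: vimage_def case_prod_unfold)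
        also have "\<dots> = measure_pmf.prob (random_subset V Q) E"
          using V q \<alpha> by (subst random_subset_Int) auto
        also have "\<dots> < \<zeta> / 2" using elim(1) by (simp add: V_def U_def E_def Q_def q0_def N_def)
        finally show "measure_pmf.prob (random_subset (nsets {1..n} 2) q)
       {G. \<exists>H. H \<subseteq> G \<and> real (card H) \<ge> \<rho> * (q * real (n choose 2)) \<and>
           real (card (cliques r {1..n} H)) < \<delta> * real n ^ r * q ^ (r choose 2)} \<le> \<zeta>"
          by (simp add: V_def U_def B_def N_def k_def)
      qed
    qed
  qed
qed

section \<open>Above the threshold\<close>

text \<open>By \<open>(r + 1) / 2 * (r - 2) = (r choose 2) - 1\<close>, \<open>theta\<close> is the
  inverse of \<open>x\<close> in \<open>ennreal\<close>. At \<open>x = 0\<close> it is infinite: the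
  upper bound on \<open>p * x\<close> is then trivial, and the hypothesis of the lower bound
  contradicts that \<open>p\<close> is real.\<close>

lemma theta_bounds:
  assumes r: "r \<ge> 3" and q: "0 \<le> q n" and p: "0 \<le> (p::real)"
  defines "x \<equiv> real n ^ (r - 2) * q n ^ ((r choose 2) - 1)"
  shows "c > 0 \<Longrightarrow> ennreal p \<le> ennreal c * theta r q n \<Longrightarrow> p * x \<le> c"
    and "c > 0 \<Longrightarrow> ennreal p \<ge> ennreal c * theta r q n \<Longrightarrow> p * x \<ge> c"
proof -
  have k: "r choose 2 \<ge> 3" using r by (rule choose_two_ge_3)
  have x0: "x \<ge> 0" using q by (simp add: x_def)
  have "(q n powr ((real r + 1) / 2)) ^ (r - 2) = q n ^ ((r choose 2) - 1)"
  proof (cases "q n = 0")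
    case True
    have "r - 2 > 0" "(r choose 2) - 1 > 0" using r k by auto
    thus ?thesis using True by (simp add: power_0_left)
  next
    case False
    hence q0: "q n > 0" using q by simp
    have "(real r + 1) / 2 * real (r - 2) = real ((r choose 2) - 1)"
      using k real_choose_two[of r] r by (simp add: of_nat_diff field_simps)
    thus ?thesis using q0 by (simp add: powr_realpow[symmetric] powr_powr)
  qed
  hence "(real n * q n powr ((real r + 1) / 2)) ^ (r - 2) = x"
    by (simp add: x_def power_mult_distrib)
  hence th: "theta r q n = inverse (ennreal x)"
    by (simp add: theta_def ennreal_power)
  have pos: "theta r q n = ennreal (1 / x)" if "x > 0"
    using that by (simp add: th inverse_ennreal inverse_eq_divide)
  show "p * x \<le> c" if c: "c > 0" "ennreal p \<le> ennreal c * theta r q n"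
  proof (cases "x = 0")
    case False
    hence x: "x > 0" using x0 by simp
    have "ennreal p \<le> ennreal (c * (1 / x))" using c x by (simp add: pos ennreal_mult[symmetric])
    hence "p \<le> c / x" using c x by (subst (asm) ennreal_le_iff) auto
    thus ?thesis using x by (simp add: field_simps)
  qed (use c in simp)
  show "p * x \<ge> c" if c: "c > 0" "ennreal p \<ge> ennreal c * theta r q n"
  proof (cases "x = 0")
    case True
    hence "theta r q n = \<infinity>" by (simp add: th)
    hence "ennreal p = \<infinity>" using c by (simp add: ennreal_mult_top top_unique)
    thus ?thesis by simp
  next
    case False
    hence x: "x > 0" using x0 by simp
    have "ennreal (c * (1 / x)) \<le> ennreal p" using c x by (simp add: pos ennreal_mult[symmetric])
    hence "c / x \<le> p" using p by (subst (asm) ennreal_le_iff) auto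
    thus ?thesis using x by (simp add: field_simps)
  qed
qed

lemma not_turannical_disjoint:
  assumes "\<not> turannical r \<epsilon> F G"
  shows "\<exists>H\<subseteq>G. real (card H) > (1 + \<epsilon>) * ((real r - 2) / (real r - 1)) * real (card G) \<and> F \<inter> cliques r U H = {}"
  using assms unfolding turannical_def cliques_def nsets_def[of U] by blast

text \<open>At most \<open>2 ^ card G\<close> subgraphs, each missed by all hyperedges with
  probability at most \<open>(1 - p) ^ m \<le> exp (- p * m)\<close>. The graph is fixed, so its
  cliques are a fixed set of potential hyperedges.\<close>

lemma prob_disjoint_cliques_le:
  assumes U: "finite U" and p: "0 \<le> p" "p \<le> 1" and G: "finite G"
    and m: "\<And>H. H \<subseteq> G \<Longrightarrow> P H \<Longrightarrow> real (card (cliques r U H)) \<ge> m"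
  shows "measure_pmf.prob (random_subset (nsets U r) p) {F. \<exists>H. H \<subseteq> G \<and> P H \<and> F \<inter> cliques r U H = {}}
    \<le> exp (real (card G) - p * m)"
proof -
  let ?M = "random_subset (nsets U r) p"
  have finE: "finite (nsets U r)" using U by (simp add: finite_imp_finite_nsets)
  let ?S = "{H \<in> Pow G. P H}"
  have finS: "finite ?S" using G by simp
  have "{F. \<exists>H. H \<subseteq> G \<and> P H \<and> F \<inter> cliques r U H = {}} = (\<Union>H\<in>?S. {F. F \<inter> cliques r U H = {}})" by auto
  hence "measure_pmf.prob ?M {F. \<exists>H. H \<subseteq> G \<and> P H \<and> F \<inter> cliques r U H = {}}
      \<le> (\<Sum>H\<in>?S. measure_pmf.prob ?M {F. F \<inter> cliques r U H = {}})"
    using finS by (simp add: measure_UNION_le)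
  also have "\<dots> \<le> (\<Sum>H\<in>?S. exp (- (p * m)))"
  proof (intro sum_mono)
    fix H assume H: "H \<in> ?S"
    have "measure_pmf.prob ?M {F. F \<inter> cliques r U H = {}} = (1 - p) ^ card (cliques r U H)"
      using finE p by (intro prob_disjoint_random_subset) (auto simp: cliques_def)
    also have "\<dots> \<le> exp (- p) ^ card (cliques r U H)"
      using p exp_ge_add_one_self[of "- p"] by (intro power_mono) auto
    also have "\<dots> = exp (- (p * real (card (cliques r U H))))" by (simp add: exp_of_nat_mult[symmetric] mult.commute)
    also have "\<dots> \<le> exp (- (p * m))" using p m H by (auto intro!: mult_left_mono)
    finally show "measure_pmf.prob ?M {F. F \<inter> cliques r U H = {}} \<le> exp (- (p * m))" .
  qed
  also have "\<dots> = real (card ?S) * exp (- (p * m))" by simp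
  also have "\<dots> \<le> exp (real (card G)) * exp (- (p * m))"
  proof (intro mult_right_mono)
    have "card ?S \<le> 2 ^ card G" using card_mono[of "Pow G" ?S] G by (auto simp: card_Pow)
    hence "real (card ?S) \<le> real (2 ^ card G)" by (simp only: of_nat_le_iff)
    also have "\<dots> = 2 ^ card G" by simp
    also have "\<dots> \<le> exp 1 ^ card G" using exp_ge_add_one_self[of 1] by (intro power_mono) auto
    also have "\<dots> = exp (real (card G))" by (simp add: exp_of_nat_mult[symmetric])
    finally show "real (card ?S) \<le> exp (real (card G))" .
  qed simp
  also have "\<dots> = exp (real (card G) - p * m)" by (simp add: exp_diff exp_minus field_simps)
  finally show ?thesis .
qed

lemma square_le_4_choose: "n \<ge> 2 \<Longrightarrow> (real n)\<^sup>2 \<le> 4 * real (n choose 2)"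
  by (simp add: real_choose_two power2_eq_square field_simps)

theorem turannical_above_threshold:
  fixes \<epsilon> :: real
  assumes r: "r \<ge> 3" and \<epsilon>: "0 < \<epsilon>"
  shows "\<exists>C>0. \<forall>p q. (\<forall>n. 0 \<le> p n \<and> p n \<le> 1) \<longrightarrow> (\<forall>n. 0 \<le> q n \<and> q n \<le> 1) \<longrightarrow>
    (\<forall>\<^sub>F n in sequentially. p n * (real n ^ (r - 2) * q n ^ ((r choose 2) - 1)) \<ge> C) \<longrightarrow>
    (\<lambda>n. measure_pmf.prob (pair_pmf (random_hypergraph r n (p n)) (random_graph n (q n)))
       {(F, G). turannical r \<epsilon> F G}) \<longlonglongrightarrow> 1"
proof -
  define \<pi> where "\<pi> = (real r - 2) / (real r - 1)"
  have \<pi>: "\<pi> > 0" using r by (auto simp: \<pi>_def)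
  define k where "k = r choose 2"
  have k: "k \<ge> 3" unfolding k_def using r by (rule choose_two_ge_3)
  \<comment> \<open>Half of \<open>\<epsilon>\<close> is kept back for the fluctuation of the number
    of edges; \<open>\<eta>\<close> below is the relative error that this half tolerates.\<close>
  define \<rho> where "\<rho> = (1 + \<epsilon> / 2) * \<pi>"
  have "\<rho> > (real r - 2) / (real r - 1)" using \<epsilon> \<pi> by (simp add: \<rho>_def \<pi>_def[symmetric] algebra_simps)
  from sparse_supersaturation[OF r this] obtain C0 \<delta> where C0: "C0 \<ge> 1" and \<delta>: "\<delta> > 0" and sat:
   "\<And>\<zeta>. \<zeta> > 0 \<Longrightarrow> \<forall>\<^sub>F n in sequentially. \<forall>q. C0 * turan_scale r n \<le> q \<longrightarrow> q \<le> 1 \<longrightarrow>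
     measure_pmf.prob (random_subset (nsets {1..n} 2) q)
     {G. \<exists>H. H \<subseteq> G \<and> real (card H) \<ge> \<rho> * (q * real (n choose 2)) \<and>
         real (card (cliques r {1..n} H)) < \<delta> * real n ^ r * q ^ k} \<le> \<zeta>"
    unfolding k_def by blast
  define \<eta> where "\<eta> = \<epsilon> / 2 / (1 + \<epsilon>)"
  have \<eta>: "0 < \<eta>" "\<eta> \<le> 1" "(1 + \<epsilon>) * (1 - \<eta>) = 1 + \<epsilon> / 2" using \<epsilon> by (auto simp: \<eta>_def field_simps)
  \<comment> \<open>The first entry forces \<open>q \<ge> C0 * turan_scale r n\<close>, since
    \<open>p \<le> 1\<close>. The second makes \<open>p\<close> times the clique count at least
    \<open>4 * Q * N\<close>, twice the bound \<open>2 * Q * N\<close> for the number of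
    edges.\<close>
  define C where "C = max (C0 ^ (k - 1)) (2 / \<delta>)"
  have C: "C \<ge> C0 ^ (k - 1)" "C \<ge> 2 / \<delta>" "C > 0" using \<delta> by (auto simp: C_def less_max_iff_disj)
  have qN: "filterlim (\<lambda>n. turan_scale r n * real (n choose 2)) at_top sequentially"
    using r by (intro turan_scale_mult_choose_at_top) auto
  show ?thesis
  proof (rule exI[of _ C], rule conjI[OF C(3)], intro allI impI)
    fix p q :: "nat \<Rightarrow> real"
    assume p: "\<forall>n. 0 \<le> p n \<and> p n \<le> 1" and q: "\<forall>n. 0 \<le> q n \<and> q n \<le> 1"
      and big: "\<forall>\<^sub>F n in sequentially. p n * (real n ^ (r - 2) * q n ^ ((r choose 2) - 1)) \<ge> C"
    define M where "M n = pair_pmf (random_hypergraph r n (p n)) (random_graph n (q n))" for n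
    have "\<forall>\<^sub>F n in sequentially. measure_pmf.prob (M n) {(F, G). \<not> turannical r \<epsilon> F G} \<le> \<zeta>" if \<zeta>: "\<zeta> > 0" for \<zeta>
    proof -
      \<comment> \<open>The first entry is for the concentration of the edge count, the second makes
        \<open>exp (- (Q * N))\<close> at most \<open>\<zeta> / 3\<close>.\<close>
      have "\<forall>\<^sub>F n in sequentially. turan_scale r n * real (n choose 2) \<ge> max (3 / (\<zeta> * \<eta>\<^sup>2)) (ln (3 / \<zeta>))"
        using qN unfolding filterlim_at_top by blast
      moreover have "\<zeta> / 3 > 0" using \<zeta> by simp
      note sat[OF this]
      ultimately show ?thesis
        using big eventually_ge_at_top[of 2]
      proof eventually_elim
        case (elim n)
        define U where "U = {1..n}"
        define V where "V = nsets U 2"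
        define N where "N = real (n choose 2)"
        define Q where "Q = q n"
        have U: "finite U" "card U = n" by (auto simp: U_def)
        have V: "finite V" "real (card V) = N" using U by (auto simp: V_def N_def finite_imp_finite_nsets)
        have pn: "0 \<le> p n" "p n \<le> 1" and Q1: "0 \<le> Q" "Q \<le> 1" using p q by (auto simp: Q_def)
        have n: "n \<ge> 1" using elim by simp
        have \<tau>: "0 < turan_scale r n" using turan_scale_bounds[OF n] by simp
        have px: "p n * (real n ^ (r - 2) * Q ^ (k - 1)) \<ge> C" using elim by (simp add: Q_def k_def)
        have x: "real n ^ (r - 2) * Q ^ (k - 1) \<ge> C0 ^ (k - 1)"
        proof -
          have "C0 ^ (k - 1) \<le> p n * (real n ^ (r - 2) * Q ^ (k - 1))" using C px by linarith
          also have "\<dots> \<le> 1 * (real n ^ (r - 2) * Q ^ (k - 1))"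
            using pn Q1 by (intro mult_right_mono) auto
          finally show ?thesis by simp
        qed
        have Qge: "Q \<ge> C0 * turan_scale r n"
        proof -
          have "real n ^ (r - 2) * (C0 * turan_scale r n) ^ (k - 1) = C0 ^ (k - 1)"
            using turan_scale_power[OF n r] by (simp add: power_mult_distrib k_def mult_ac)
          hence "real n ^ (r - 2) * (C0 * turan_scale r n) ^ (k - 1) \<le> real n ^ (r - 2) * Q ^ (k - 1)" using x by simp
          hence "(C0 * turan_scale r n) ^ (k - 1) \<le> Q ^ (k - 1)" using n by simp
          thus ?thesis using Q1 k by (subst (asm) power_mono_iff) (use C0 \<tau> in auto)
        qed
        have N0: "N > 0" using elim by (simp add: N_def zero_less_binomial)
        have Q0: "Q > 0" using Qge C0 \<tau> by (smt (verit) mult_pos_pos)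
        have "turan_scale r n * N \<le> Q * N"
        proof (intro mult_right_mono)
          have "1 * turan_scale r n \<le> C0 * turan_scale r n" using C0 \<tau> by (intro mult_right_mono) auto
          thus "turan_scale r n \<le> Q" using Qge by linarith
        qed (use N0 in simp)
        hence "max (3 / (\<zeta> * \<eta>\<^sup>2)) (ln (3 / \<zeta>)) \<le> Q * N" using elim(1) unfolding N_def by (rule order_trans[rotated])
        hence QN: "Q * N \<ge> 3 / (\<zeta> * \<eta>\<^sup>2)" "Q * N \<ge> ln (3 / \<zeta>)" by simp_all
        define B1 where "B1 = {G. \<bar>real (card (G \<inter> V)) - Q * real (card V)\<bar> \<ge> \<eta> * (Q * N)}"
        define B2 where "B2 = {G. \<exists>H. H \<subseteq> G \<and> real (card H) \<ge> \<rho> * (Q * N) \<and>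
           real (card (cliques r U H)) < \<delta> * real n ^ r * Q ^ k}"
        have b1: "measure_pmf.prob (random_subset V Q) B1 \<le> \<zeta> / 3"
        proof -
          have "measure_pmf.prob (random_subset V Q) B1 \<le> Q * real (card V) / (\<eta> * (Q * N))\<^sup>2"
            unfolding B1_def using V Q1 \<eta> Q0 N0 by (intro random_subset_concentration) auto
          also have "\<dots> = 1 / (\<eta>\<^sup>2 * (Q * N))" using V(2) Q0 N0 by (simp add: power2_eq_square)
          also have "\<dots> \<le> \<zeta> / 3" using QN(1) \<eta> \<zeta> Q0 N0 by (simp add: field_simps)
          finally show ?thesis .
        qed
        have b2: "measure_pmf.prob (random_subset V Q) B2 \<le> \<zeta> / 3"
          using elim(2) Qge Q1 unfolding B2_def V_def U_def N_def by blast
        have b3: "measure_pmf.prob (random_subset (nsets U r) (p n)) {F. \<not> turannical r \<epsilon> F G} \<le> \<zeta> / 3"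
          if G: "G \<subseteq> V" "G \<notin> B1" "G \<notin> B2" for G
        proof -
          have "G \<inter> V = G" using G by auto
          hence cG: "\<bar>real (card G) - Q * N\<bar> < \<eta> * (Q * N)" using G V by (auto simp: B1_def)
          have \<eta>QN: "\<eta> * (Q * N) \<le> 1 * (Q * N)" using \<eta> Q0 N0 by (intro mult_right_mono) auto
          have low: "(1 + \<epsilon>) * \<pi> * real (card G) \<ge> \<rho> * (Q * N)"
          proof -
            have "\<rho> * (Q * N) = (1 + \<epsilon>) * \<pi> * ((1 - \<eta>) * (Q * N))"
              unfolding \<rho>_def \<eta>(3)[symmetric] by (simp add: mult_ac)
            also have "\<dots> \<le> (1 + \<epsilon>) * \<pi> * real (card G)"
              using cG \<epsilon> \<pi> by (intro mult_left_mono) (auto simp: algebra_simps)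
            finally show ?thesis .
          qed
          let ?P = "\<lambda>H. real (card H) \<ge> \<rho> * (Q * N)"
          have "measure_pmf.prob (random_subset (nsets U r) (p n)) {F. \<not> turannical r \<epsilon> F G}
             \<le> measure_pmf.prob (random_subset (nsets U r) (p n)) {F. \<exists>H. H \<subseteq> G \<and> ?P H \<and> F \<inter> cliques r U H = {}}"
          proof (intro measure_pmf.finite_measure_mono subsetI)
            fix F assume "F \<in> {F. \<not> turannical r \<epsilon> F G}"
            then obtain H where "H \<subseteq> G" "real (card H) > (1 + \<epsilon>) * \<pi> * real (card G)" "F \<inter> cliques r U H = {}"
              using not_turannical_disjoint[of r \<epsilon> F G U] unfolding \<pi>_def by blast
            moreover from this low have "?P H" by linarith
            ultimately show "F \<in> {F. \<exists>H. H \<subseteq> G \<and> ?P H \<and> F \<inter> cliques r U H = {}}" by blast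
          qed simp
          also have "\<dots> \<le> exp (real (card G) - p n * (\<delta> * real n ^ r * Q ^ k))"
          proof (rule prob_disjoint_cliques_le[OF U(1) pn])
            show "finite G" using G V finite_subset by blast
            fix H assume H: "H \<subseteq> G" "?P H"
            show "\<delta> * real n ^ r * Q ^ k \<le> real (card (cliques r U H))"
            proof (rule ccontr)
              assume "\<not> \<delta> * real n ^ r * Q ^ k \<le> real (card (cliques r U H))"
              hence "real (card (cliques r U H)) < \<delta> * real n ^ r * Q ^ k" by (rule not_le_imp_less)
              hence "G \<in> B2" unfolding B2_def using H by blast
              thus False using G(3) by contradiction
            qed
          qed
          also have "\<dots> \<le> exp (- (Q * N))"
          proof -
            have n2: "2 * N \<le> (real n)\<^sup>2" by (simp add: N_def real_choose_two power2_eq_square algebra_simps)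
            have e1: "real n ^ r * Q ^ k = (real n)\<^sup>2 * Q * (real n ^ (r - 2) * Q ^ (k - 1))"
              unfolding k_def by (rule clique_count_eq[OF r])
            have "real (card G) \<le> 2 * (Q * N)" using cG \<eta>QN by linarith
            moreover have "p n * (\<delta> * real n ^ r * Q ^ k) \<ge> 4 * (Q * N)"
            proof -
              have "2 * (2 * (Q * N)) \<le> 2 * ((real n)\<^sup>2 * Q)"
                using mult_left_mono[OF n2 Q1(1)] by (simp add: mult_ac)
              also have "\<dots> \<le> (\<delta> * C) * ((real n)\<^sup>2 * Q)"
                using C(2) \<delta> Q1 by (intro mult_right_mono) (auto simp: field_simps)
              also have "\<dots> \<le> (\<delta> * (p n * (real n ^ (r - 2) * Q ^ (k - 1)))) * ((real n)\<^sup>2 * Q)"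
                using px \<delta> Q1 by (intro mult_right_mono mult_left_mono) auto
              also have "\<dots> = p n * (\<delta> * (real n ^ r * Q ^ k))" unfolding e1 by (simp add: mult_ac)
              finally show ?thesis by (simp add: mult_ac)
            qed
            ultimately have "real (card G) - p n * (\<delta> * real n ^ r * Q ^ k) \<le> - (Q * N)"
              using Q0 N0 by (smt (verit) mult_pos_pos)
            thus ?thesis by simp
          qed
          also have "\<dots> \<le> exp (- ln (3 / \<zeta>))" using QN(2) by simp
          also have "\<dots> = \<zeta> / 3" using \<zeta> by (simp add: exp_minus)
          finally show ?thesis .
        qed
        \<comment> \<open>The pair is reversed so that the graph is drawn first and the hypergraph
          is averaged for fixed \<open>G\<close>.\<close>
        have "measure_pmf.prob (M n) {(F, G). \<not> turannical r \<epsilon> F G}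
            = measure_pmf.prob (pair_pmf (random_subset V Q) (random_subset (nsets U r) (p n))) {(G, F). \<not> turannical r \<epsilon> F G}"
          unfolding M_def random_hypergraph_eq V_def U_def Q_def
          by (subst pair_commute_pmf) (simp add: vimage_def case_prod_unfold)
        also have "\<dots> = measure_pmf.expectation (random_subset V Q)
            (\<lambda>G. measure_pmf.prob (random_subset (nsets U r) (p n)) {F. \<not> turannical r \<epsilon> F G})"
          by (simp add: prob_pair_pmf)
        also have "\<dots> \<le> measure_pmf.expectation (random_subset V Q)
            (\<lambda>G. (if G \<in> B1 then 1 else 0) + (if G \<in> B2 then 1 else 0) + \<zeta> / 3)"
        proof (rule expectation_mono_finite)
          fix G assume "G \<in> set_pmf (random_subset V Q)"
          hence G: "G \<subseteq> V" using set_random_subset by blast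
          have le1: "measure_pmf.prob (random_subset (nsets U r) (p n)) {F. \<not> turannical r \<epsilon> F G} \<le> 1"
            by (rule measure_pmf.prob_le_1)
          show "measure_pmf.prob (random_subset (nsets U r) (p n)) {F. \<not> turannical r \<epsilon> F G}
              \<le> (if G \<in> B1 then 1 else 0) + (if G \<in> B2 then 1 else 0) + \<zeta> / 3"
          proof (cases "G \<in> B1 \<or> G \<in> B2")
            case True
            hence "(1::real) \<le> (if G \<in> B1 then 1 else 0) + (if G \<in> B2 then 1 else 0)" by auto
            thus ?thesis using le1 \<zeta> by linarith
          next
            case False thus ?thesis using b3[OF G] by auto
          qed
        qed (use V in simp)
        also have "\<dots> = measure_pmf.prob (random_subset V Q) B1 + measure_pmf.prob (random_subset V Q) B2 + \<zeta> / 3"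
          unfolding prob_eq_expectation[of _ B1] prob_eq_expectation[of _ B2]
          using V by (simp add: integrable_measure_pmf_finite)
        also have "\<dots> \<le> \<zeta>" using b1 b2 by simp
        finally show ?case .
      qed
    qed
    moreover have "measure_pmf.prob (M n) {(F, G). \<not> turannical r \<epsilon> F G} = 1 - measure_pmf.prob (M n) {(F, G). turannical r \<epsilon> F G}" for n
    proof -
      have "{(F, G). \<not> turannical r \<epsilon> F G} = space (M n) - {(F, G). turannical r \<epsilon> F G}" by auto
      thus ?thesis by (simp only: measure_pmf.prob_compl sets_measure_pmf UNIV_I)
    qed
    ultimately have ev: "\<forall>\<^sub>F n in sequentially. measure_pmf.prob (M n) {(F, G). turannical r \<epsilon> F G} \<ge> 1 - \<zeta>" if "\<zeta> > 0" for \<zeta>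
      using that by (simp add: algebra_simps)
    show "(\<lambda>n. measure_pmf.prob (pair_pmf (random_hypergraph r n (p n)) (random_graph n (q n)))
       {(F, G). turannical r \<epsilon> F G}) \<longlonglongrightarrow> 1"
      unfolding M_def[symmetric]
    proof (rule order_tendstoI)
      fix a :: real assume "a < 1"
      hence "(1 - a) / 2 > 0" by simp
      from ev[OF this] show "\<forall>\<^sub>F n in sequentially. a < measure_pmf.prob (M n) {(F, G). turannical r \<epsilon> F G}"
        by eventually_elim (use \<open>a < 1\<close> in \<open>simp add: field_simps\<close>)
    next
      fix a :: real assume "1 < a"
      thus "\<forall>\<^sub>F n in sequentially. measure_pmf.prob (M n) {(F, G). turannical r \<epsilon> F G} < a"
        by (intro always_eventually allI) (meson le_less_trans measure_pmf.prob_le_1)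
    qed
  qed
qed

section \<open>Below the threshold\<close>

text \<open>Merges hyperedges and edges into one random subset of a disjoint union. A clique spanned
  by a hyperedge is then a single set to be contained, and \<open>second_moment\<close>
  applies.\<close>

lemma prob_superset_Un_pair:
  assumes A: "finite A" "0 \<le> p" "p \<le> 1" and B: "finite B" "0 \<le> q" "q \<le> 1"
    and disj: "A \<inter> B = {}" and S: "S \<subseteq> A \<union> B"
  shows "measure_pmf.prob (map_pmf (\<lambda>(F, G). F \<union> G) (pair_pmf (random_subset A p) (random_subset B q))) {R. S \<subseteq> R}
    = p ^ card (S \<inter> A) * q ^ card (S \<inter> B)"
proof -
  let ?F = "random_subset A p" and ?G = "random_subset B q"
  have "measure_pmf.prob (map_pmf (\<lambda>(F, G). F \<union> G) (pair_pmf ?F ?G)) {R. S \<subseteq> R}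
      = measure_pmf.prob (pair_pmf ?F ?G) {(F, G). S \<subseteq> F \<union> G}"
    by (simp add: vimage_def case_prod_unfold)
  also have "\<dots> = measure_pmf.expectation ?F (\<lambda>F. measure_pmf.prob ?G {G. S \<subseteq> F \<union> G})"
    by (simp add: prob_pair_pmf)
  also have "\<dots> = measure_pmf.expectation ?F (\<lambda>F. (if F \<in> {F. S \<inter> A \<subseteq> F} then 1 else 0) * q ^ card (S \<inter> B))"
  proof (intro integral_cong_AE AE_pmfI)
    fix F assume "F \<in> set_pmf ?F"
    hence F: "F \<subseteq> A" using set_random_subset by blast
    have "measure_pmf.prob ?G {G. S \<subseteq> F \<union> G} = measure_pmf.expectation ?G (\<lambda>G. if G \<in> {G. S \<subseteq> F \<union> G} then 1 else 0)"
      by (rule prob_eq_expectation)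
    also have "\<dots> = measure_pmf.expectation ?G (\<lambda>G. (if F \<in> {F. S \<inter> A \<subseteq> F} then 1 else 0) * (if G \<in> {G. S \<inter> B \<subseteq> G} then 1 else 0))"
    proof (intro integral_cong_AE AE_pmfI)
      fix G assume "G \<in> set_pmf ?G"
      hence G: "G \<subseteq> B" using set_random_subset by blast
      have "S \<subseteq> F \<union> G \<longleftrightarrow> S \<inter> A \<subseteq> F \<and> S \<inter> B \<subseteq> G" using F G S disj by blast
      thus "(if G \<in> {G. S \<subseteq> F \<union> G} then 1 else 0)
          = (if F \<in> {F. S \<inter> A \<subseteq> F} then 1 else 0) * (if G \<in> {G. S \<inter> B \<subseteq> G} then 1 else (0::real))" by simp
    qed auto
    also have "\<dots> = (if F \<in> {F. S \<inter> A \<subseteq> F} then 1 else 0) * measure_pmf.prob ?G {G. S \<inter> B \<subseteq> G}"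
      unfolding prob_eq_expectation by simp
    also have "measure_pmf.prob ?G {G. S \<inter> B \<subseteq> G} = q ^ card (S \<inter> B)"
      using B by (intro prob_superset_random_subset) auto
    finally show "measure_pmf.prob ?G {G. S \<subseteq> F \<union> G} = (if F \<in> {F. S \<inter> A \<subseteq> F} then 1 else 0) * q ^ card (S \<inter> B)" .
  qed auto
  also have "\<dots> = measure_pmf.prob ?F {F. S \<inter> A \<subseteq> F} * q ^ card (S \<inter> B)"
    unfolding prob_eq_expectation by simp
  also have "measure_pmf.prob ?F {F. S \<inter> A \<subseteq> F} = p ^ card (S \<inter> A)"
    using A by (intro prob_superset_random_subset) auto
  finally show ?thesis .
qed

lemma nsets_disjoint: "r \<noteq> s \<Longrightarrow> nsets U r \<inter> nsets U s = {}"
  by (auto simp: nsets_def)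

text \<open>Two \<open>r\<close>-sets with \<open>j\<close> common vertices share
  \<open>j choose 2\<close> pairs, which raises their joint probability by
  \<open>1 / q ^ (j choose 2)\<close>, while prescribing the intersection reduces the choices by
  \<open>n ^ j\<close>. By \<open>dens\<close> such pairs amount to at most a fraction
  \<open>1 / L\<close> of the squared mean bound for each intersection, of which there are at most
  \<open>2 ^ r\<close>. The diagonal gives the first term.\<close>

lemma clique_pairs_sum_le:
  fixes U :: "'a set" and r :: nat and p q L :: real
  defines "E2 \<equiv> nsets U 2" and "Er \<equiv> nsets U r" and "k \<equiv> r choose 2"
  defines "f \<equiv> \<lambda>X. insert X (nsets X 2)"
  defines "P \<equiv> \<lambda>S. p ^ card (S \<inter> Er) * q ^ card (S \<inter> E2)"
  defines "n \<equiv> real (card U)"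
  assumes U: "finite U" and r: "r \<ge> 3" and p: "0 \<le> p" and q: "0 < q" and L: "L > 0"
    and dens: "\<And>j. 2 \<le> j \<Longrightarrow> j < r \<Longrightarrow> n ^ j * q ^ (j choose 2) \<ge> L"
  shows "(\<Sum>X\<in>Er. \<Sum>Y\<in>{Y\<in>Er. f X \<inter> f Y \<noteq> {}}. P (f X \<union> f Y)) \<le> n ^ r * q ^ k * p + 2 ^ r * (n ^ r * q ^ k * p)\<^sup>2 / L"
proof -
  have finEr: "finite Er" "finite E2" using U by (auto simp: Er_def E2_def finite_imp_finite_nsets)
  have disj: "Er \<inter> E2 = {}" using r unfolding Er_def E2_def by (intro nsets_disjoint) auto
  have n0: "n \<ge> 0" by (simp add: n_def)
  have cEr: "real (card Er) \<le> n ^ r"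
  proof -
    have "card Er \<le> card U ^ r" unfolding Er_def card_nsets by (rule choose_le_pow)
    hence "real (card Er) \<le> real (card U ^ r)" by (simp only: of_nat_le_iff)
    thus ?thesis by (simp add: n_def)
  qed
  have Int2: "f X \<inter> E2 = nsets X 2" "f X \<inter> Er = {X}" if "X \<in> Er" for X
  proof -
    have "nsets X 2 \<subseteq> E2" using that unfolding Er_def E2_def by (intro nsets_mono) (auto simp: nsets_def)
    thus "f X \<inter> E2 = nsets X 2" "f X \<inter> Er = {X}" using that disj by (auto simp: f_def)
  qed
  have fin: "finite X" "card X = r" "X \<subseteq> U" if "X \<in> Er" for X using that by (auto simp: Er_def nsets_def)
  have diag: "P (f X \<union> f X) = q ^ k * p" if "X \<in> Er" for X
    using Int2[OF that] fin[OF that] by (simp add: P_def k_def)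
  have off: "P (f X \<union> f Y) \<le> p\<^sup>2 * q ^ (2 * k) * n ^ card (X \<inter> Y) / L"
    if XY: "X \<in> Er" "Y \<in> Er" "X \<noteq> Y" "2 \<le> card (X \<inter> Y)" "card (X \<inter> Y) < r" for X Y
  proof -
    define j where "j = card (X \<inter> Y)"
    have "(f X \<union> f Y) \<inter> Er = {X, Y}" using Int2[OF XY(1)] Int2[OF XY(2)] by (auto simp: Int_Un_distrib2)
    hence c1: "card ((f X \<union> f Y) \<inter> Er) = 2" using XY by simp
    have "(f X \<union> f Y) \<inter> E2 = nsets X 2 \<union> nsets Y 2"
      using Int2[OF XY(1)] Int2[OF XY(2)] by (auto simp: Int_Un_distrib2)
    moreover have "nsets X 2 \<inter> nsets Y 2 = nsets (X \<inter> Y) 2" by (auto simp: nsets_def)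
    moreover have "card (nsets X 2 \<union> nsets Y 2) + card (nsets X 2 \<inter> nsets Y 2) = card (nsets X 2) + card (nsets Y 2)"
      using fin XY by (intro card_Un_Int[symmetric]) (auto simp: finite_imp_finite_nsets)
    ultimately have "card ((f X \<union> f Y) \<inter> E2) + (j choose 2) = 2 * k"
      using fin XY by (simp add: k_def j_def)
    hence "q ^ card ((f X \<union> f Y) \<inter> E2) * q ^ (j choose 2) = q ^ (2 * k)" by (simp add: power_add[symmetric])
    hence e: "q ^ card ((f X \<union> f Y) \<inter> E2) = q ^ (2 * k) / q ^ (j choose 2)" using q by (simp add: field_simps)
    have "1 / q ^ (j choose 2) \<le> n ^ j / L"
      using dens[of j] XY q L by (simp add: j_def field_simps)
    hence "p\<^sup>2 * q ^ (2 * k) * (1 / q ^ (j choose 2)) \<le> p\<^sup>2 * q ^ (2 * k) * (n ^ j / L)"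
      using q by (intro mult_left_mono) auto
    thus ?thesis by (simp add: P_def c1 e j_def)
  qed
  have row: "(\<Sum>Y\<in>{Y\<in>Er. f X \<inter> f Y \<noteq> {}}. P (f X \<union> f Y)) \<le> q ^ k * p + 2 ^ r * (p\<^sup>2 * q ^ (2 * k) * n ^ r / L)"
    if X: "X \<in> Er" for X
  proof -
    define JJ where "JJ = {J \<in> Pow X. 2 \<le> card J \<and> card J < r}"
    define YY where "YY = {Y \<in> Er. Y \<noteq> X \<and> 2 \<le> card (X \<inter> Y)}"
    have finJJ: "finite JJ" using fin[OF X] by (simp add: JJ_def)
    have finYY: "finite YY" using finEr by (simp add: YY_def)
    have YYr: "card (X \<inter> Y) < r" if "Y \<in> YY" for Y
    proof -
      have "Y \<in> Er" "Y \<noteq> X" using that by (auto simp: YY_def)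
      hence "X \<inter> Y \<subset> X" using fin[OF X] fin[of Y] card_subset_eq[of Y X] by auto
      thus ?thesis using psubset_card_mono[of X "X \<inter> Y"] fin[OF X] by simp
    qed
    have nn: "0 \<le> P (f X \<union> f Y)" for Y using p q by (simp add: P_def)
    have sub: "{Y\<in>Er. f X \<inter> f Y \<noteq> {}} \<subseteq> insert X YY"
    proof
      fix Y assume "Y \<in> {Y\<in>Er. f X \<inter> f Y \<noteq> {}}"
      hence Y: "Y \<in> Er" and "f X \<inter> f Y \<noteq> {}" by auto
      \<comment> \<open>As \<open>r \<ge> 3\<close>, no hyperedge is a pair. Distinct
        \<open>r\<close>-sets can thus interact only through a common pair, that is, through two
        common vertices.\<close>
      moreover have "X \<notin> nsets Y 2" "Y \<notin> nsets X 2" using fin[OF X] fin[OF Y] r by (auto simp: nsets_def)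
      ultimately have "Y = X \<or> (\<exists>e. e \<in> nsets X 2 \<and> e \<in> nsets Y 2)" by (auto simp: f_def)
      moreover have "2 \<le> card (X \<inter> Y)" if "e \<in> nsets X 2" "e \<in> nsets Y 2" for e
        using that card_mono[of "X \<inter> Y" e] fin[OF X] by (auto simp: nsets_def)
      ultimately show "Y \<in> insert X YY" using Y by (auto simp: YY_def)
    qed
    have "(\<Sum>Y\<in>{Y\<in>Er. f X \<inter> f Y \<noteq> {}}. P (f X \<union> f Y)) \<le> (\<Sum>Y\<in>insert X YY. P (f X \<union> f Y))"
      using sub finYY nn by (intro sum_mono2) auto
    also have "\<dots> = q ^ k * p + (\<Sum>Y\<in>YY. P (f X \<union> f Y))"
      using finYY diag[OF X] by (subst sum.insert) (auto simp: YY_def)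
    also have "(\<Sum>Y\<in>YY. P (f X \<union> f Y)) \<le> (\<Sum>Y\<in>YY. p\<^sup>2 * q ^ (2 * k) * n ^ card (X \<inter> Y) / L)"
      using X YYr by (intro sum_mono off) (auto simp: YY_def)
    also have "\<dots> = (\<Sum>J\<in>JJ. \<Sum>Y\<in>{Y\<in>YY. X \<inter> Y = J}. p\<^sup>2 * q ^ (2 * k) * n ^ card (X \<inter> Y) / L)"
      using finJJ finYY YYr by (intro sum.group[symmetric]) (auto simp: JJ_def YY_def)
    also have "\<dots> \<le> (\<Sum>J\<in>JJ. p\<^sup>2 * q ^ (2 * k) * n ^ r / L)"
    proof (intro sum_mono)
      fix J assume J: "J \<in> JJ"
      hence J': "J \<subseteq> U" "card J \<le> r" using fin[OF X] by (auto simp: JJ_def)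
      have "card {Y\<in>YY. X \<inter> Y = J} \<le> card {Y \<in> nsets U r. J \<subseteq> Y}"
        using finEr by (intro card_mono) (auto simp: YY_def Er_def)
      also have "\<dots> \<le> card U ^ (r - card J)" using U J' by (rule card_supersets_le)
      finally have "real (card {Y\<in>YY. X \<inter> Y = J}) \<le> real (card U ^ (r - card J))" by (simp only: of_nat_le_iff)
      hence c: "real (card {Y\<in>YY. X \<inter> Y = J}) \<le> n ^ (r - card J)" by (simp add: n_def)
      have "(\<Sum>Y\<in>{Y\<in>YY. X \<inter> Y = J}. p\<^sup>2 * q ^ (2 * k) * n ^ card (X \<inter> Y) / L)
          = real (card {Y\<in>YY. X \<inter> Y = J}) * (p\<^sup>2 * q ^ (2 * k) * n ^ card J / L)" by simp
      also have "\<dots> \<le> n ^ (r - card J) * (p\<^sup>2 * q ^ (2 * k) * n ^ card J / L)"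
        using c q L n0 by (intro mult_right_mono) auto
      also have "\<dots> = p\<^sup>2 * q ^ (2 * k) * (n ^ (r - card J) * n ^ card J) / L" by (simp add: mult_ac)
      also have "n ^ (r - card J) * n ^ card J = n ^ r" using J' by (simp add: power_add[symmetric])
      finally show "(\<Sum>Y\<in>{Y\<in>YY. X \<inter> Y = J}. p\<^sup>2 * q ^ (2 * k) * n ^ card (X \<inter> Y) / L) \<le> p\<^sup>2 * q ^ (2 * k) * n ^ r / L" .
    qed
    also have "\<dots> = real (card JJ) * (p\<^sup>2 * q ^ (2 * k) * n ^ r / L)" by simp
    also have "\<dots> \<le> 2 ^ r * (p\<^sup>2 * q ^ (2 * k) * n ^ r / L)"
    proof (intro mult_right_mono)
      have "card JJ \<le> card (Pow X)" using fin[OF X] by (intro card_mono) (auto simp: JJ_def)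
      hence "card JJ \<le> 2 ^ r" using fin[OF X] by (simp add: card_Pow)
      hence "real (card JJ) \<le> real (2 ^ r)" by (simp only: of_nat_le_iff)
      thus "real (card JJ) \<le> 2 ^ r" by simp
    qed (use q L n0 in auto)
    finally show ?thesis by simp
  qed
  have "(\<Sum>X\<in>Er. \<Sum>Y\<in>{Y\<in>Er. f X \<inter> f Y \<noteq> {}}. P (f X \<union> f Y)) \<le> (\<Sum>X\<in>Er. q ^ k * p + 2 ^ r * (p\<^sup>2 * q ^ (2 * k) * n ^ r / L))"
    by (intro sum_mono row)
  also have "\<dots> = real (card Er) * (q ^ k * p + 2 ^ r * (p\<^sup>2 * q ^ (2 * k) * n ^ r / L))" by simp
  also have "\<dots> \<le> n ^ r * (q ^ k * p + 2 ^ r * (p\<^sup>2 * q ^ (2 * k) * n ^ r / L))"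
    using cEr p q L n0 by (intro mult_right_mono) auto
  also have "\<dots> = n ^ r * q ^ k * p + 2 ^ r * (n ^ r * q ^ k * p)\<^sup>2 / L"
    by (simp add: algebra_simps power2_eq_square mult_2_right power_add)
  finally show ?thesis .
qed

text \<open>The exponent on the right is \<open>j * (r + 2 - j) / (r + 1)\<close>, and
  \<open>j \<ge> 2\<close>, \<open>r + 2 - j \<ge> 3\<close>. So smaller cliques are expected in
  numbers growing like a power of \<open>n\<close>, which is why overlaps contribute a vanishing
  share of the variance.\<close>

lemma turan_scale_power_below:
  assumes "n \<ge> 1" "2 \<le> j" "j < r"
  shows "real n ^ j * turan_scale r n ^ (j choose 2) \<ge> real n powr (6 / (real r + 1))"
proof -
  have "6 / (real r + 1) \<le> real j + (- 2 / (real r + 1)) * real (j choose 2)"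
  proof -
    have "2 * 3 \<le> real j * (real r + 2 - real j)"
      using assms by (intro mult_mono) auto
    hence "6 / (real r + 1) \<le> real j * (real r + 2 - real j) / (real r + 1)"
      by (intro divide_right_mono) auto
    also have "\<dots> = real j + (- 2 / (real r + 1)) * real (j choose 2)"
      by (simp add: real_choose_two divide_simps) (simp add: algebra_simps)
    finally show ?thesis .
  qed
  hence "real n powr (6 / (real r + 1)) \<le> real n powr (real j + (- 2 / (real r + 1)) * real (j choose 2))"
    using assms by (intro powr_mono) auto
  also have "\<dots> = real n ^ j * turan_scale r n ^ (j choose 2)"
    unfolding turan_scale_def powr_add using assms by (simp add: powr_realpow[symmetric] powr_powr)
  finally show ?thesis .
qed

text \<open>Contraposition: with fewer such cliques, deleting one edge of each leaves a subgraph
  that violates the Turannical property. The count is phrased by containment in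
  \<open>F \<union> G\<close> to match the moment computation.\<close>

lemma turannical_imp_many_cliques:
  assumes "turannical r \<epsilon> F G" "F \<subseteq> nsets U r" "finite U" "finite G" "r \<ge> 2"
  shows "real (card G) * (1 - (1 + \<epsilon>) * ((real r - 2) / (real r - 1))) \<le> real (card {X \<in> nsets U r. insert X (nsets X 2) \<subseteq> F \<union> G})"
proof (rule ccontr)
  let ?K = "{X \<in> F. nsets X 2 \<subseteq> G}"
  have finF: "finite F" using assms finite_subset finite_imp_finite_nsets by metis
  have "card ?K \<le> card {X \<in> nsets U r. insert X (nsets X 2) \<subseteq> F \<union> G}"
    using assms(2,3) by (intro card_mono) (auto simp: finite_imp_finite_nsets)
  moreover assume "\<not> real (card G) * (1 - (1 + \<epsilon>) * ((real r - 2) / (real r - 1))) \<le> real (card {X \<in> nsets U r. insert X (nsets X 2) \<subseteq> F \<union> G})"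
  ultimately have few: "real (card G) * (1 - (1 + \<epsilon>) * ((real r - 2) / (real r - 1))) > real (card ?K)" by linarith
  have "nsets X 2 \<noteq> {}" if "X \<in> ?K" for X
    using that assms(2,5) by (auto simp: nsets_def[of U] nsets_eq_empty_iff)
  then obtain H where H: "H \<subseteq> G" "card G \<le> card H + card ?K" "\<forall>X\<in>?K. \<not> nsets X 2 \<subseteq> H"
    using clique_removal[OF assms(4), of ?K] finF by auto
  have "real (card H) > (1 + \<epsilon>) * ((real r - 2) / (real r - 1)) * real (card G)"
    using few H(2) by (simp add: algebra_simps)
  then obtain X where "X \<in> F" "nsets X 2 \<subseteq> H" using assms(1) H(1) unfolding turannical_def by blast
  with H(1,3) show False by blast
qed

theorem turannical_below_threshold:
  fixes \<epsilon> :: real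
  assumes r: "r \<ge> 3" and \<epsilon>: "\<epsilon> < 1 / (real r - 2)"
  shows "\<exists>c>0. \<forall>p q. (\<forall>n. 0 \<le> p n \<and> p n \<le> 1) \<longrightarrow> (\<forall>n. 0 \<le> q n \<and> q n \<le> 1) \<longrightarrow>
    filterlim (\<lambda>n. (real n)\<^sup>2 * q n) at_top sequentially \<longrightarrow>
    (\<forall>\<^sub>F n in sequentially. p n * (real n ^ (r - 2) * q n ^ ((r choose 2) - 1)) \<le> c) \<longrightarrow>
    (\<lambda>n. measure_pmf.prob (pair_pmf (random_hypergraph r n (p n)) (random_graph n (q n)))
       {(F, G). turannical r \<epsilon> F G}) \<longlonglongrightarrow> 0"
proof -
  define k where "k = r choose 2"
  have k: "k \<ge> 3" unfolding k_def using r by (rule choose_two_ge_3)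
  \<comment> \<open>The fraction of edges that may be deleted; it is positive precisely because
    \<open>\<epsilon> < 1 / (r - 2)\<close>.\<close>
  define \<kappa> where "\<kappa> = 1 - (1 + \<epsilon>) * ((real r - 2) / (real r - 1))"
  have \<kappa>: "\<kappa> > 0" using r \<epsilon> by (simp add: \<kappa>_def field_simps)
  \<comment> \<open>With this value the mean is at most \<open>4 * (Q * N) * c\<close>, which is
    half of the target \<open>t\<close> below, so reaching \<open>t\<close> is a deviation of at
    least \<open>t / 2\<close>.\<close>
  define c where "c = \<kappa> / 16"
  have c: "c > 0" using \<kappa> by (simp add: c_def)
  show ?thesis
  proof (rule exI[of _ c], rule conjI[OF c], intro allI impI)
    fix p q :: "nat \<Rightarrow> real"
    assume p: "\<forall>n. 0 \<le> p n \<and> p n \<le> 1" and q: "\<forall>n. 0 \<le> q n \<and> q n \<le> 1"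
      and lim: "filterlim (\<lambda>n. (real n)\<^sup>2 * q n) at_top sequentially"
      and small: "\<forall>\<^sub>F n in sequentially. p n * (real n ^ (r - 2) * q n ^ ((r choose 2) - 1)) \<le> c"
    define M where "M n = pair_pmf (random_hypergraph r n (p n)) (random_graph n (q n))" for n
    have main: "\<forall>\<^sub>F n in sequentially. measure_pmf.prob (M n) {(F, G). turannical r \<epsilon> F G} \<le> \<zeta>" if \<zeta>: "\<zeta> > 0" for \<zeta>
    proof -
      \<comment> \<open>The cutoff between the two moment methods. The cap at 1 makes powers of
        \<open>y1\<close> decrease in the exponent.\<close>
      define y1 where "y1 = min 1 (\<kappa> * \<zeta> / 16)"
      have y1: "0 < y1" "y1 \<le> 1" "y1 \<le> \<kappa> * \<zeta> / 16" using \<kappa> \<zeta> by (auto simp: y1_def)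
      \<comment> \<open>The constant of the off-diagonal variance term after division by the squared
        deviation; it depends on \<open>\<zeta>\<close> through \<open>y1\<close>, but not on
        \<open>n\<close>.\<close>
      define D where "D = 256 * 2 ^ r * c\<^sup>2 / (\<kappa>\<^sup>2 * y1 ^ k)"
      have pw: "filterlim (\<lambda>n. real n powr (6 / (real r + 1))) at_top sequentially"
      proof -
        define a where "a = 6 / (real r + 1)"
        have "a > 0" by (simp add: a_def)
        hence "filterlim (\<lambda>n. real n powr a) at_top sequentially" by real_asymp
        thus ?thesis by (simp add: a_def)
      qed
      have "\<forall>\<^sub>F n in sequentially. real n powr (6 / (real r + 1)) \<ge> 4 * D / \<zeta>"
        using pw unfolding filterlim_at_top by blast
      \<comment> \<open>The first entry is for the concentration of the edge count, the second for
        the diagonal variance term.\<close>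
      moreover have "\<forall>\<^sub>F n in sequentially. (real n)\<^sup>2 * q n \<ge> max (32 / \<zeta>) (1024 * c / (\<kappa>\<^sup>2 * \<zeta>))"
        using lim unfolding filterlim_at_top by blast
      ultimately show ?thesis
        using small eventually_ge_at_top[of 2]
      proof eventually_elim
        case (elim n)
        define U where "U = {1..n}"
        define V where "V = nsets U 2"
        define W where "W = nsets U r"
        define N where "N = real (n choose 2)"
        define Q where "Q = q n"
        define y where "y = real n ^ (r - 2) * Q ^ (k - 1)"
        define f where "f X = insert X (nsets X 2)" for X :: "nat set"
        define Z where "Z R = real (card {X \<in> W. f X \<subseteq> R})" for R
        define MU where "MU = map_pmf (\<lambda>(F, G). F \<union> G) (pair_pmf (random_subset W (p n)) (random_subset V Q))"
        define PP where "PP S = measure_pmf.prob MU {R. S \<subseteq> R}" for S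
        define PF where "PF S = p n ^ card (S \<inter> W) * Q ^ card (S \<inter> V)" for S
        have U: "finite U" "card U = n" by (auto simp: U_def)
        have V: "finite V" "real (card V) = N" using U by (auto simp: V_def N_def finite_imp_finite_nsets)
        have W: "finite W" using U by (auto simp: W_def finite_imp_finite_nsets)
        have disj: "W \<inter> V = {}" using r unfolding V_def W_def by (intro nsets_disjoint) auto
        have pn: "0 \<le> p n" "p n \<le> 1" and Q1: "0 \<le> Q" "Q \<le> 1" using p q by (auto simp: Q_def)
        have n: "n \<ge> 1" using elim by simp
        have N0: "N > 0" using elim by (simp add: N_def zero_less_binomial)
        have nQ: "(real n)\<^sup>2 * Q \<ge> 32 / \<zeta>" "(real n)\<^sup>2 * Q \<ge> 1024 * c / (\<kappa>\<^sup>2 * \<zeta>)"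
          using elim(2) by (simp_all add: Q_def)
        have nQ0: "(real n)\<^sup>2 * Q > 0" using nQ(1) \<zeta> by (smt (verit) divide_pos_pos)
        hence Q0: "Q > 0" using Q1 by (cases "Q = 0") auto
        have nQN: "(real n)\<^sup>2 * Q \<le> 4 * (Q * N)"
          using mult_right_mono[OF square_le_4_choose[of n] Q1(1)] elim by (simp add: N_def mult_ac)
        have QN0: "Q * N > 0" using Q0 N0 by simp
        have py: "p n * y \<le> c" using elim by (simp add: Q_def k_def y_def)
        have y0: "y \<ge> 0" using Q1 by (simp add: y_def)
        have finMU: "finite (set_pmf MU)" using V W by (simp add: MU_def)
        have fX: "f X \<subseteq> W \<union> V" "f X \<inter> W = {X}" "card (f X \<inter> V) = k" if "X \<in> W" for X
        proof -
          have "nsets X 2 \<subseteq> V" using that unfolding W_def V_def by (intro nsets_mono) (auto simp: nsets_def)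
          moreover have "X \<notin> V" "nsets X 2 \<inter> W = {}" using that disj calculation by auto
          ultimately have "f X \<subseteq> W \<union> V" "f X \<inter> W = {X}" "f X \<inter> V = nsets X 2" using that by (auto simp: f_def)
          moreover have "card X = r" using that by (auto simp: W_def nsets_def)
          ultimately show "f X \<subseteq> W \<union> V" "f X \<inter> W = {X}" "card (f X \<inter> V) = k" by (auto simp: k_def)
        qed
        have PP: "PP S = PF S" if "S \<subseteq> W \<union> V" for S
          unfolding PP_def PF_def MU_def using W V pn Q1 disj that by (intro prob_superset_Un_pair) auto
        have PX: "PP (f X) = p n * Q ^ k" if "X \<in> W" for X
          using PP[OF fX(1)[OF that]] fX[OF that] by (simp add: PF_def)
        define \<mu> where "\<mu> = (\<Sum>X\<in>W. PP (f X))"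
        have nrk: "real n ^ r * Q ^ k * p n = (real n)\<^sup>2 * Q * (p n * y)"
          unfolding k_def clique_count_eq[OF r] by (simp add: y_def k_def mult_ac)
        have \<mu>_le: "\<mu> \<le> (real n)\<^sup>2 * Q * (p n * y)"
        proof -
          have "card W \<le> n ^ r" unfolding W_def card_nsets U(2) by (rule choose_le_pow)
          hence "real (card W) \<le> real (n ^ r)" by (simp only: of_nat_le_iff)
          hence "real (card W) * (p n * Q ^ k) \<le> real n ^ r * (p n * Q ^ k)"
            using pn Q1 by (intro mult_right_mono) auto
          also have "real n ^ r * (p n * Q ^ k) = (real n)\<^sup>2 * Q * (p n * y)"
            using nrk by (simp only: mult_ac)
          finally show ?thesis using PX by (simp add: \<mu>_def)
        qed
        have EZ: "measure_pmf.expectation MU Z = \<mu>"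
          unfolding Z_def \<mu>_def PP_def using finMU W by (rule expectation_count)
        \<comment> \<open>When the edge count is at least half its mean \<open>Q * N\<close>, this
          is at most the fraction \<open>\<kappa>\<close> of the edges.\<close>
        define t where "t = \<kappa> * (Q * N) / 2"
        have t: "t > 0" using \<kappa> QN0 by (simp add: t_def)
        have b2: "measure_pmf.prob MU {R. Z R \<ge> t} \<le> \<zeta> / 2"
        \<comment> \<open>For small \<open>y\<close> the mean is below \<open>t\<close> by a factor
          of order \<open>\<zeta>\<close>, whatever \<open>p \<le> 1\<close> is, so Markov suffices.
          Otherwise \<open>Q\<close> is within a constant factor of the Turan scale or above it, and
          the overlap estimate for the variance becomes available.\<close>
        proof (cases "y \<le> \<kappa> * \<zeta> / 16")
          case True
          have "measure_pmf.prob MU {R. Z R \<ge> t} \<le> measure_pmf.expectation MU Z / t"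
            using finMU t by (intro prob_markov) (auto simp: Z_def)
          also have "\<dots> \<le> 4 * (Q * N) * (\<kappa> * \<zeta> / 16) / t"
          proof (intro divide_right_mono)
            have "p n * y \<le> 1 * y" using pn y0 by (intro mult_right_mono) auto
            hence py16: "p n * y \<le> \<kappa> * \<zeta> / 16" using True by linarith
            have "(real n)\<^sup>2 * Q * (p n * y) \<le> 4 * (Q * N) * (\<kappa> * \<zeta> / 16)"
              by (rule mult_mono[OF nQN py16]) (use QN0 pn y0 in auto)
            thus "measure_pmf.expectation MU Z \<le> 4 * (Q * N) * (\<kappa> * \<zeta> / 16)" using EZ \<mu>_le by linarith
          qed (use t in simp)
          also have "\<dots> = \<zeta> / 2" using \<kappa> Q0 N0 by (simp add: t_def)
          finally show ?thesis .
        next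
          case False
          have Qge: "Q \<ge> y1 * turan_scale r n"
          proof -
            have \<tau>: "0 < turan_scale r n" using turan_scale_bounds[OF n] by simp
            have "real n ^ (r - 2) * (y1 * turan_scale r n) ^ (k - 1) = y1 ^ (k - 1)"
              using turan_scale_power[OF n r] by (simp add: power_mult_distrib k_def mult_ac)
            also have "\<dots> \<le> y1 ^ 1" using y1 k by (intro power_decreasing) auto
            also have "\<dots> \<le> y" using y1 False by simp
            finally have "(y1 * turan_scale r n) ^ (k - 1) \<le> Q ^ (k - 1)" using n by (simp add: y_def)
            thus ?thesis using Q1 k by (subst (asm) power_mono_iff) (use y1 \<tau> in auto)
          qed
          \<comment> \<open>One power of \<open>y1\<close> for all intersection sizes:
            \<open>j choose 2 \<le> k\<close> and \<open>y1 \<le> 1\<close>.\<close>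
          define L where "L = y1 ^ k * real n powr (6 / (real r + 1))"
          have L: "L > 0" using y1 n by (simp add: L_def)
          have dens: "real n ^ j * Q ^ (j choose 2) \<ge> L" if j: "2 \<le> j" "j < r" for j
          proof -
            have \<tau>: "0 < turan_scale r n" using turan_scale_bounds[OF n] by simp
            have "j choose 2 \<le> k" unfolding k_def using j by (intro binomial_right_mono) auto
            hence "y1 ^ k \<le> y1 ^ (j choose 2)" using y1 by (intro power_decreasing) auto
            hence "L \<le> y1 ^ (j choose 2) * (real n ^ j * turan_scale r n ^ (j choose 2))"
              unfolding L_def using y1 turan_scale_power_below[OF n j] by (intro mult_mono) auto
            also have "\<dots> = real n ^ j * (y1 * turan_scale r n) ^ (j choose 2)"
              by (simp add: power_mult_distrib)
            also have "\<dots> \<le> real n ^ j * Q ^ (j choose 2)"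
              using Qge y1 \<tau> by (intro mult_left_mono power_mono) auto
            finally show ?thesis .
          qed
          have var: "(\<Sum>X\<in>W. \<Sum>Y\<in>{Y\<in>W. f X \<inter> f Y \<noteq> {}}. PP (f X \<union> f Y))
              \<le> real n ^ r * Q ^ k * p n + 2 ^ r * (real n ^ r * Q ^ k * p n)\<^sup>2 / L"
          proof -
            have "(\<Sum>X\<in>W. \<Sum>Y\<in>{Y\<in>W. f X \<inter> f Y \<noteq> {}}. PP (f X \<union> f Y))
                = (\<Sum>X\<in>W. \<Sum>Y\<in>{Y\<in>W. f X \<inter> f Y \<noteq> {}}. PF (f X \<union> f Y))"
              using fX by (intro sum.cong refl PP) auto
            also have "\<dots> \<le> real n ^ r * Q ^ k * p n + 2 ^ r * (real n ^ r * Q ^ k * p n)\<^sup>2 / L"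
              unfolding W_def f_def PF_def V_def k_def
              using clique_pairs_sum_le[OF U(1) r pn(1) Q0 L] dens U(2) by simp
            finally show ?thesis .
          qed
          have pyc: "(real n)\<^sup>2 * Q * (p n * y) \<le> 4 * (Q * N) * c"
            by (rule mult_mono) (use nQN nQ0 QN0 pn y0 py in auto)
          have "{R. Z R \<ge> t} \<subseteq> {R. \<bar>Z R - \<mu>\<bar> \<ge> t / 2}"
          proof
            fix R assume "R \<in> {R. Z R \<ge> t}"
            hence "Z R \<ge> t" by simp
            moreover have "\<mu> \<le> t / 2"
            proof -
              have "4 * (Q * N) * c = t / 2" by (simp add: c_def t_def)
              thus ?thesis using \<mu>_le pyc by linarith
            qed
            ultimately have "\<bar>Z R - \<mu>\<bar> \<ge> t / 2" by linarith
            thus "R \<in> {R. \<bar>Z R - \<mu>\<bar> \<ge> t / 2}" by simp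
          qed
          hence "measure_pmf.prob MU {R. Z R \<ge> t} \<le> measure_pmf.prob MU {R. \<bar>Z R - \<mu>\<bar> \<ge> t / 2}"
            by (intro measure_pmf.finite_measure_mono) auto
          also have "\<dots> \<le> (\<Sum>X\<in>W. \<Sum>Y\<in>{Y\<in>W. f X \<inter> f Y \<noteq> {}}. PP (f X \<union> f Y)) / (t / 2)\<^sup>2"
            unfolding Z_def \<mu>_def PP_def
          proof (rule second_moment)
            fix X Y assume XY: "X \<in> W" "Y \<in> W" "f X \<inter> f Y = {}"
            have "PF (f X \<union> f Y) = PF (f X) * PF (f Y)"
            proof -
              have fin: "finite (f X \<inter> W)" "finite (f Y \<inter> W)" "finite (f X \<inter> V)" "finite (f Y \<inter> V)" using V W by auto
              have "card ((f X \<union> f Y) \<inter> W) = card (f X \<inter> W) + card (f Y \<inter> W)"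
                using XY fin by (subst Int_Un_distrib2, intro card_Un_disjoint) auto
              moreover have "card ((f X \<union> f Y) \<inter> V) = card (f X \<inter> V) + card (f Y \<inter> V)"
                using XY fin by (subst Int_Un_distrib2, intro card_Un_disjoint) auto
              ultimately show ?thesis by (simp add: PF_def power_add)
            qed
            hence "PP (f X \<union> f Y) = PP (f X) * PP (f Y)"
              using fX[OF XY(1)] fX[OF XY(2)] by (simp add: PP)
            thus "measure_pmf.prob MU {R. f X \<union> f Y \<subseteq> R} = measure_pmf.prob MU {R. f X \<subseteq> R} * measure_pmf.prob MU {R. f Y \<subseteq> R}"
              by (simp only: PP_def)
          qed (use finMU W t in auto)
          also have "\<dots> \<le> ((real n)\<^sup>2 * Q * c + 2 ^ r * ((real n)\<^sup>2 * Q * c)\<^sup>2 / L) / (\<kappa> * ((real n)\<^sup>2 * Q) / 16)\<^sup>2"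
          proof (rule frac_le)
            have le: "real n ^ r * Q ^ k * p n \<le> (real n)\<^sup>2 * Q * c"
              unfolding nrk using py nQ0 by (intro mult_left_mono) auto
            have ge: "0 \<le> real n ^ r * Q ^ k * p n" using pn Q1 by simp
            have "2 ^ r * (real n ^ r * Q ^ k * p n)\<^sup>2 / L \<le> 2 ^ r * ((real n)\<^sup>2 * Q * c)\<^sup>2 / L"
              using le ge L by (intro divide_right_mono mult_left_mono power_mono) auto
            thus "(\<Sum>X\<in>W. \<Sum>Y\<in>{Y\<in>W. f X \<inter> f Y \<noteq> {}}. PP (f X \<union> f Y)) \<le> (real n)\<^sup>2 * Q * c + 2 ^ r * ((real n)\<^sup>2 * Q * c)\<^sup>2 / L"
              using var le by linarith
            show "(\<kappa> * ((real n)\<^sup>2 * Q) / 16)\<^sup>2 \<le> (t / 2)\<^sup>2"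
            proof (rule power_mono)
              have "\<kappa> * ((real n)\<^sup>2 * Q) \<le> \<kappa> * (4 * (Q * N))" using nQN \<kappa> by (intro mult_left_mono) auto
              moreover have "t / 2 = \<kappa> * (4 * (Q * N)) / 16" by (simp add: t_def)
              ultimately show "\<kappa> * ((real n)\<^sup>2 * Q) / 16 \<le> t / 2" by linarith
            qed (use \<kappa> nQ0 in simp)
            show "0 \<le> (real n)\<^sup>2 * Q * c + 2 ^ r * ((real n)\<^sup>2 * Q * c)\<^sup>2 / L" using nQ0 c L by simp
            show "0 < (\<kappa> * ((real n)\<^sup>2 * Q) / 16)\<^sup>2"
              using mult_pos_pos[OF \<kappa> nQ0] by (intro zero_less_power divide_pos_pos) simp_all
          qed
          also have "\<dots> = 256 * c / (\<kappa>\<^sup>2 * ((real n)\<^sup>2 * Q)) + D / real n powr (6 / (real r + 1))"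
          proof -
            define z where "z = (real n)\<^sup>2 * Q"
            have z: "z > 0" using nQ0 by (simp add: z_def)
            have pwn: "real n powr (6 / (real r + 1)) > 0" using n by simp
            show ?thesis
              unfolding z_def[symmetric] D_def L_def using z \<kappa> pwn y1
              by (simp add: power2_eq_square field_simps)
          qed
          also have "\<dots> \<le> \<zeta> / 4 + \<zeta> / 4"
          proof (intro add_mono)
            show "256 * c / (\<kappa>\<^sup>2 * ((real n)\<^sup>2 * Q)) \<le> \<zeta> / 4"
            proof -
              have "1024 * c \<le> (real n)\<^sup>2 * Q * (\<kappa>\<^sup>2 * \<zeta>)"
                using nQ(2) \<kappa> \<zeta> by (subst (asm) pos_divide_le_eq) auto
              hence "256 * c \<le> \<zeta> / 4 * (\<kappa>\<^sup>2 * ((real n)\<^sup>2 * Q))" by (simp add: mult_ac)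
              moreover have "\<kappa>\<^sup>2 * ((real n)\<^sup>2 * Q) > 0"
                using \<kappa> nQ0 by (rule mult_pos_pos[OF zero_less_power])
              ultimately show ?thesis by (simp only: pos_divide_le_eq)
            qed
            have "real n powr (6 / (real r + 1)) > 0" using n by simp
            thus "D / real n powr (6 / (real r + 1)) \<le> \<zeta> / 4"
              using elim(1) \<zeta> by (simp add: field_simps)
          qed
          finally show ?thesis by simp
        qed
        define B1 where "B1 = {G. \<bar>real (card (G \<inter> V)) - Q * real (card V)\<bar> \<ge> Q * N / 2}"
        have b1: "measure_pmf.prob (random_subset V Q) B1 \<le> \<zeta> / 2"
        proof -
          have "measure_pmf.prob (random_subset V Q) B1 \<le> Q * real (card V) / (Q * N / 2)\<^sup>2"
            unfolding B1_def using V Q1 QN0 by (intro random_subset_concentration) auto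
          also have "\<dots> = 4 / (Q * N)" using V(2) Q0 N0 by (simp add: power2_eq_square)
          also have "\<dots> \<le> \<zeta> / 2"
          proof -
            have "8 / \<zeta> \<le> Q * N" using nQ(1) nQN by simp
            thus ?thesis using \<zeta> QN0 by (simp add: field_simps)
          qed
          finally show ?thesis .
        qed
        let ?M = "pair_pmf (random_subset W (p n)) (random_subset V Q)"
        have "measure_pmf.prob (M n) {(F, G). turannical r \<epsilon> F G} = measure_pmf.prob ?M {(F, G). turannical r \<epsilon> F G}"
          unfolding M_def random_hypergraph_eq V_def U_def Q_def W_def ..
        also have "\<dots> \<le> measure_pmf.prob ?M ({(F, G). G \<in> B1} \<union> {(F, G). Z (F \<union> G) \<ge> t})"
        proof (intro measure_pmf.finite_measure_mono_AE AE_pmfI impI)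
          fix FG assume "FG \<in> set_pmf ?M" and T: "FG \<in> {(F, G). turannical r \<epsilon> F G}"
          then obtain F G where *: "FG = (F, G)" "F \<in> set_pmf (random_subset W (p n))"
            "G \<in> set_pmf (random_subset V Q)" "turannical r \<epsilon> F G" by auto
          have "F \<in> Pow W" by (rule subsetD[OF set_random_subset *(2)])
          moreover have "G \<in> Pow V" by (rule subsetD[OF set_random_subset *(3)])
          ultimately have FG: "FG = (F, G)" "F \<subseteq> W" "G \<subseteq> V" "turannical r \<epsilon> F G" using *(1,4) by auto
          have "Z (F \<union> G) \<ge> t" if "G \<notin> B1"
          proof -
            have GV: "G \<inter> V = G" using FG by auto
            have finG: "finite G" using FG V finite_subset by blast
            have "\<bar>real (card G) - Q * N\<bar> < Q * N / 2" using that V(2) by (simp add: B1_def GV)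
            hence "Q * N / 2 \<le> real (card G)" by linarith
            hence "t \<le> real (card G) * \<kappa>" using \<kappa> mult_right_mono[of "Q * N / 2" "real (card G)" \<kappa>] by (simp add: t_def mult_ac)
            also have "\<dots> \<le> Z (F \<union> G)"
              using turannical_imp_many_cliques[OF FG(4) _ U(1) finG] FG(2) r
              by (simp add: \<kappa>_def Z_def W_def f_def)
            finally show ?thesis .
          qed
          thus "FG \<in> {(F, G). G \<in> B1} \<union> {(F, G). Z (F \<union> G) \<ge> t}" using FG by auto
        qed auto
        also have "\<dots> \<le> measure_pmf.prob ?M {(F, G). G \<in> B1} + measure_pmf.prob ?M {(F, G). Z (F \<union> G) \<ge> t}"
          by (rule measure_Un_le) auto
        also have "measure_pmf.prob ?M {(F, G). G \<in> B1} = measure_pmf.prob (random_subset V Q) B1"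
          by (simp add: prob_pair_pmf)
        also have "measure_pmf.prob ?M {(F, G). Z (F \<union> G) \<ge> t} = measure_pmf.prob MU {R. Z R \<ge> t}"
          by (simp add: MU_def vimage_def case_prod_unfold)
        finally show ?case using b1 b2 by linarith
      qed
    qed
    show "(\<lambda>n. measure_pmf.prob (pair_pmf (random_hypergraph r n (p n)) (random_graph n (q n)))
       {(F, G). turannical r \<epsilon> F G}) \<longlonglongrightarrow> 0"
      unfolding M_def[symmetric]
    proof (rule order_tendstoI)
      fix a :: real assume "a < 0"
      thus "\<forall>\<^sub>F n in sequentially. a < measure_pmf.prob (M n) {(F, G). turannical r \<epsilon> F G}"
        by (intro always_eventually allI) (rule less_le_trans[OF _ measure_nonneg])
    next
      fix a :: real assume a: "0 < a"
      hence "a / 2 > 0" by simp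
      from main[OF this] show "\<forall>\<^sub>F n in sequentially. measure_pmf.prob (M n) {(F, G). turannical r \<epsilon> F G} < a"
        by eventually_elim (use a in linarith)
    qed
  qed
qed

theorem theorem2p8:
  fixes r :: nat and \<epsilon> :: real
  assumes "r \<ge> 3" and "0 < \<epsilon>" and "\<epsilon> < 1 / (real r - 2)"
  shows "\<exists>c > 0. \<exists>C > 0. \<forall>p q :: nat \<Rightarrow> real.
    (\<forall>n. 0 \<le> p n \<and> p n \<le> 1) \<longrightarrow> (\<forall>n. 0 \<le> q n \<and> q n \<le> 1) \<longrightarrow>
    (let P = (\<lambda>n. measure_pmf.prob
                (pair_pmf (random_hypergraph r n (p n)) (random_graph n (q n)))
                {(F, G). turannical r \<epsilon> F G})
     in (filterlim (\<lambda>n. (real n)\<^sup>2 * q n) at_top sequentially \<longrightarrow>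
         (\<forall>\<^sub>F n in sequentially. ennreal (p n) \<le> ennreal c * theta r q n) \<longrightarrow>
           P \<longlonglongrightarrow> 0) \<and>
        ((\<forall>\<^sub>F n in sequentially. ennreal (p n) \<ge> ennreal C * theta r q n) \<longrightarrow>
           P \<longlonglongrightarrow> 1))"
proof -
  from turannical_below_threshold[OF assms(1,3)] obtain c where c: "c > 0" and below:
    "\<forall>p q. (\<forall>n. 0 \<le> p n \<and> p n \<le> 1) \<longrightarrow> (\<forall>n. 0 \<le> q n \<and> q n \<le> 1) \<longrightarrow>
    filterlim (\<lambda>n. (real n)\<^sup>2 * q n) at_top sequentially \<longrightarrow>
    (\<forall>\<^sub>F n in sequentially. p n * (real n ^ (r - 2) * q n ^ ((r choose 2) - 1)) \<le> c) \<longrightarrow>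
    (\<lambda>n. measure_pmf.prob (pair_pmf (random_hypergraph r n (p n)) (random_graph n (q n)))
       {(F, G). turannical r \<epsilon> F G}) \<longlonglongrightarrow> 0" by (elim exE conjE)
  from turannical_above_threshold[OF assms(1,2)] obtain C where C: "C > 0" and above:
    "\<forall>p q. (\<forall>n. 0 \<le> p n \<and> p n \<le> 1) \<longrightarrow> (\<forall>n. 0 \<le> q n \<and> q n \<le> 1) \<longrightarrow>
    (\<forall>\<^sub>F n in sequentially. p n * (real n ^ (r - 2) * q n ^ ((r choose 2) - 1)) \<ge> C) \<longrightarrow>
    (\<lambda>n. measure_pmf.prob (pair_pmf (random_hypergraph r n (p n)) (random_graph n (q n)))
       {(F, G). turannical r \<epsilon> F G}) \<longlonglongrightarrow> 1" by (elim exE conjE)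
  show ?thesis
    unfolding Let_def
  proof (rule exI[of _ c], rule conjI[OF c], rule exI[of _ C], rule conjI[OF C], intro allI impI conjI)
    fix p q :: "nat \<Rightarrow> real"
    assume p: "\<forall>n. 0 \<le> p n \<and> p n \<le> 1" and q: "\<forall>n. 0 \<le> q n \<and> q n \<le> 1"
    {
      assume lim: "filterlim (\<lambda>n. (real n)\<^sup>2 * q n) at_top sequentially"
        and small: "\<forall>\<^sub>F n in sequentially. ennreal (p n) \<le> ennreal c * theta r q n"
      from small have "\<forall>\<^sub>F n in sequentially. p n * (real n ^ (r - 2) * q n ^ ((r choose 2) - 1)) \<le> c"
        by eventually_elim (use p q assms(1) c in \<open>intro theta_bounds(1), auto\<close>)
      with below p q lim show "(\<lambda>n. measure_pmf.prob (pair_pmf (random_hypergraph r n (p n)) (random_graph n (q n)))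
         {(F, G). turannical r \<epsilon> F G}) \<longlonglongrightarrow> 0" by blast
    next
      assume big: "\<forall>\<^sub>F n in sequentially. ennreal (p n) \<ge> ennreal C * theta r q n"
      from big have "\<forall>\<^sub>F n in sequentially. p n * (real n ^ (r - 2) * q n ^ ((r choose 2) - 1)) \<ge> C"
        by eventually_elim (use p q assms(1) C in \<open>intro theta_bounds(2), auto\<close>)
      with above p q show "(\<lambda>n. measure_pmf.prob (pair_pmf (random_hypergraph r n (p n)) (random_graph n (q n)))
         {(F, G). turannical r \<epsilon> F G}) \<longlonglongrightarrow> 1" by blast
    }
  qed
qed

end
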